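(* Let $R$ be a unital ring. Then $(\mathrm{V}_{\mathrm{M}}(R), \preceq_{\mathrm{M}}, \langle {}_RR\rangle_{\mathrm{M}})$ is naturally a partially ordered submonoid of $(\mathrm{U}_{\mathrm{M}}(R), \preceq_{\mathrm{M}}^{\mathrm{fg}}, \langle{}_RR\rangle_{\mathrm{M}}^{\mathrm{fg}})$; that is, the map $\langle\mathcal{M}\rangle_{\mathrm{M}}\mapsto\langle\mathcal{M}\rangle_{\mathrm{M}}^{\mathrm{fg}}$ ($\mathcal{M}$ a finitely presented left $R$-module) is a well-defined injective monoid homomorphism $\mathrm{V}_{\mathrm{M}}(R)\to\mathrm{U}_{\mathrm{M}}(R)$ sending $\langle {}_RR\rangle_{\mathrm{M}}$ to $\langle {}_RR\rangle_{\mathrm{M}}^{\mathrm{fg}}$, and for finitely presented left $R$-modules $\mathcal{M},\mathcal{N}$ one has $\langle\mathcal{M}\rangle_{\mathrm{M}}\preceq_{\mathrm{M}}\langle\mathcal{N}\rangle_{\mathrm{M}}$ if and only if $\langle\mathcal{M}\rangle_{\mathrm{M}}^{\mathrm{fg}}\preceq_{\mathrm{M}}^{\mathrm{fg}}\langle\mathcal{N}\rangle_{\mathrm{M}}^{\mathrm{fg}}$.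
   Context: All unital rings are nonzero. For left $R$-modules $\mathcal{M},\mathcal{N}$ write $\mathcal{M}\lesssim\mathcal{N}$ if one can write $\mathcal{N}=\mathcal{N}_1\oplus\mathcal{N}_2$ such that there is an exact sequence of left $R$-modules $\mathcal{N}_1\to\mathcal{M}\to\mathcal{N}_2\to0$. For finitely presented left $R$-modules $\mathcal{M},\mathcal{N}$ write $\mathcal{M}\preceq_{\mathrm{M}}\mathcal{N}$ if there are $n\ge1$ and finitely presented left $R$-modules $\mathcal{M}_1,\dots,\mathcal{M}_n$ with $\mathcal{M}=\mathcal{M}_1\lesssim\mathcal{M}_2\lesssim\dots\lesssim\mathcal{M}_n=\mathcal{N}$; write $\mathcal{M}\sim_{\mathrm{M}}\mathcal{N}$ if $\mathcal{M}\preceq_{\mathrm{M}}\mathcal{N}$ and $\mathcal{N}\preceq_{\mathrm{M}}\mathcal{M}$. $\mathrm{V}_{\mathrm{M}}(R)$ is the set of $\sim_{\mathrm{M}}$-classes $\langle\mathcal{M}\rangle_{\mathrm{M}}$ of finitely presented left $R$-modules. For finitely generated left $R$-modules $\mathcal{M},\mathcal{N}$ write $\mathcal{M}\preceq_{\mathrm{M}}^{\mathrm{fg}}\mathcal{N}$ if there are $n\ge1$ and finitely generated left $R$-modules $\mathcal{M}_1,\dots,\mathcal{M}_n$ with $\mathcal{M}=\mathcal{M}_1\lesssim\mathcal{M}_2\lesssim\dots\lesssim\mathcal{M}_n=\mathcal{N}$; write $\mathcal{M}\sim_{\mathrm{M}}^{\mathrm{fg}}\mathcal{N}$ if $\mathcal{M}\preceq_{\mathrm{M}}^{\mathrm{fg}}\mathcal{N}$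 and $\mathcal{N}\preceq_{\mathrm{M}}^{\mathrm{fg}}\mathcal{M}$. $\mathrm{U}_{\mathrm{M}}(R)$ is the set of $\sim_{\mathrm{M}}^{\mathrm{fg}}$-classes $\langle\mathcal{M}\rangle_{\mathrm{M}}^{\mathrm{fg}}$ of finitely generated left $R$-modules. Both are abelian monoids with addition induced by direct sum, identity the class of $0$, partial order induced by $\preceq_{\mathrm{M}}$ (resp. $\preceq_{\mathrm{M}}^{\mathrm{fg}}$) on representatives, and order-unit the class of ${}_RR$. *)

theory Defs
  imports "HOL-Algebra.Module"
begin

text \<open>The locale \<^locale>\<open>module\<close> requires a commutative ring, so left modules are introduced here on
  the same record type.  The fields for multiplication and one that this record inherits
  from rings play no role.  The locale \<^locale>\<open>submodule\<close> makes no commutativity assumption and is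
  used as it stands.\<close>

locale left_module = R?: ring R + M?: abelian_group M for R (structure) and M (structure) +
  assumes lsmult_closed:
      "\<lbrakk>a \<in> carrier R; x \<in> carrier M\<rbrakk> \<Longrightarrow> a \<odot>\<^bsub>M\<^esub> x \<in> carrier M"
    and lsmult_l_distr:
      "\<lbrakk>a \<in> carrier R; b \<in> carrier R; x \<in> carrier M\<rbrakk> \<Longrightarrow>
        (a \<oplus>\<^bsub>R\<^esub> b) \<odot>\<^bsub>M\<^esub> x = a \<odot>\<^bsub>M\<^esub> x \<oplus>\<^bsub>M\<^esub> b \<odot>\<^bsub>M\<^esub> x"
    and lsmult_r_distr:
      "\<lbrakk>a \<in> carrier R; x \<in> carrier M; y \<in> carrier M\<rbrakk> \<Longrightarrow>
        a \<odot>\<^bsub>M\<^esub> (x \<oplus>\<^bsub>M\<^esub> y) = a \<odot>\<^bsub>M\<^esub> x \<oplus>\<^bsub>M\<^esub> a \<odot>\<^bsub>M\<^esub> y"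
    and lsmult_assoc:
      "\<lbrakk>a \<in> carrier R; b \<in> carrier R; x \<in> carrier M\<rbrakk> \<Longrightarrow>
        (a \<otimes>\<^bsub>R\<^esub> b) \<odot>\<^bsub>M\<^esub> x = a \<odot>\<^bsub>M\<^esub> (b \<odot>\<^bsub>M\<^esub> x)"
    and lsmult_one:
      "x \<in> carrier M \<Longrightarrow> \<one>\<^bsub>R\<^esub> \<odot>\<^bsub>M\<^esub> x = x"

definition mod_hom ::
  "('a, 'r) ring_scheme \<Rightarrow> ('a, 'x) module \<Rightarrow> ('a, 'y) module \<Rightarrow> ('x \<Rightarrow> 'y) set" where
  "mod_hom R M N = {f \<in> hom (add_monoid M) (add_monoid N).
     \<forall>a\<in>carrier R. \<forall>x\<in>carrier M. f (a \<odot>\<^bsub>M\<^esub> x) = a \<odot>\<^bsub>N\<^esub> f x}"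

definition mod_ker :: "('a, 'x) module \<Rightarrow> ('a, 'y) module \<Rightarrow> ('x \<Rightarrow> 'y) \<Rightarrow> 'x set" where
  "mod_ker M N f = {x \<in> carrier M. f x = \<zero>\<^bsub>N\<^esub>}"

definition mod_isomorphic ::
  "('a, 'r) ring_scheme \<Rightarrow> ('a, 'x) module \<Rightarrow> ('a, 'y) module \<Rightarrow> bool" where
  "mod_isomorphic R M N \<longleftrightarrow> (\<exists>f\<in>mod_hom R M N. bij_betw f (carrier M) (carrier N))"

definition zero_module :: "('a, unit) module" where
  "zero_module =
    \<lparr>carrier = UNIV, mult = (\<lambda>_ _. ()), one = (), zero = (), add = (\<lambda>_ _. ()),
     smult = (\<lambda>_ _. ())\<rparr>"

definition regular_module :: "('a, 'r) ring_scheme \<Rightarrow> ('a, 'a) module" where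
  "regular_module R =
    \<lparr>carrier = carrier R, mult = mult R, one = \<one>\<^bsub>R\<^esub>, zero = \<zero>\<^bsub>R\<^esub>, add = add R,
     smult = mult R\<rparr>"

definition free_module :: "('a, 'r) ring_scheme \<Rightarrow> nat \<Rightarrow> ('a, nat \<Rightarrow> 'a) module" where
  "free_module R n =
    \<lparr>carrier = {..<n} \<rightarrow>\<^sub>E carrier R,
     mult = (\<lambda>x y. \<lambda>i\<in>{..<n}. x i \<otimes>\<^bsub>R\<^esub> y i),
     one = (\<lambda>i\<in>{..<n}. \<one>\<^bsub>R\<^esub>),
     zero = (\<lambda>i\<in>{..<n}. \<zero>\<^bsub>R\<^esub>),
     add = (\<lambda>x y. \<lambda>i\<in>{..<n}. x i \<oplus>\<^bsub>R\<^esub> y i),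
     smult = (\<lambda>a x. \<lambda>i\<in>{..<n}. a \<otimes>\<^bsub>R\<^esub> x i)\<rparr>"

definition direct_sum :: "('a, 'x) module \<Rightarrow> ('a, 'y) module \<Rightarrow> ('a, 'x \<times> 'y) module" where
  "direct_sum M N =
    \<lparr>carrier = carrier M \<times> carrier N,
     mult = (\<lambda>(x, y) (x', y'). (x \<otimes>\<^bsub>M\<^esub> x', y \<otimes>\<^bsub>N\<^esub> y')),
     one = (\<one>\<^bsub>M\<^esub>, \<one>\<^bsub>N\<^esub>),
     zero = (\<zero>\<^bsub>M\<^esub>, \<zero>\<^bsub>N\<^esub>),
     add = (\<lambda>(x, y) (x', y'). (x \<oplus>\<^bsub>M\<^esub> x', y \<oplus>\<^bsub>N\<^esub> y')),
     smult = (\<lambda>a (x, y). (a \<odot>\<^bsub>M\<^esub> x, a \<odot>\<^bsub>N\<^esub> y))\<rparr>"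

definition fin_gen :: "('a, 'r) ring_scheme \<Rightarrow> ('a, 'x) module \<Rightarrow> bool" where
  "fin_gen R M \<longleftrightarrow> left_module R M \<and>
     (\<exists>S. finite S \<and> S \<subseteq> carrier M \<and> (\<forall>H. submodule H R M \<and> S \<subseteq> H \<longrightarrow> H = carrier M))"

definition fin_pres :: "('a, 'r) ring_scheme \<Rightarrow> ('a, 'x) module \<Rightarrow> bool" where
  "fin_pres R M \<longleftrightarrow> left_module R M \<and>
     (\<exists>n. \<exists>p\<in>mod_hom R (free_module R n) M. p ` carrier (free_module R n) = carrier M \<and>
        fin_gen R ((free_module R n)\<lparr>carrier := mod_ker (free_module R n) M p\<rparr>))"

definition internal_direct_sum ::
  "('a, 'r) ring_scheme \<Rightarrow> ('a, 'x) module \<Rightarrow> 'x set \<Rightarrow> 'x set \<Rightarrow> bool" where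
  "internal_direct_sum R N N\<^sub>1 N\<^sub>2 \<longleftrightarrow> submodule N\<^sub>1 R N \<and> submodule N\<^sub>2 R N \<and>
     N\<^sub>1 \<inter> N\<^sub>2 = {\<zero>\<^bsub>N\<^esub>} \<and> carrier N = {x \<oplus>\<^bsub>N\<^esub> y | x y. x \<in> N\<^sub>1 \<and> y \<in> N\<^sub>2}"

definition mod_lesssim ::
  "('a, 'r) ring_scheme \<Rightarrow> ('a, 'x) module \<Rightarrow> ('a, 'y) module \<Rightarrow> bool" where
  "mod_lesssim R M N \<longleftrightarrow> left_module R M \<and> left_module R N \<and>
     (\<exists>N\<^sub>1 N\<^sub>2. internal_direct_sum R N N\<^sub>1 N\<^sub>2 \<and>
       (\<exists>f\<in>mod_hom R (N\<lparr>carrier := N\<^sub>1\<rparr>) M. \<exists>g\<in>mod_hom R M (N\<lparr>carrier := N\<^sub>2\<rparr>).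
          f ` N\<^sub>1 = mod_ker M (N\<lparr>carrier := N\<^sub>2\<rparr>) g \<and> g ` carrier M = N\<^sub>2))"

text \<open>The parameter \<open>P\<close> is the class of modules from which the chain is taken: the finitely
  presented or the finitely generated ones.\<close>

definition mod_preceq ::
  "('a, 'r) ring_scheme \<Rightarrow> (('a, 'x) module \<Rightarrow> bool) \<Rightarrow> ('a, 'x) module \<Rightarrow> ('a, 'x) module \<Rightarrow> bool" where
  "mod_preceq R P M N \<longleftrightarrow> (\<exists>n\<ge>(1::nat). \<exists>F. F 1 = M \<and> F n = N \<and>
     (\<forall>i\<in>{1..n}. P (F i)) \<and> (\<forall>i\<in>{1..<n}. mod_lesssim R (F i) (F (Suc i))))"

definition mod_sim ::
  "('a, 'r) ring_scheme \<Rightarrow> (('a, 'x) module \<Rightarrow> bool) \<Rightarrow> ('a, 'x) module \<Rightarrow> ('a, 'x) module \<Rightarrow> bool" where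
  "mod_sim R P M N \<longleftrightarrow> mod_preceq R P M N \<and> mod_preceq R P N M"

text \<open>As usual in HOL-Algebra the monoid is written multiplicatively, although the operation of
  interest is a sum.\<close>

record 'c ord_monoid = "'c monoid" +
  mon_le :: "'c \<Rightarrow> 'c \<Rightarrow> bool"
  ord_unit :: 'c

locale po_comm_monoid_with_unit = comm_monoid W for W :: "('c, 'w) ord_monoid_scheme" (structure) +
  assumes le_refl: "x \<in> carrier W \<Longrightarrow> mon_le W x x"
    and le_antisym:
      "\<lbrakk>mon_le W x y; mon_le W y x; x \<in> carrier W; y \<in> carrier W\<rbrakk> \<Longrightarrow> x = y"
    and le_trans:
      "\<lbrakk>mon_le W x y; mon_le W y z; x \<in> carrier W; y \<in> carrier W; z \<in> carrier W\<rbrakk> \<Longrightarrow> mon_le W x z"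
    and le_translate:
      "\<lbrakk>mon_le W x y; x \<in> carrier W; y \<in> carrier W; z \<in> carrier W\<rbrakk> \<Longrightarrow> mon_le W (x \<otimes> z) (y \<otimes> z)"
    and unit_closed: "ord_unit W \<in> carrier W"
    and unit_nonneg: "mon_le W \<one> (ord_unit W)"
    and unit_bound: "x \<in> carrier W \<Longrightarrow> \<exists>n::nat. mon_le W x (ord_unit W [^] n)"

text \<open>Classes are formed from modules carried by the type below.  This loses nothing: if \<open>M\<close> is a
  left module, on any carrier type, generated by \<open>g\<^sub>0, \<dots>, g\<^sub>n\<^sub>-\<^sub>1\<close>, then sending \<open>x\<close> to the set of all
  \<open>c\<close> in \<open>R\<^sup>n\<close> with \<open>x = c\<^sub>0 g\<^sub>0 + \<dots> + c\<^sub>n\<^sub>-\<^sub>1 g\<^sub>n\<^sub>-\<^sub>1\<close> is injective and transports the structure of \<open>M\<close>.\<close>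

type_synonym 'a umodule = "('a, (nat \<Rightarrow> 'a) set) module"

text \<open>The class of a module \<open>M\<close> on an arbitrary carrier type consists of the modules equivalent to
  an isomorphic copy of \<open>M\<close>.  Since isomorphic modules are equivalent, for a module \<open>M\<close> of type
  \<^typ>\<open>'a umodule\<close> satisfying \<open>P\<close> this is its ordinary equivalence class.\<close>

definition mod_class ::
  "('a, 'r) ring_scheme \<Rightarrow> ('a umodule \<Rightarrow> bool) \<Rightarrow> ('a, 'x) module \<Rightarrow> 'a umodule set" where
  "mod_class R P M = {Q. \<exists>M'. mod_isomorphic R M' M \<and> mod_sim R P Q M'}"

definition class_monoid ::
  "('a, 'r) ring_scheme \<Rightarrow> ('a umodule \<Rightarrow> bool) \<Rightarrow> 'a umodule set ord_monoid" where
  "class_monoid R P =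
    \<lparr>carrier = {mod_class R P M | M :: 'a umodule. P M},
     mult = (\<lambda>A B. \<Union>M\<in>A. \<Union>N\<in>B. mod_class R P (direct_sum M N)),
     one = mod_class R P zero_module,
     mon_le = (\<lambda>A B. \<exists>M\<in>A. \<exists>N\<in>B. mod_preceq R P M N),
     ord_unit = mod_class R P (regular_module R)\<rparr>"

definition fp_class :: "('a, 'r) ring_scheme \<Rightarrow> ('a, 'x) module \<Rightarrow> 'a umodule set" where
  "fp_class R M = mod_class R (fin_pres R) M"

definition fg_class :: "('a, 'r) ring_scheme \<Rightarrow> ('a, 'x) module \<Rightarrow> 'a umodule set" where
  "fg_class R M = mod_class R (fin_gen R) M"

definition VM :: "('a, 'r) ring_scheme \<Rightarrow> 'a umodule set ord_monoid" where
  "VM R = class_monoid R (fin_pres R)"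

definition UM :: "('a, 'r) ring_scheme \<Rightarrow> 'a umodule set ord_monoid" where
  "UM R = class_monoid R (fin_gen R)"

definition VM_to_UM :: "('a, 'r) ring_scheme \<Rightarrow> 'a umodule set \<Rightarrow> 'a umodule set" where
  "VM_to_UM R A = the_elem (fg_class R ` A)"

end

theory Submission
  imports Defs
begin

text \<open>The only substantial point is that two finitely presented modules joined by a chain of finitely
  generated modules are joined by a chain of finitely presented ones.  Fix the finitely presented
  upper end \<open>N\<close>.  Going down the chain, one shows that every finitely presented module sufficiently
  close to a member \<open>M\<close> of the chain lies below \<open>N\<close>; here a quotient of \<open>R\<^sup>n\<close> by a submodule of the
  kernel of a given surjection \<open>R\<^sup>n \<rightarrow> M\<close> is close to \<open>M\<close> if that submodule contains a certain finite
  set.  For the step, let \<open>A \<rightarrow> M \<rightarrow> B \<rightarrow> 0\<close> be exact with \<open>A \<oplus> B\<close> the next member.  Lift \<open>A \<rightarrow> M\<close> to a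
  map \<open>h\<close> from a free cover \<open>R\<^sup>a\<close> of \<open>A\<close> to \<open>R\<^sup>n\<close>.  If \<open>M' = R\<^sup>n / K\<close> is close to \<open>M\<close>, then
  \<open>B' = R\<^sup>n / (K + h R\<^sup>a)\<close> is close to \<open>B\<close>, and \<open>A' \<rightarrow> M' \<rightarrow> B' \<rightarrow> 0\<close> is exact for every quotient \<open>A'\<close>
  of \<open>R\<^sup>a\<close> close to \<open>A\<close> through which the map to \<open>M'\<close> factors, so \<open>M'\<close> precedes \<open>A' \<oplus> B'\<close>.  The
  statement for \<open>M\<close> itself follows when \<open>M\<close> is finitely presented.\<close>

section \<open>Left modules and their homomorphisms\<close>

text \<open>The members of the chain cannot be replaced one by one: the relations of a finitely
  generated module need not be finitely generated, and an approximation of one member has to fit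
  both of its neighbours. What travels down the chain is therefore a finite demand rather than a
  module. The demand on the next member is a finite set \<open>T\<close> of relations of a cover of
  A \<oplus> B, and the projection onto B separates each of them into a relation of A and one of B.
  The former has to be carried by \<open>h\<close> into K, so that A' \<rightarrow> M' exists. The
  latter is a relation of M only modulo the image of A; subtracting a suitable value of
  \<open>h\<close> makes it one of M, and this correction is invisible in B', where \<open>h\<close>
  vanishes. So a finite set \<open>S\<close> for M suffices. Finite presentability enters through
  \<open>fin_pres_kernel_generates\<close>: at N it gives the first finite demand, and at each M' it
  makes B' finitely presented.\<close>

context left_module
begin

lemma smult_zero [simp]: "a \<in> carrier R \<Longrightarrow> a \<odot>\<^bsub>M\<^esub> \<zero>\<^bsub>M\<^esub> = \<zero>\<^bsub>M\<^esub>"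
  by (metis M.add.r_cancel_one' M.zero_closed M.l_zero lsmult_closed lsmult_r_distr)

lemma zero_smult [simp]: "x \<in> carrier M \<Longrightarrow> \<zero> \<odot>\<^bsub>M\<^esub> x = \<zero>\<^bsub>M\<^esub>"
  by (metis M.add.r_cancel_one' R.zero_closed R.l_zero lsmult_closed lsmult_l_distr)

lemma minus_one_smult: "x \<in> carrier M \<Longrightarrow> (\<ominus> \<one>) \<odot>\<^bsub>M\<^esub> x = \<ominus>\<^bsub>M\<^esub> x"
  by (metis M.minus_equality R.add.inv_closed R.l_neg R.one_closed lsmult_closed lsmult_l_distr
      lsmult_one zero_smult)

lemma smult_a_inv:
  "a \<in> carrier R \<Longrightarrow> x \<in> carrier M \<Longrightarrow> a \<odot>\<^bsub>M\<^esub> (\<ominus>\<^bsub>M\<^esub> x) = \<ominus>\<^bsub>M\<^esub> (a \<odot>\<^bsub>M\<^esub> x)"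
  by (metis M.add.inv_closed M.l_neg M.minus_equality lsmult_closed lsmult_r_distr smult_zero)

lemma a_inv_zero [simp]: "\<ominus>\<^bsub>M\<^esub> \<zero>\<^bsub>M\<^esub> = \<zero>\<^bsub>M\<^esub>"
  by (rule M.minus_equality) auto

lemma diff_self: "x \<in> carrier M \<Longrightarrow> x \<ominus>\<^bsub>M\<^esub> x = \<zero>\<^bsub>M\<^esub>"
  by (simp add: a_minus_def M.r_neg)

lemma add_diff_cancel:
  "x \<in> carrier M \<Longrightarrow> y \<in> carrier M \<Longrightarrow> x \<oplus>\<^bsub>M\<^esub> (y \<ominus>\<^bsub>M\<^esub> x) = y"
  "x \<in> carrier M \<Longrightarrow> y \<in> carrier M \<Longrightarrow> (y \<ominus>\<^bsub>M\<^esub> x) \<oplus>\<^bsub>M\<^esub> x = y"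
  "x \<in> carrier M \<Longrightarrow> y \<in> carrier M \<Longrightarrow> (y \<oplus>\<^bsub>M\<^esub> x) \<ominus>\<^bsub>M\<^esub> x = y"
  by (simp_all add: a_minus_def M.a_assoc M.l_neg M.r_neg M.add.m_lcomm[of x y])

lemma diff_zero_eq: "x \<in> carrier M \<Longrightarrow> y \<in> carrier M \<Longrightarrow> x \<ominus>\<^bsub>M\<^esub> y = \<zero>\<^bsub>M\<^esub> \<Longrightarrow> x = y"
  using add_diff_cancel(2)[of y x] by simp

lemma diff_add_diff:
  assumes "x \<in> carrier M" "y \<in> carrier M" "z \<in> carrier M"
  shows "(y \<ominus>\<^bsub>M\<^esub> x) \<oplus>\<^bsub>M\<^esub> (x \<ominus>\<^bsub>M\<^esub> z) = y \<ominus>\<^bsub>M\<^esub> z"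
  using assms by (simp add: a_minus_def M.a_assoc M.r_neg1)

text \<open>Negatives come from the scalar \<open>\<ominus> \<one>\<close>, so the subgroup
  condition inside \<open>submodule\<close> reduces to zero, sums and scalar multiples.\<close>

lemma submoduleI:
  assumes "H \<subseteq> carrier M" "\<zero>\<^bsub>M\<^esub> \<in> H" "\<And>x y. x \<in> H \<Longrightarrow> y \<in> H \<Longrightarrow> x \<oplus>\<^bsub>M\<^esub> y \<in> H"
    and "\<And>a x. a \<in> carrier R \<Longrightarrow> x \<in> H \<Longrightarrow> a \<odot>\<^bsub>M\<^esub> x \<in> H"
  shows "submodule H R M"
proof -
  have "\<ominus>\<^bsub>M\<^esub> x \<in> H" if "x \<in> H" for x
    using assms(1) assms(4)[of "\<ominus> \<one>" x] that by (auto simp: minus_one_smult)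
  then show ?thesis
    using assms by (auto simp: submodule_def submodule_axioms_def subgroup_def a_inv_def)
qed

lemma submoduleD:
  assumes "submodule H R M"
  shows "H \<subseteq> carrier M" "\<zero>\<^bsub>M\<^esub> \<in> H" "\<And>x y. x \<in> H \<Longrightarrow> y \<in> H \<Longrightarrow> x \<oplus>\<^bsub>M\<^esub> y \<in> H"
    "\<And>a x. a \<in> carrier R \<Longrightarrow> x \<in> H \<Longrightarrow> a \<odot>\<^bsub>M\<^esub> x \<in> H"
    "\<And>x. x \<in> H \<Longrightarrow> \<ominus>\<^bsub>M\<^esub> x \<in> H"
    "\<And>x y. x \<in> H \<Longrightarrow> y \<in> H \<Longrightarrow> x \<ominus>\<^bsub>M\<^esub> y \<in> H"
  using assms by (auto simp: submodule_def submodule_axioms_def subgroup_def a_inv_def a_minus_def)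

lemma submodule_carrier: "submodule (carrier M) R M"
  by (rule submoduleI) (auto simp: lsmult_closed)

lemma submodule_left_module:
  assumes "submodule H R M"
  shows "left_module R (M\<lparr>carrier := H\<rparr>)"
proof -
  note H = submoduleD[OF assms]
  have "abelian_group (M\<lparr>carrier := H\<rparr>)"
  proof (rule abelian_groupI)
    show "\<exists>y\<in>carrier (M\<lparr>carrier := H\<rparr>). y \<oplus>\<^bsub>M\<lparr>carrier := H\<rparr>\<^esub> x = \<zero>\<^bsub>M\<lparr>carrier := H\<rparr>\<^esub>"
      if "x \<in> carrier (M\<lparr>carrier := H\<rparr>)" for x
      using that H by (intro bexI[of _ "\<ominus>\<^bsub>M\<^esub> x"]) (auto simp: M.l_neg)
  qed (use H in \<open>auto simp: M.add.m_ac subset_iff\<close>)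
  then show ?thesis
    using H R.ring_axioms
    by (auto simp: left_module_def left_module_axioms_def subset_iff lsmult_l_distr lsmult_r_distr
        lsmult_assoc lsmult_one)
qed

end

section \<open>Homomorphisms, preimages and images\<close>

lemma mod_homI:
  assumes "\<And>x. x \<in> carrier M \<Longrightarrow> f x \<in> carrier N"
    and "\<And>x y. x \<in> carrier M \<Longrightarrow> y \<in> carrier M \<Longrightarrow> f (x \<oplus>\<^bsub>M\<^esub> y) = f x \<oplus>\<^bsub>N\<^esub> f y"
    and "\<And>a x. a \<in> carrier R \<Longrightarrow> x \<in> carrier M \<Longrightarrow> f (a \<odot>\<^bsub>M\<^esub> x) = a \<odot>\<^bsub>N\<^esub> f x"
  shows "f \<in> mod_hom R M N"
  using assms by (auto simp: mod_hom_def hom_def)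

lemma mod_homD:
  assumes "f \<in> mod_hom R M N"
  shows "\<And>x. x \<in> carrier M \<Longrightarrow> f x \<in> carrier N"
    and "\<And>x y. x \<in> carrier M \<Longrightarrow> y \<in> carrier M \<Longrightarrow> f (x \<oplus>\<^bsub>M\<^esub> y) = f x \<oplus>\<^bsub>N\<^esub> f y"
    and "\<And>a x. a \<in> carrier R \<Longrightarrow> x \<in> carrier M \<Longrightarrow> f (a \<odot>\<^bsub>M\<^esub> x) = a \<odot>\<^bsub>N\<^esub> f x"
  using assms by (auto simp: mod_hom_def hom_def)

lemma mod_hom_comp:
  assumes "f \<in> mod_hom R M N" "g \<in> mod_hom R N K"
  shows "(\<lambda>x. g (f x)) \<in> mod_hom R M K"
  using assms by (auto simp: mod_hom_def hom_def Pi_iff)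

lemma mod_hom_id: "(\<lambda>x. x) \<in> mod_hom R M M"
  by (auto simp: mod_hom_def hom_def)

lemma mod_hom_group_hom:
  assumes "left_module R M" "left_module R N" "f \<in> mod_hom R M N"
  shows "group_hom (add_monoid M) (add_monoid N) f"
proof -
  interpret M: left_module R M by fact
  interpret N: left_module R N by fact
  show ?thesis
    using assms(3) M.M.a_group N.M.a_group
    by (simp add: group_hom_def group_hom_axioms_def mod_hom_def)
qed

lemma mod_hom_zero:
  assumes "left_module R M" "left_module R N" "f \<in> mod_hom R M N"
  shows "f \<zero>\<^bsub>M\<^esub> = \<zero>\<^bsub>N\<^esub>"
  using group_hom.hom_one[OF mod_hom_group_hom[OF assms]] by simp

lemma mod_hom_a_inv:
  assumes "left_module R M" "left_module R N" "f \<in> mod_hom R M N" "x \<in> carrier M"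
  shows "f (\<ominus>\<^bsub>M\<^esub> x) = \<ominus>\<^bsub>N\<^esub> f x"
  using group_hom.hom_inv[OF mod_hom_group_hom[OF assms(1-3)]] assms(4) by (simp add: a_inv_def)

lemma mod_hom_minus:
  assumes "left_module R M" "left_module R N" "f \<in> mod_hom R M N" "x \<in> carrier M" "y \<in> carrier M"
  shows "f (x \<ominus>\<^bsub>M\<^esub> y) = f x \<ominus>\<^bsub>N\<^esub> f y"
proof -
  interpret M: left_module R M by fact
  show ?thesis using assms
    by (simp add: a_minus_def mod_homD(2)[OF assms(3)] mod_hom_a_inv[OF assms(1-3)])
qed

lemma mod_hom_add:
  assumes "left_module R N" "f \<in> mod_hom R M N" "g \<in> mod_hom R M N"
  shows "(\<lambda>x. f x \<oplus>\<^bsub>N\<^esub> g x) \<in> mod_hom R M N"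
proof -
  interpret N: left_module R N by fact
  show ?thesis
    by (rule mod_homI)
      (auto simp: mod_homD[OF assms(2)] mod_homD[OF assms(3)] N.lsmult_r_distr N.M.add.m_ac
        intro!: N.M.add.m_closed)
qed

lemma mod_hom_diff:
  assumes "left_module R M" "left_module R N" "f \<in> mod_hom R M N" "g \<in> mod_hom R M N"
  shows "(\<lambda>x. f x \<ominus>\<^bsub>N\<^esub> g x) \<in> mod_hom R M N"
proof -
  interpret M: left_module R M by fact
  interpret N: left_module R N by fact
  have "(\<lambda>x. \<ominus>\<^bsub>N\<^esub> g x) \<in> mod_hom R M N"
    by (rule mod_homI) (auto simp: mod_homD[OF assms(4)] N.M.minus_add N.smult_a_inv)
  from mod_hom_add[OF assms(2,3) this] show ?thesis by (simp add: a_minus_def)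
qed

lemma mod_hom_into_submodule:
  assumes "f \<in> mod_hom R M N" "f ` carrier M \<subseteq> H"
  shows "f \<in> mod_hom R M (N\<lparr>carrier := H\<rparr>)"
  using assms by (auto simp: mod_hom_def hom_def)

lemma submodule_vimage:
  assumes "left_module R M" "left_module R N" "f \<in> mod_hom R M N" "submodule H R N"
  shows "submodule {x \<in> carrier M. f x \<in> H} R M"
proof -
  interpret M: left_module R M by fact
  interpret N: left_module R N by fact
  show ?thesis
    by (rule M.submoduleI) (auto simp: mod_homD[OF assms(3)] N.submoduleD[OF assms(4)]
        mod_hom_zero[OF assms(1-3)] M.lsmult_closed)
qed

lemma submodule_image:
  assumes "left_module R M" "left_module R N" "f \<in> mod_hom R M N" "submodule H R M"
  shows "submodule (f ` H) R N"
proof -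
  interpret M: left_module R M by fact
  interpret N: left_module R N by fact
  note H = M.submoduleD[OF assms(4)]
  note f = mod_homD[OF assms(3)]
  show ?thesis
  proof (rule N.submoduleI)
    show "\<zero>\<^bsub>N\<^esub> \<in> f ` H" using H(2) mod_hom_zero[OF assms(1-3)] by (metis imageI)
    show "x \<oplus>\<^bsub>N\<^esub> y \<in> f ` H" if "x \<in> f ` H" "y \<in> f ` H" for x y
      using that f(2) H(1,3) by (smt (verit) image_iff subsetD)
    show "a \<odot>\<^bsub>N\<^esub> x \<in> f ` H" if "a \<in> carrier R" "x \<in> f ` H" for a x
      using that f(3) H(1,4) by (smt (verit) image_iff subsetD)
  qed (use f H in auto)
qed

lemma (in left_module) submodule_zero: "submodule {\<zero>\<^bsub>M\<^esub>} R M"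
  by (rule submoduleI) auto

lemma submodule_mod_ker:
  assumes "left_module R M" "left_module R N" "f \<in> mod_hom R M N"
  shows "submodule (mod_ker M N f) R M"
  using submodule_vimage[OF assms left_module.submodule_zero[OF assms(2)]]
  by (simp add: mod_ker_def)

section \<open>Quotients and isomorphisms\<close>

text \<open>Meaningful only if the fibres of \<open>p\<close> are the classes of a congruence; the fields for multiplication
  and one are junk.\<close>

definition image_module :: "('x \<Rightarrow> 'y) \<Rightarrow> ('a, 'x) module \<Rightarrow> ('a, 'y) module" where
  "image_module p M = (let r = inv_into (carrier M) p in
     \<lparr>carrier = p ` carrier M, mult = (\<lambda>A B. A), one = p \<zero>\<^bsub>M\<^esub>, zero = p \<zero>\<^bsub>M\<^esub>,
      add = (\<lambda>A B. p (r A \<oplus>\<^bsub>M\<^esub> r B)), smult = (\<lambda>a A. p (a \<odot>\<^bsub>M\<^esub> r A))\<rparr>)"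

text \<open>The two hypotheses make the fibres of \<open>p\<close> a congruence. The operations use
  the representative picked by \<open>inv_into\<close>, but \<open>p\<close> of the result does not
  depend on it, so every module law of \<open>M\<close> carries over along \<open>p\<close>.\<close>

lemma image_module:
  fixes M :: "('a, 'x) module" and p :: "'x \<Rightarrow> 'y"
  assumes "left_module R M"
    and add: "\<And>x x' y y'. \<lbrakk>x \<in> carrier M; x' \<in> carrier M; y \<in> carrier M; y' \<in> carrier M;
      p x = p x'; p y = p y'\<rbrakk> \<Longrightarrow> p (x \<oplus>\<^bsub>M\<^esub> y) = p (x' \<oplus>\<^bsub>M\<^esub> y')"
    and smult: "\<And>a x x'. \<lbrakk>a \<in> carrier R; x \<in> carrier M; x' \<in> carrier M; p x = p x'\<rbrakk>
      \<Longrightarrow> p (a \<odot>\<^bsub>M\<^esub> x) = p (a \<odot>\<^bsub>M\<^esub> x')"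
  shows "left_module R (image_module p M)" "p \<in> mod_hom R M (image_module p M)"
    "carrier (image_module p M) = p ` carrier M" "\<zero>\<^bsub>image_module p M\<^esub> = p \<zero>\<^bsub>M\<^esub>"
proof -
  interpret M: left_module R M by fact
  let ?N = "image_module p M"
  let ?r = "inv_into (carrier M) p"
  have r: "?r (p x) \<in> carrier M" "p (?r (p x)) = p x" if "x \<in> carrier M" for x
    using that by (auto simp: inv_into_into f_inv_into_f)
  show carrier: "carrier ?N = p ` carrier M" and zero: "\<zero>\<^bsub>?N\<^esub> = p \<zero>\<^bsub>M\<^esub>"
    by (auto simp: image_module_def Let_def)
  have addN: "p x \<oplus>\<^bsub>?N\<^esub> p y = p (x \<oplus>\<^bsub>M\<^esub> y)" if "x \<in> carrier M" "y \<in> carrier M" for x y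
    using that r by (auto simp: image_module_def Let_def intro!: add)
  have smultN: "a \<odot>\<^bsub>?N\<^esub> p x = p (a \<odot>\<^bsub>M\<^esub> x)" if "a \<in> carrier R" "x \<in> carrier M" for a x
    using that r by (auto simp: image_module_def Let_def intro!: smult)
  show "p \<in> mod_hom R M ?N"
    by (rule mod_homI) (auto simp: carrier addN smultN)
  have "abelian_group ?N"
  proof (rule abelian_groupI)
    show "\<exists>y\<in>carrier ?N. y \<oplus>\<^bsub>?N\<^esub> x = \<zero>\<^bsub>?N\<^esub>" if x: "x \<in> carrier ?N" for x
    proof -
      obtain u where "u \<in> carrier M" "x = p u" using x carrier by auto
      then show ?thesis
        by (intro bexI[of _ "p (\<ominus>\<^bsub>M\<^esub> u)"]) (auto simp: carrier addN zero M.M.l_neg)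
    qed
  qed (auto simp: carrier addN zero M.M.add.m_ac)
  then show "left_module R ?N"
    using M.R.ring_axioms
    by (auto simp: left_module_def left_module_axioms_def carrier addN smultN M.lsmult_closed
        M.lsmult_l_distr M.lsmult_r_distr M.lsmult_assoc M.lsmult_one)
qed

lemma quotient_module_exists:
  fixes M :: "('a, 'x) module"
  assumes "left_module R M" "submodule L R M"
  shows "\<exists>(Q :: ('a, 'x set) module) p. left_module R Q \<and> p \<in> mod_hom R M Q \<and>
    p ` carrier M = carrier Q \<and> mod_ker M Q p = L"
proof -
  interpret M: left_module R M by fact
  note L = M.submoduleD[OF assms(2)]
  \<comment> \<open>\<open>p x\<close> is the coset of \<open>x\<close> modulo \<open>L\<close>,
    kept as a set of elements of \<open>M\<close>; this fixes the carrier type of the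
    quotient.\<close>
  define p where "p x = {y \<in> carrier M. y \<ominus>\<^bsub>M\<^esub> x \<in> L}" for x
  have p_eq: "p x = p x' \<longleftrightarrow> x \<ominus>\<^bsub>M\<^esub> x' \<in> L" if x: "x \<in> carrier M" "x' \<in> carrier M" for x x'
  proof
    assume "p x = p x'"
    moreover have "x \<in> p x" using x L by (simp add: p_def M.M.r_neg a_minus_def)
    ultimately show "x \<ominus>\<^bsub>M\<^esub> x' \<in> L" by (auto simp: p_def)
  next
    assume *: "x \<ominus>\<^bsub>M\<^esub> x' \<in> L"
    have "y \<ominus>\<^bsub>M\<^esub> x \<in> L \<longleftrightarrow> y \<ominus>\<^bsub>M\<^esub> x' \<in> L" if "y \<in> carrier M" for y
    proof -
      note e = M.diff_add_diff[OF x(1) that x(2)]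
      \<comment> \<open>\<open>e\<close> solved for its first summand, for the converse inclusion of
        cosets.\<close>
      have e': "y \<ominus>\<^bsub>M\<^esub> x = (y \<ominus>\<^bsub>M\<^esub> x') \<ominus>\<^bsub>M\<^esub> (x \<ominus>\<^bsub>M\<^esub> x')"
        using x that by (subst e[symmetric]) (rule M.add_diff_cancel(3)[symmetric], auto)
      show ?thesis
      proof
        assume "y \<ominus>\<^bsub>M\<^esub> x \<in> L"
        from L(3)[OF this *] show "y \<ominus>\<^bsub>M\<^esub> x' \<in> L" unfolding e .
      next
        assume "y \<ominus>\<^bsub>M\<^esub> x' \<in> L"
        from L(6)[OF this *] show "y \<ominus>\<^bsub>M\<^esub> x \<in> L" unfolding e'[symmetric] .
      qed
    qed
    then show "p x = p x'" by (auto simp: p_def)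
  qed
  have add: "p (x \<oplus>\<^bsub>M\<^esub> y) = p (x' \<oplus>\<^bsub>M\<^esub> y')"
    if "x \<in> carrier M" "x' \<in> carrier M" "y \<in> carrier M" "y' \<in> carrier M" "p x = p x'" "p y = p y'"
    for x x' y y'
  proof -
    have "x \<oplus>\<^bsub>M\<^esub> y \<ominus>\<^bsub>M\<^esub> (x' \<oplus>\<^bsub>M\<^esub> y') = (x \<ominus>\<^bsub>M\<^esub> x') \<oplus>\<^bsub>M\<^esub> (y \<ominus>\<^bsub>M\<^esub> y')"
      using that by (simp add: a_minus_def M.M.minus_add M.M.add.m_ac)
    then show ?thesis using that L(3) by (simp add: p_eq)
  qed
  have smult: "p (a \<odot>\<^bsub>M\<^esub> x) = p (a \<odot>\<^bsub>M\<^esub> x')"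
    if "a \<in> carrier R" "x \<in> carrier M" "x' \<in> carrier M" "p x = p x'" for a x x'
  proof -
    have "a \<odot>\<^bsub>M\<^esub> x \<ominus>\<^bsub>M\<^esub> a \<odot>\<^bsub>M\<^esub> x' = a \<odot>\<^bsub>M\<^esub> (x \<ominus>\<^bsub>M\<^esub> x')"
      using that by (simp add: a_minus_def M.lsmult_r_distr M.smult_a_inv)
    then show ?thesis using that L(4) by (simp add: p_eq M.lsmult_closed)
  qed
  have Q: "left_module R (image_module p M)" "p \<in> mod_hom R M (image_module p M)"
    "carrier (image_module p M) = p ` carrier M" "\<zero>\<^bsub>image_module p M\<^esub> = p \<zero>\<^bsub>M\<^esub>"
    by (rule image_module[OF assms(1)], fact add, fact smult)+
  have "p x = p \<zero>\<^bsub>M\<^esub> \<longleftrightarrow> x \<in> L" if "x \<in> carrier M" for x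
    using that by (subst p_eq) (simp_all add: a_minus_def)
  then have ker: "mod_ker M (image_module p M) p = L"
    using L(1) by (auto simp: mod_ker_def Q(4))
  have "left_module R (image_module p M) \<and> p \<in> mod_hom R M (image_module p M) \<and>
      p ` carrier M = carrier (image_module p M) \<and> mod_ker M (image_module p M) p = L"
    using Q ker by simp
  then show ?thesis
    by blast
qed

text \<open>Universal property of a quotient: \<open>k\<close> is evaluated at a chosen preimage
  under \<open>p\<close>. Two preimages differ by an element that \<open>p\<close> kills, hence that
  \<open>k\<close> kills, so the choice is harmless.\<close>

lemma mod_hom_factor:
  assumes M: "left_module R M" and N: "left_module R N" and K: "left_module R K"
    and p: "p \<in> mod_hom R M N" "p ` carrier M = carrier N"
    and k: "k \<in> mod_hom R M K" and ker: "\<And>x. x \<in> carrier M \<Longrightarrow> p x = \<zero>\<^bsub>N\<^esub> \<Longrightarrow> k x = \<zero>\<^bsub>K\<^esub>"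
  shows "\<exists>k'. k' \<in> mod_hom R N K \<and> (\<forall>x\<in>carrier M. k' (p x) = k x)"
proof -
  interpret M: left_module R M by fact
  interpret N: left_module R N by fact
  interpret K: left_module R K by fact
  define k' where "k' y = k (inv_into (carrier M) p y)" for y
  have k': "k' (p x) = k x" if x: "x \<in> carrier M" for x
  proof -
    define u where "u = inv_into (carrier M) p (p x)"
    have u: "u \<in> carrier M" "p u = p x"
      using x by (auto simp: u_def inv_into_into f_inv_into_f)
    then have "p (u \<ominus>\<^bsub>M\<^esub> x) = \<zero>\<^bsub>N\<^esub>"
      using x by (simp add: mod_hom_minus[OF M N p(1)] mod_homD(1)[OF p(1)] N.diff_self)
    then have "k (u \<ominus>\<^bsub>M\<^esub> x) = \<zero>\<^bsub>K\<^esub>" using ker u x by simp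
    then have "k u = k x"
      using u x K.diff_zero_eq mod_homD(1)[OF k] by (simp add: mod_hom_minus[OF M K k])
    then show ?thesis by (simp add: k'_def u_def)
  qed
  have "k' \<in> mod_hom R N K"
  proof (rule mod_homI)
    fix y assume "y \<in> carrier N"
    then obtain x where x: "x \<in> carrier M" "y = p x" using p(2) by blast
    then show "k' y \<in> carrier K" using k' mod_homD(1)[OF k] by simp
    fix y' assume "y' \<in> carrier N"
    then obtain x' where x': "x' \<in> carrier M" "y' = p x'" using p(2) by blast
    show "k' (y \<oplus>\<^bsub>N\<^esub> y') = k' y \<oplus>\<^bsub>K\<^esub> k' y'"
      using x x' by (simp add: k' mod_homD(2)[OF p(1), symmetric] mod_homD(2)[OF k])
  next
    fix a y assume a: "a \<in> carrier R" and "y \<in> carrier N"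
    then obtain x where x: "x \<in> carrier M" "y = p x" using p(2) by blast
    then show "k' (a \<odot>\<^bsub>N\<^esub> y) = a \<odot>\<^bsub>K\<^esub> k' y"
      using a by (simp add: k' mod_homD(3)[OF p(1), symmetric] mod_homD(3)[OF k] M.lsmult_closed)
  qed
  with k' show ?thesis by blast
qed

lemma mod_isomorphicI:
  assumes "f \<in> mod_hom R M N" "g \<in> mod_hom R N M"
    and "\<And>x. x \<in> carrier M \<Longrightarrow> g (f x) = x" "\<And>y. y \<in> carrier N \<Longrightarrow> f (g y) = y"
  shows "mod_isomorphic R M N"
  unfolding mod_isomorphic_def
  by (intro bexI[of _ f] bij_betwI[of _ _ _ g]) (use assms mod_homD(1) in auto)

text \<open>Linearity of the inverse follows by applying it to the linearity equations of
  \<open>f\<close> at inverse images.\<close>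

lemma mod_isomorphicE:
  assumes "mod_isomorphic R M N" "left_module R M"
  obtains f g where "f \<in> mod_hom R M N" "g \<in> mod_hom R N M"
    "\<And>x. x \<in> carrier M \<Longrightarrow> g (f x) = x" "\<And>y. y \<in> carrier N \<Longrightarrow> f (g y) = y"
proof -
  interpret M: left_module R M by fact
  obtain f where f: "f \<in> mod_hom R M N" and bij: "bij_betw f (carrier M) (carrier N)"
    using assms by (auto simp: mod_isomorphic_def)
  define g where "g = inv_into (carrier M) f"
  have gf: "\<And>x. x \<in> carrier M \<Longrightarrow> g (f x) = x" and fg: "\<And>y. y \<in> carrier N \<Longrightarrow> f (g y) = y"
    and g: "\<And>y. y \<in> carrier N \<Longrightarrow> g y \<in> carrier M"
    using bij by (auto simp: g_def bij_betw_inv_into_left bij_betw_inv_into_right bij_betw_def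
        inv_into_into)
  have "g \<in> mod_hom R N M"
  proof (rule mod_homI)
    show "g (x \<oplus>\<^bsub>N\<^esub> y) = g x \<oplus>\<^bsub>M\<^esub> g y" if "x \<in> carrier N" "y \<in> carrier N" for x y
      using that gf[of "g x \<oplus>\<^bsub>M\<^esub> g y"] g fg mod_homD(2)[OF f, of "g x" "g y"] by simp
    show "g (a \<odot>\<^bsub>N\<^esub> x) = a \<odot>\<^bsub>M\<^esub> g x" if "a \<in> carrier R" "x \<in> carrier N" for a x
      using that gf[of "a \<odot>\<^bsub>M\<^esub> g x"] g fg mod_homD(3)[OF f, of a "g x"] by (simp add: M.lsmult_closed)
  qed (fact g)
  with f gf fg that show ?thesis by blast
qed

lemma mod_isomorphic_refl: "mod_isomorphic R M M"
  by (rule mod_isomorphicI[OF mod_hom_id mod_hom_id]) auto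

lemma mod_isomorphic_sym:
  "mod_isomorphic R M N \<Longrightarrow> left_module R M \<Longrightarrow> mod_isomorphic R N M"
  by (erule mod_isomorphicE) (auto intro: mod_isomorphicI)

lemma mod_isomorphic_trans:
  assumes "mod_isomorphic R M N" "mod_isomorphic R N K"
  shows "mod_isomorphic R M K"
proof -
  obtain f g where fg: "f \<in> mod_hom R M N" "bij_betw f (carrier M) (carrier N)"
    "g \<in> mod_hom R N K" "bij_betw g (carrier N) (carrier K)"
    using assms unfolding mod_isomorphic_def by blast
  have "bij_betw (\<lambda>x. g (f x)) (carrier M) (carrier K)"
    using bij_betw_trans[OF fg(2,4)] by (simp add: comp_def)
  then show ?thesis
    using mod_hom_comp[OF fg(1,3)] unfolding mod_isomorphic_def by (rule bexI)
qed

text \<open>With equal kernels each surjection factors through the other, and the two factor maps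
  are inverse to each other on images of elements of \<open>M\<close>. The carrier types may differ,
  so this also serves to move a module to another type.\<close>

lemma mod_isomorphic_quotient:
  assumes M: "left_module R M" and N: "left_module R N" and K: "left_module R K"
    and p: "p \<in> mod_hom R M N" "p ` carrier M = carrier N"
    and q: "q \<in> mod_hom R M K" "q ` carrier M = carrier K"
    and ker: "mod_ker M N p = mod_ker M K q"
  shows "mod_isomorphic R N K"
proof -
  have ker': "p x = \<zero>\<^bsub>N\<^esub> \<longleftrightarrow> q x = \<zero>\<^bsub>K\<^esub>" if "x \<in> carrier M" for x
    using ker that unfolding mod_ker_def by blast
  have p0: "q x = \<zero>\<^bsub>K\<^esub>" if "x \<in> carrier M" "p x = \<zero>\<^bsub>N\<^esub>" for x
    using that ker' by simp
  have q0: "p x = \<zero>\<^bsub>N\<^esub>" if "x \<in> carrier M" "q x = \<zero>\<^bsub>K\<^esub>" for x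
    using that ker' by simp
  obtain f where f: "f \<in> mod_hom R N K" "\<forall>x\<in>carrier M. f (p x) = q x"
    using mod_hom_factor[OF M N K p q(1) p0] by blast
  obtain g where g: "g \<in> mod_hom R K N" "\<forall>x\<in>carrier M. g (q x) = p x"
    using mod_hom_factor[OF M K N q p(1) q0] by blast
  show ?thesis
  proof (rule mod_isomorphicI[OF f(1) g(1)])
    fix y assume "y \<in> carrier N"
    then obtain x where "x \<in> carrier M" "y = p x" using p(2) by blast
    then show "g (f y) = y" using f(2) g(2) by simp
  next
    fix y assume "y \<in> carrier K"
    then obtain x where "x \<in> carrier M" "y = q x" using q(2) by blast
    then show "f (g y) = y" using f(2) g(2) by simp
  qed
qed

section \<open>Free modules, generators and finite presentations\<close>

definition unit_vec :: "('a, 'r) ring_scheme \<Rightarrow> nat \<Rightarrow> nat \<Rightarrow> nat \<Rightarrow> 'a" where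
  "unit_vec R n i = (\<lambda>j\<in>{..<n}. if j = i then \<one>\<^bsub>R\<^esub> else \<zero>\<^bsub>R\<^esub>)"

text \<open>A recursion with an explicit bound, separate from the length of the vector: proofs go by
  induction on the partial sums of a fixed vector.\<close>

primrec lincomb :: "('a, 'x, 'm) module_scheme \<Rightarrow> (nat \<Rightarrow> 'x) \<Rightarrow> (nat \<Rightarrow> 'a) \<Rightarrow> nat \<Rightarrow> 'x" where
  "lincomb M x c 0 = \<zero>\<^bsub>M\<^esub>"
| "lincomb M x c (Suc k) = lincomb M x c k \<oplus>\<^bsub>M\<^esub> c k \<odot>\<^bsub>M\<^esub> x k"

lemma free_module_simps:
  "carrier (free_module R n) = {..<n} \<rightarrow>\<^sub>E carrier R"
  "\<zero>\<^bsub>free_module R n\<^esub> = (\<lambda>i\<in>{..<n}. \<zero>\<^bsub>R\<^esub>)"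
  "c \<oplus>\<^bsub>free_module R n\<^esub> d = (\<lambda>i\<in>{..<n}. c i \<oplus>\<^bsub>R\<^esub> d i)"
  "a \<odot>\<^bsub>free_module R n\<^esub> c = (\<lambda>i\<in>{..<n}. a \<otimes>\<^bsub>R\<^esub> c i)"
  by (simp_all add: free_module_def)

lemma free_module_ext:
  assumes "c \<in> carrier (free_module R n)" "d \<in> carrier (free_module R n)"
    "\<And>i. i < n \<Longrightarrow> c i = d i"
  shows "c = d"
  using assms by (auto simp: free_module_simps intro: PiE_ext)

lemma left_module_free:
  assumes "ring R"
  shows "left_module R (free_module R n)"
proof -
  interpret R: ring R by fact
  have mem: "c i \<in> carrier R" if "c \<in> {..<n} \<rightarrow>\<^sub>E carrier R" "i < n" for c i
    using that by auto
  let ?F = "free_module R n"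
  note FD = free_module_simps
  have closed: "c \<oplus>\<^bsub>?F\<^esub> d \<in> carrier ?F" "a \<odot>\<^bsub>?F\<^esub> c \<in> carrier ?F" "\<zero>\<^bsub>?F\<^esub> \<in> carrier ?F"
    if "a \<in> carrier R" "c \<in> carrier ?F" "d \<in> carrier ?F" for a c d
    using that by (auto simp: FD mem)
  have zero: "\<zero>\<^bsub>?F\<^esub> \<in> carrier ?F" by (auto simp: FD)
  have "abelian_group ?F"
  proof (rule abelian_groupI)
    fix c assume c: "c \<in> carrier ?F"
    show "\<zero>\<^bsub>?F\<^esub> \<oplus>\<^bsub>?F\<^esub> c = c"
      by (rule free_module_ext[OF closed(1)[OF R.zero_closed zero c] c])
        (use c in \<open>simp add: FD mem\<close>)
    have neg: "(\<lambda>i\<in>{..<n}. \<ominus>\<^bsub>R\<^esub> c i) \<in> carrier ?F" using c by (auto simp: FD mem)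
    show "\<exists>d\<in>carrier ?F. d \<oplus>\<^bsub>?F\<^esub> c = \<zero>\<^bsub>?F\<^esub>"
      by (rule bexI[OF _ neg], rule free_module_ext[OF closed(1)[OF R.zero_closed neg c] zero])
        (use c in \<open>simp add: FD mem R.l_neg\<close>)
    fix d assume d: "d \<in> carrier ?F"
    show "c \<oplus>\<^bsub>?F\<^esub> d \<in> carrier ?F" by (rule closed[OF R.zero_closed c d])
    show "c \<oplus>\<^bsub>?F\<^esub> d = d \<oplus>\<^bsub>?F\<^esub> c"
      using c d unfolding FD by (intro restrict_ext) (simp add: mem R.add.m_comm)
    fix e assume e: "e \<in> carrier ?F"
    show "c \<oplus>\<^bsub>?F\<^esub> d \<oplus>\<^bsub>?F\<^esub> e = c \<oplus>\<^bsub>?F\<^esub> (d \<oplus>\<^bsub>?F\<^esub> e)"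
      using c d e unfolding FD by (intro restrict_ext) (simp add: mem R.add.m_assoc)
  qed (rule zero)
  moreover have "left_module_axioms R ?F"
  proof
    fix c assume c: "c \<in> carrier ?F"
    show "\<one>\<^bsub>R\<^esub> \<odot>\<^bsub>?F\<^esub> c = c"
      by (rule free_module_ext[OF closed(2)[OF R.one_closed c c] c])
        (use c in \<open>simp add: FD mem\<close>)
    fix a assume a: "a \<in> carrier R"
    show "a \<odot>\<^bsub>?F\<^esub> c \<in> carrier ?F" by (rule closed[OF a c c])
    show "a \<odot>\<^bsub>?F\<^esub> (c \<oplus>\<^bsub>?F\<^esub> d) = a \<odot>\<^bsub>?F\<^esub> c \<oplus>\<^bsub>?F\<^esub> a \<odot>\<^bsub>?F\<^esub> d"
      if "d \<in> carrier ?F" for d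
      using a c that unfolding FD by (intro restrict_ext) (simp add: mem R.r_distr)
    fix b assume b: "b \<in> carrier R"
    show "(a \<oplus>\<^bsub>R\<^esub> b) \<odot>\<^bsub>?F\<^esub> c = a \<odot>\<^bsub>?F\<^esub> c \<oplus>\<^bsub>?F\<^esub> b \<odot>\<^bsub>?F\<^esub> c"
      using a b c unfolding FD by (intro restrict_ext) (simp add: mem R.l_distr)
    show "(a \<otimes>\<^bsub>R\<^esub> b) \<odot>\<^bsub>?F\<^esub> c = a \<odot>\<^bsub>?F\<^esub> (b \<odot>\<^bsub>?F\<^esub> c)"
      using a b c unfolding FD by (intro restrict_ext) (simp add: mem R.m_assoc)
  qed
  ultimately show ?thesis
    using R.ring_axioms by (simp add: left_module_def)
qed

lemma unit_vec_closed: "ring R \<Longrightarrow> unit_vec R n i \<in> carrier (free_module R n)"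
  by (auto simp: unit_vec_def free_module_simps ring.ring_simprules)

context left_module
begin

lemma lincomb_in_submodule:
  assumes "submodule H R M" "\<And>i. i < k \<Longrightarrow> x i \<in> H" "\<And>i. i < k \<Longrightarrow> c i \<in> carrier R"
  shows "lincomb M x c k \<in> H"
  using assms(2,3) by (induction k) (auto intro!: submoduleD[OF assms(1)])

lemma lincomb_closed:
  "(\<And>i. i < k \<Longrightarrow> x i \<in> carrier M) \<Longrightarrow> (\<And>i. i < k \<Longrightarrow> c i \<in> carrier R) \<Longrightarrow> lincomb M x c k \<in> carrier M"
  by (rule lincomb_in_submodule[OF submodule_carrier])

lemma lincomb_unit_vec:
  assumes "\<And>i. i < n \<Longrightarrow> x i \<in> carrier M" "k \<le> n" "i < n"
  shows "lincomb M x (unit_vec R n i) k = (if i < k then x i else \<zero>\<^bsub>M\<^esub>)"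
  using assms(2)
proof (induction k)
  case (Suc k)
  then show ?case
    using assms(1)[of k] assms(1)[of i] assms(3)
    by (auto simp: unit_vec_def lsmult_one less_Suc_eq)
qed simp

end

lemma lincomb_hom:
  assumes "left_module R M" and x: "\<And>i. i < n \<Longrightarrow> x i \<in> carrier M"
  shows "(\<lambda>c. lincomb M x c n) \<in> mod_hom R (free_module R n) M"
proof -
  interpret left_module R M by fact
  have mem: "c i \<in> carrier R" if "c \<in> {..<n} \<rightarrow>\<^sub>E carrier R" "i < n" for c i
    using that by auto
  have closed: "lincomb M x c k \<in> carrier M" if "c \<in> {..<n} \<rightarrow>\<^sub>E carrier R" "k \<le> n" for c k
    using that x by (auto intro!: lincomb_closed)
  have add: "lincomb M x (\<lambda>i\<in>{..<n}. c i \<oplus>\<^bsub>R\<^esub> d i) k = lincomb M x c k \<oplus>\<^bsub>M\<^esub> lincomb M x d k"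
    if "c \<in> {..<n} \<rightarrow>\<^sub>E carrier R" "d \<in> {..<n} \<rightarrow>\<^sub>E carrier R" "k \<le> n" for c d k
    using that(3)
  proof (induction k)
    case (Suc k)
    then show ?case
      using that(1,2) closed[of c k] closed[of d k] x[of k]
      by (simp add: mem lsmult_l_distr lsmult_closed M.add.m_ac)
  qed simp
  have smult: "lincomb M x (\<lambda>i\<in>{..<n}. a \<otimes>\<^bsub>R\<^esub> c i) k = a \<odot>\<^bsub>M\<^esub> lincomb M x c k"
    if "c \<in> {..<n} \<rightarrow>\<^sub>E carrier R" "a \<in> carrier R" "k \<le> n" for a c k
    using that(3)
  proof (induction k)
    case (Suc k)
    then show ?case
      using that(1,2) closed[of c k] x[of k]
      by (simp add: mem lsmult_r_distr lsmult_closed lsmult_assoc)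
  qed (use that in simp)
  show ?thesis
    by (rule mod_homI) (auto simp: free_module_simps closed add smult)
qed

text \<open>Freeness of R^n: the values on the unit vectors may be prescribed.\<close>

lemma free_module_lift:
  assumes "left_module R M" "\<And>i. i < n \<Longrightarrow> x i \<in> carrier M"
  shows "\<exists>h. h \<in> mod_hom R (free_module R n) M \<and> (\<forall>i<n. h (unit_vec R n i) = x i)"
proof -
  interpret left_module R M by fact
  show ?thesis
    using lincomb_hom[of R M n x, OF assms] lincomb_unit_vec[of n x n, OF assms(2)]
    by (intro exI[of _ "\<lambda>c. lincomb M x c n"]) simp
qed

lemma lincomb_free:
  assumes "ring R" "c \<in> carrier (free_module R n)"
  shows "lincomb (free_module R n) (unit_vec R n) c n = c"
proof -
  interpret R: ring R by fact
  interpret F: left_module R "free_module R n" using assms by (simp add: left_module_free)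
  have c: "c i \<in> carrier R" if "i < n" for i using assms that by (auto simp: free_module_simps)
  have "lincomb (free_module R n) (unit_vec R n) c k i = (if i < k then c i else \<zero>\<^bsub>R\<^esub>)"
    if "i < n" "k \<le> n" for i k
    using that(2)
  proof (induction k)
    case (Suc k)
    then show ?case
      using that(1) c[of k] c[of i] by (auto simp: free_module_simps unit_vec_def less_Suc_eq)
  qed (use that in \<open>simp add: free_module_simps\<close>)
  moreover have "lincomb (free_module R n) (unit_vec R n) c n \<in> carrier (free_module R n)"
    using c assms(1) by (intro F.lincomb_closed) (auto intro: unit_vec_closed)
  ultimately show ?thesis by (intro free_module_ext[OF _ assms(2)]) auto
qed

text \<open>Generation is measured in the ambient module \<open>M\<close> rather than in
  \<open>L\<close> as a module of its own, so that kernels of different maps out of one free module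
  can be compared directly. For a submodule \<open>L\<close> it says that \<open>L\<close> is the
  span of \<open>S\<close>.\<close>

definition generates ::
  "('a, 'r) ring_scheme \<Rightarrow> ('a, 'x) module \<Rightarrow> 'x set \<Rightarrow> 'x set \<Rightarrow> bool" where
  "generates R M S L \<longleftrightarrow> S \<subseteq> L \<and> (\<forall>H. submodule H R M \<longrightarrow> S \<subseteq> H \<longrightarrow> L \<subseteq> H)"

lemma generatesD: "generates R M S L \<Longrightarrow> submodule H R M \<Longrightarrow> S \<subseteq> H \<Longrightarrow> L \<subseteq> H"
  by (auto simp: generates_def)

lemma generates_unit_vec:
  assumes "ring R"
  shows "generates R (free_module R n) (unit_vec R n ` {..<n}) (carrier (free_module R n))"
  unfolding generates_def
proof (intro conjI allI impI subsetI)
  interpret F: left_module R "free_module R n" using assms by (simp add: left_module_free)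
  fix H c assume H: "submodule H R (free_module R n)" "unit_vec R n ` {..<n} \<subseteq> H"
    and c: "c \<in> carrier (free_module R n)"
  have "lincomb (free_module R n) (unit_vec R n) c n \<in> H"
    using H c by (intro F.lincomb_in_submodule) (auto simp: free_module_simps)
  then show "c \<in> H" using lincomb_free[OF assms c] by simp
qed (use assms in \<open>auto simp: unit_vec_closed\<close>)

text \<open>The preimage of \<open>H\<close> is a submodule containing \<open>S\<close>. All later
  checks of a property of homomorphisms on generators go through this lemma.\<close>

lemma generates_hom_mem:
  assumes "left_module R M" "left_module R N" "generates R M S L" "L \<subseteq> carrier M"
    "f \<in> mod_hom R M N" "submodule H R N" "\<And>x. x \<in> S \<Longrightarrow> f x \<in> H" "x \<in> L"
  shows "f x \<in> H"
  using generatesD[OF assms(3) submodule_vimage[OF assms(1,2,5,6)]] assms(3,4,7,8)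
  by (auto simp: generates_def)

text \<open>The previous lemma for the difference \<open>f\<close> - \<open>g\<close> and the zero
  submodule.\<close>

lemma generates_hom_eq:
  assumes "left_module R M" "left_module R N" "generates R M S (carrier M)"
    "f \<in> mod_hom R M N" "g \<in> mod_hom R M N" "\<And>x. x \<in> S \<Longrightarrow> f x = g x" "x \<in> carrier M"
  shows "f x = g x"
proof -
  interpret N: left_module R N by fact
  have S: "S \<subseteq> carrier M" using assms(3) by (simp add: generates_def)
  have "f x \<ominus>\<^bsub>N\<^esub> g x \<in> {\<zero>\<^bsub>N\<^esub>}"
  proof (rule generates_hom_mem[OF assms(1,2,3) subset_refl mod_hom_diff[OF assms(1,2,4,5)]
        N.submodule_zero _ assms(7)])
    show "f x \<ominus>\<^bsub>N\<^esub> g x \<in> {\<zero>\<^bsub>N\<^esub>}" if "x \<in> S" for x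
      using that S mod_homD(1)[OF assms(5), of x] by (simp add: assms(6) N.diff_self subset_iff)
  qed
  then show ?thesis
    using N.diff_zero_eq mod_homD(1)[OF assms(4)] mod_homD(1)[OF assms(5)] assms(7) by simp
qed

lemma fin_gen_iff_generates:
  "fin_gen R M \<longleftrightarrow> left_module R M \<and> (\<exists>S. finite S \<and> generates R M S (carrier M))"
proof -
  have "submodule H R M \<Longrightarrow> H \<subseteq> carrier M" if "left_module R M" for H
    using left_module.submoduleD(1)[OF that] .
  then have "(\<forall>H. submodule H R M \<and> S \<subseteq> H \<longrightarrow> H = carrier M) \<longleftrightarrow>
      (\<forall>H. submodule H R M \<longrightarrow> S \<subseteq> H \<longrightarrow> carrier M \<subseteq> H)" if "left_module R M" for S
    using that by blast
  then show ?thesis unfolding fin_gen_def generates_def by blast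
qed

text \<open>Submodules of \<open>L\<close> are exactly the submodules of \<open>M\<close> inside
  \<open>L\<close>; a submodule of \<open>M\<close> is brought into \<open>L\<close> by
  intersecting.\<close>

lemma fin_gen_submodule_iff:
  assumes "left_module R M" "submodule L R M"
  shows "fin_gen R (M\<lparr>carrier := L\<rparr>) \<longleftrightarrow> (\<exists>S. finite S \<and> generates R M S L)"
proof -
  interpret M: left_module R M by fact
  have L: "left_module R (M\<lparr>carrier := L\<rparr>)" using assms by (simp add: M.submodule_left_module)
  interpret L: left_module R "M\<lparr>carrier := L\<rparr>" by fact
  have "generates R (M\<lparr>carrier := L\<rparr>) S L \<longleftrightarrow> generates R M S L" for S
  proof
    assume *: "generates R (M\<lparr>carrier := L\<rparr>) S L"
    have "L \<subseteq> H" if H: "submodule H R M" "S \<subseteq> H" for H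
    proof -
      have "submodule (H \<inter> L) R (M\<lparr>carrier := L\<rparr>)"
        by (rule L.submoduleI)
          (auto simp: M.submoduleD[OF H(1)] M.submoduleD[OF assms(2)])
      then show ?thesis using * H by (auto simp: generates_def)
    qed
    then show "generates R M S L" using * by (auto simp: generates_def)
  next
    assume *: "generates R M S L"
    have "L \<subseteq> H" if H: "submodule H R (M\<lparr>carrier := L\<rparr>)" "S \<subseteq> H" for H
    proof -
      have "submodule H R M"
        using L.submoduleD[OF H(1)] M.submoduleD(1)[OF assms(2)] by (intro M.submoduleI) auto
      then show ?thesis using * H by (auto simp: generates_def)
    qed
    then show "generates R (M\<lparr>carrier := L\<rparr>) S L" using * by (auto simp: generates_def)
  qed
  then show ?thesis using L by (simp add: fin_gen_iff_generates)
qed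

lemma generates_image:
  assumes "left_module R M" "left_module R N" "f \<in> mod_hom R M N" "generates R M S L" "L \<subseteq> carrier M"
  shows "generates R N (f ` S) (f ` L)"
  unfolding generates_def
proof (intro conjI allI impI)
  show "f ` S \<subseteq> f ` L" using assms(4) by (auto simp: generates_def)
  fix H assume H: "submodule H R N" "f ` S \<subseteq> H"
  show "f ` L \<subseteq> H"
    using generates_hom_mem[OF assms(1,2,4,5,3) H(1)] H(2) by blast
qed

lemma fin_gen_image:
  assumes "fin_gen R M" "left_module R N" "f \<in> mod_hom R M N" "f ` carrier M = carrier N"
  shows "fin_gen R N"
proof -
  obtain S where M: "left_module R M" and S: "finite S" "generates R M S (carrier M)"
    using assms(1) unfolding fin_gen_iff_generates by blast
  have "generates R N (f ` S) (carrier N)"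
    using generates_image[OF M assms(2,3) S(2) subset_refl] assms(4) by simp
  then show ?thesis using S(1) assms(2) unfolding fin_gen_iff_generates by blast
qed

lemma fin_gen_free: "ring R \<Longrightarrow> fin_gen R (free_module R n)"
  unfolding fin_gen_iff_generates using generates_unit_vec left_module_free by blast

lemma fin_gen_cover:
  assumes "fin_gen R M"
  obtains n p where "p \<in> mod_hom R (free_module R n) M" "p ` carrier (free_module R n) = carrier M"
proof -
  interpret M: left_module R M using assms by (simp add: fin_gen_def)
  have F: "left_module R (free_module R n)" for n using M.R.ring_axioms by (rule left_module_free)
  obtain S where S: "finite S" "generates R M S (carrier M)"
    using assms by (auto simp: fin_gen_iff_generates)
  obtain x and n :: nat where x: "S = x ` {..<n}"
    using finite_imp_nat_seg_image_inj_on[OF S(1)] by (auto simp: lessThan_def)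
  have "x i \<in> carrier M" if "i < n" for i using that x S(2) by (auto simp: generates_def)
  then obtain p where p: "p \<in> mod_hom R (free_module R n) M" "\<And>i. i < n \<Longrightarrow> p (unit_vec R n i) = x i"
    using free_module_lift[OF M.left_module_axioms, of n x] by blast
  have "S \<subseteq> p ` carrier (free_module R n)"
  proof
    fix y assume "y \<in> S"
    then obtain i where i: "i < n" "y = x i" using x by auto
    then show "y \<in> p ` carrier (free_module R n)"
      using p(2)[of i] unit_vec_closed[OF M.R.ring_axioms, of n i] by (metis imageI)
  qed
  moreover have "submodule (p ` carrier (free_module R n)) R M"
    by (rule submodule_image[OF F M.left_module_axioms p(1) left_module.submodule_carrier[OF F]])
  ultimately have "p ` carrier (free_module R n) = carrier M"
    using generatesD[OF S(2)] mod_homD(1)[OF p(1)] by blast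
  with p(1) show ?thesis by (rule that)
qed

lemma fin_pres_iff:
  "fin_pres R M \<longleftrightarrow> left_module R M \<and> (\<exists>n p S. p \<in> mod_hom R (free_module R n) M \<and>
     p ` carrier (free_module R n) = carrier M \<and> finite S \<and>
     generates R (free_module R n) S (mod_ker (free_module R n) M p))"
proof (cases "left_module R M")
  case True
  then interpret M: left_module R M .
  have F: "left_module R (free_module R n)" for n using M.R.ring_axioms by (rule left_module_free)
  have iff: "fin_gen R ((free_module R n)\<lparr>carrier := mod_ker (free_module R n) M p\<rparr>) \<longleftrightarrow>
      (\<exists>S. finite S \<and> generates R (free_module R n) S (mod_ker (free_module R n) M p))"
    if "p \<in> mod_hom R (free_module R n) M" for n p
    using fin_gen_submodule_iff[OF F submodule_mod_ker[OF F True that]] .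
  show ?thesis using True by (simp add: fin_pres_def Bex_def iff cong: conj_cong)
qed (auto simp: fin_pres_def)

lemma fin_pres_imp_fin_gen: "fin_pres R M \<Longrightarrow> fin_gen R M"
proof -
  assume "fin_pres R M"
  then obtain n p where M: "left_module R M" "p \<in> mod_hom R (free_module R n) M"
    "p ` carrier (free_module R n) = carrier M"
    unfolding fin_pres_iff by blast
  show ?thesis by (rule fin_gen_image[OF fin_gen_free[OF left_module.axioms(1)] M]) (fact M)
qed

section \<open>Lifting along surjections and independence of the presentation\<close>

lemma free_module_projective:
  assumes "left_module R N" "left_module R M" "p \<in> mod_hom R N M" "p ` carrier N = carrier M"
    "f \<in> mod_hom R (free_module R n) M"
  shows "\<exists>h. h \<in> mod_hom R (free_module R n) N \<and> (\<forall>c\<in>carrier (free_module R n). p (h c) = f c)"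
proof -
  interpret N: left_module R N by fact
  have F: "left_module R (free_module R n)" using N.R.ring_axioms by (rule left_module_free)
  \<comment> \<open>No bound on \<open>i\<close>: beyond \<open>n\<close> the unit vector is the
    zero vector, which lies in the carrier as well, so a total choice function can be
    extracted.\<close>
  have "\<forall>i. \<exists>x\<in>carrier N. p x = f (unit_vec R n i)"
  proof
    fix i
    have "f (unit_vec R n i) \<in> p ` carrier N"
      using mod_homD(1)[OF assms(5) unit_vec_closed[OF N.R.ring_axioms]] assms(4) by simp
    then show "\<exists>x\<in>carrier N. p x = f (unit_vec R n i)" by (metis imageE)
  qed
  then obtain x where x: "\<And>i. x i \<in> carrier N" "\<And>i. p (x i) = f (unit_vec R n i)" by metis
  have "x i \<in> carrier N" if "i < n" for i by (rule x)
  then obtain h where h: "h \<in> mod_hom R (free_module R n) N" "\<And>i. i < n \<Longrightarrow> h (unit_vec R n i) = x i"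
    using free_module_lift[OF assms(1), of n x] by blast
  have "p (h c) = f c" if "c \<in> carrier (free_module R n)" for c
  proof (rule generates_hom_eq[OF F assms(2) generates_unit_vec[OF N.R.ring_axioms]
          mod_hom_comp[OF h(1) assms(3)] assms(5) _ that])
    fix u assume "u \<in> unit_vec R n ` {..<n}"
    then obtain i where "i < n" "u = unit_vec R n i" by auto
    then show "p (h u) = f u" by (simp only: h(2) x(2))
  qed
  with h(1) show ?thesis by (intro exI[of _ h] conjI ballI)
qed

text \<open>A form of Schanuel's lemma. Lift each cover through the other to get \<open>h\<close>
  and \<open>k\<close>, and put \<open>d\<close> = id - \<open>h\<close> \<circ> \<open>k\<close>.
  An element \<open>x\<close> of the kernel of \<open>q\<close> is \<open>d x\<close> plus
  \<open>h (k x)\<close>, where \<open>k x\<close> lies in the kernel of \<open>p\<close>. So the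
  images under \<open>h\<close> of generators of the known kernel, together with the images under
  \<open>d\<close> of the unit vectors, generate the kernel of \<open>q\<close>.\<close>

lemma fin_pres_kernel_generates:
  assumes "fin_pres R M" "q \<in> mod_hom R (free_module R n) M"
    and q: "q ` carrier (free_module R n) = carrier M"
  obtains S where "finite S" "generates R (free_module R n) S (mod_ker (free_module R n) M q)"
proof -
  obtain m p T where M: "left_module R M" and p: "p \<in> mod_hom R (free_module R m) M"
    "p ` carrier (free_module R m) = carrier M"
    and T: "finite T" "generates R (free_module R m) T (mod_ker (free_module R m) M p)"
    using assms(1) unfolding fin_pres_iff by blast
  interpret M: left_module R M by fact
  have F: "left_module R (free_module R k)" for k using M.R.ring_axioms by (rule left_module_free)
  interpret F: left_module R "free_module R n" by (rule F)
  obtain h where h: "h \<in> mod_hom R (free_module R m) (free_module R n)"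
    "\<And>c. c \<in> carrier (free_module R m) \<Longrightarrow> q (h c) = p c"
    using free_module_projective[OF F M assms(2) q p(1)] by blast
  obtain k where k: "k \<in> mod_hom R (free_module R n) (free_module R m)"
    "\<And>c. c \<in> carrier (free_module R n) \<Longrightarrow> p (k c) = q c"
    using free_module_projective[OF F M p assms(2)] by blast
  define d where "d c = c \<ominus>\<^bsub>free_module R n\<^esub> h (k c)" for c
  have d: "d \<in> mod_hom R (free_module R n) (free_module R n)"
    unfolding d_def by (rule mod_hom_diff[OF F F mod_hom_id mod_hom_comp[OF k(1) h(1)]])
  have dq: "q (d c) = \<zero>\<^bsub>M\<^esub>" if "c \<in> carrier (free_module R n)" for c
    using that mod_homD(1)[OF h(1)] mod_homD(1)[OF k(1)] mod_homD(1)[OF assms(2)]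
    by (simp add: d_def mod_hom_minus[OF F M assms(2)] h(2) k(2) M.diff_self)
  define S where "S = h ` T \<union> d ` unit_vec R n ` {..<n}"
  have "T \<subseteq> mod_ker (free_module R m) M p" using T(2) by (simp add: generates_def)
  then have "S \<subseteq> mod_ker (free_module R n) M q"
    using dq mod_homD(1)[OF h(1)] mod_homD(1)[OF d] h(2) unit_vec_closed[OF M.R.ring_axioms]
    by (auto simp: S_def mod_ker_def)
  moreover have "x \<in> H" if H: "submodule H R (free_module R n)" "S \<subseteq> H"
    and x: "x \<in> mod_ker (free_module R n) M q" for H x
  proof -
    have xc: "x \<in> carrier (free_module R n)" using x by (simp add: mod_ker_def)
    have "d x \<in> H"
      by (rule generates_hom_mem[OF F F generates_unit_vec[OF M.R.ring_axioms] subset_refl d H(1) _ xc])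
        (use H in \<open>auto simp: S_def\<close>)
    moreover have "k x \<in> mod_ker (free_module R m) M p"
      using x k by (auto simp: mod_ker_def mod_homD(1)[OF k(1)])
    then have "h (k x) \<in> H"
      by (rule generates_hom_mem[OF F F T(2) _ h(1) H(1), rotated 2])
        (use H in \<open>auto simp: S_def mod_ker_def\<close>)
    moreover have "d x \<oplus>\<^bsub>free_module R n\<^esub> h (k x) = x"
      using xc mod_homD(1)[OF h(1)] mod_homD(1)[OF k(1)] by (simp add: d_def F.add_diff_cancel)
    ultimately show ?thesis using F.submoduleD(3)[OF H(1)] by metis
  qed
  ultimately have "generates R (free_module R n) S (mod_ker (free_module R n) M q)"
    unfolding generates_def by blast
  moreover have "finite S" using T(1) by (simp add: S_def)
  ultimately show ?thesis using that by simp
qed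

lemma fin_gen_isomorphic:
  assumes "fin_gen R M" "mod_isomorphic R M N" "left_module R N"
  shows "fin_gen R N"
proof -
  obtain f where "f \<in> mod_hom R M N" "f ` carrier M = carrier N"
    using assms(2) unfolding mod_isomorphic_def bij_betw_def by blast
  then show ?thesis by (rule fin_gen_image[OF assms(1,3)])
qed

lemma fin_pres_isomorphic:
  assumes "fin_pres R M" "mod_isomorphic R M N" "left_module R N"
  shows "fin_pres R N"
proof -
  obtain n p S where M: "left_module R M" and p: "p \<in> mod_hom R (free_module R n) M"
    "p ` carrier (free_module R n) = carrier M"
    and S: "finite S" "generates R (free_module R n) S (mod_ker (free_module R n) M p)"
    using assms(1) unfolding fin_pres_iff by blast
  obtain f g where fg: "f \<in> mod_hom R M N" "g \<in> mod_hom R N M"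
    "\<And>x. x \<in> carrier M \<Longrightarrow> g (f x) = x" "\<And>y. y \<in> carrier N \<Longrightarrow> f (g y) = y"
    using mod_isomorphicE[OF assms(2) M] by metis
  have f0: "f x = \<zero>\<^bsub>N\<^esub> \<longleftrightarrow> x = \<zero>\<^bsub>M\<^esub>" if "x \<in> carrier M" for x
    using that fg(3) mod_hom_zero[OF M assms(3) fg(1)] mod_hom_zero[OF assms(3) M fg(2)] by metis
  have "mod_ker (free_module R n) N (\<lambda>c. f (p c)) = mod_ker (free_module R n) M p"
    using f0 mod_homD(1)[OF p(1)] by (auto simp: mod_ker_def)
  moreover have "(\<lambda>c. f (p c)) ` carrier (free_module R n) = carrier N"
  proof -
    have "(\<lambda>c. f (p c)) ` carrier (free_module R n) = f ` carrier M"
      unfolding p(2)[symmetric] by (simp add: image_image)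
    also have "\<dots> = carrier N"
      using mod_homD(1)[OF fg(1)] mod_homD(1)[OF fg(2)] fg(4) by (force simp: image_iff)
    finally show ?thesis .
  qed
  ultimately show ?thesis
    using assms(3) S mod_hom_comp[OF p(1) fg(1)] unfolding fin_pres_iff by metis
qed

text \<open>Cosets in R^n are sets of functions from \<open>nat\<close> to the ring, which is the
  carrier type of \<open>umodule\<close>.\<close>

lemma free_quotient_exists:
  fixes R :: "('a, 'r) ring_scheme"
  assumes "ring R" "submodule L R (free_module R n)"
  obtains M :: "'a umodule" and p where "left_module R M" "p \<in> mod_hom R (free_module R n) M"
    "p ` carrier (free_module R n) = carrier M" "mod_ker (free_module R n) M p = L"
  using quotient_module_exists[OF left_module_free[OF assms(1)] assms(2)] by metis

text \<open>The copy is R^n modulo the kernel of a cover of \<open>Y\<close>. Through it direct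
  sums, the zero module and the regular module, which live on other types, return to
  \<open>umodule\<close>, where the chains are formed.\<close>

lemma fin_gen_copy:
  fixes R :: "('a, 'r) ring_scheme"
  assumes "fin_gen R Y"
  obtains X :: "'a umodule" where "left_module R X" "mod_isomorphic R X Y"
proof -
  interpret Y: left_module R Y using assms by (simp add: fin_gen_def)
  obtain n p where p: "p \<in> mod_hom R (free_module R n) Y" "p ` carrier (free_module R n) = carrier Y"
    by (rule fin_gen_cover[OF assms])
  have F: "left_module R (free_module R n)" using Y.R.ring_axioms by (rule left_module_free)
  obtain X :: "'a umodule" and q where X: "left_module R X" "q \<in> mod_hom R (free_module R n) X"
    "q ` carrier (free_module R n) = carrier X"
    "mod_ker (free_module R n) X q = mod_ker (free_module R n) Y p"
    by (rule free_quotient_exists[OF Y.R.ring_axioms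
          submodule_mod_ker[OF F Y.left_module_axioms p(1)]])
  have "mod_isomorphic R X Y"
    by (rule mod_isomorphic_quotient[OF F X(1) Y.left_module_axioms X(2,3) p X(4)])
  with X(1) show ?thesis by (rule that)
qed

section \<open>Splitting idempotents and chains\<close>

lemma mod_hom_const_zero:
  assumes "left_module R N"
  shows "(\<lambda>x. \<zero>\<^bsub>N\<^esub>) \<in> mod_hom R M N"
proof -
  interpret N: left_module R N by fact
  show ?thesis by (rule mod_homI) auto
qed

text \<open>Here \<open>e\<close> is the projection onto \<open>N\<^sub>2\<close> along \<open>N\<^sub>1\<close>, and \<open>f\<close> extends the given map on \<open>N\<^sub>1\<close> by zero
  on \<open>N\<^sub>2\<close>.\<close>

lemma mod_lesssimI:
  assumes M: "left_module R M" and N: "left_module R N"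
    and e: "e \<in> mod_hom R N N" and f: "f \<in> mod_hom R N M" and g: "g \<in> mod_hom R M N"
    and ee: "\<And>y. y \<in> carrier N \<Longrightarrow> e (e y) = e y" and fe: "\<And>y. y \<in> carrier N \<Longrightarrow> f (e y) = \<zero>\<^bsub>M\<^esub>"
    and exact: "f ` carrier N = mod_ker M N g" and range: "g ` carrier M = e ` carrier N"
  shows "mod_lesssim R M N"
proof -
  interpret M: left_module R M by fact
  interpret N: left_module R N by fact
  note eD = mod_homD[OF e] and fD = mod_homD[OF f]
  let ?N1 = "mod_ker N N e" and ?N2 = "e ` carrier N"
  \<comment> \<open>The component of \<open>y\<close> in the kernel of \<open>e\<close>;
    \<open>f\<close> does not see the other component.\<close>
  have diff: "y \<ominus>\<^bsub>N\<^esub> e y \<in> ?N1" "f (y \<ominus>\<^bsub>N\<^esub> e y) = f y" if "y \<in> carrier N" for y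
    using that eD(1) fD(1)
    by (simp_all add: mod_ker_def mod_hom_minus[OF N N e] mod_hom_minus[OF N M f] ee fe N.diff_self)
      (simp add: a_minus_def)
  have "internal_direct_sum R N ?N1 ?N2"
    unfolding internal_direct_sum_def
  proof (intro conjI)
    show "submodule ?N1 R N" by (rule submodule_mod_ker[OF N N e])
    show "submodule ?N2 R N" by (rule submodule_image[OF N N e N.submodule_carrier])
    have "\<zero>\<^bsub>N\<^esub> \<in> ?N1 \<inter> ?N2"
      using mod_hom_zero[OF N N e] by (auto simp: mod_ker_def image_iff intro!: bexI[of _ "\<zero>\<^bsub>N\<^esub>"])
    moreover have "x = \<zero>\<^bsub>N\<^esub>" if x: "x \<in> ?N1 \<inter> ?N2" for x
    proof -
      obtain y where "y \<in> carrier N" "x = e y" using x by blast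
      then have "x = e x" by (simp only: ee)
      then show ?thesis using x by (simp add: mod_ker_def)
    qed
    ultimately show "?N1 \<inter> ?N2 = {\<zero>\<^bsub>N\<^esub>}" by blast
    have "y \<in> {x \<oplus>\<^bsub>N\<^esub> z |x z. x \<in> ?N1 \<and> z \<in> ?N2}" if "y \<in> carrier N" for y
    proof -
      have "y = (y \<ominus>\<^bsub>N\<^esub> e y) \<oplus>\<^bsub>N\<^esub> e y" using that eD(1) by (simp add: N.add_diff_cancel)
      then show ?thesis using diff(1)[OF that] that by blast
    qed
    moreover have "x \<oplus>\<^bsub>N\<^esub> z \<in> carrier N" if "x \<in> ?N1" "z \<in> ?N2" for x z
      using that eD(1) by (auto simp: mod_ker_def)
    ultimately show "carrier N = {x \<oplus>\<^bsub>N\<^esub> z |x z. x \<in> ?N1 \<and> z \<in> ?N2}" by blast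
  qed
  moreover have "f \<in> mod_hom R (N\<lparr>carrier := ?N1\<rparr>) M"
    using fD by (intro mod_homI) (auto simp: mod_ker_def)
  moreover have "g \<in> mod_hom R M (N\<lparr>carrier := ?N2\<rparr>)"
    by (rule mod_hom_into_submodule[OF g]) (simp add: range)
  \<comment> \<open>Restricting \<open>f\<close> to the kernel of \<open>e\<close> does not shrink
    its image, because \<open>f\<close> takes the same value at \<open>y\<close> and at
    \<open>y\<close> - \<open>e y\<close>.\<close>
  moreover have "f ` ?N1 = mod_ker M (N\<lparr>carrier := ?N2\<rparr>) g"
  proof -
    have "f ` carrier N \<subseteq> f ` ?N1"
    proof
      fix x assume "x \<in> f ` carrier N"
      then obtain y where "y \<in> carrier N" "x = f y" by auto
      then show "x \<in> f ` ?N1" using diff by (metis imageI)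
    qed
    then have "f ` ?N1 = f ` carrier N" by (auto simp: mod_ker_def)
    then show ?thesis by (simp add: exact mod_ker_def)
  qed
  ultimately show ?thesis
    unfolding mod_lesssim_def using M N range by blast
qed

text \<open>Converse of \<open>mod_lesssimI\<close>: the rest of the development works with maps on
  all of \<open>N\<close> and avoids summands as subsets. The projections \<alpha> and \<beta> onto
  \<open>N1\<close> and \<open>N2\<close> are obtained by choice; they are linear because the
  decomposition is unique. The results are \<beta> for \<open>e\<close> and \<open>f\<close> after
  \<alpha> for \<open>f\<close>.\<close>

lemma mod_lesssimE:
  assumes "mod_lesssim R M N"
  obtains e f g where "left_module R M" "left_module R N"
    "e \<in> mod_hom R N N" "f \<in> mod_hom R N M" "g \<in> mod_hom R M N"
    "\<forall>y\<in>carrier N. e (e y) = e y" "\<forall>y\<in>carrier N. f (e y) = \<zero>\<^bsub>M\<^esub>"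
    "f ` carrier N = mod_ker M N g" "g ` carrier M = e ` carrier N"
proof -
  obtain N1 N2 f g where M: "left_module R M" and N: "left_module R N"
    and ds: "internal_direct_sum R N N1 N2"
    and f: "f \<in> mod_hom R (N\<lparr>carrier := N1\<rparr>) M" and g: "g \<in> mod_hom R M (N\<lparr>carrier := N2\<rparr>)"
    and fg: "f ` N1 = mod_ker M (N\<lparr>carrier := N2\<rparr>) g" "g ` carrier M = N2"
    using assms unfolding mod_lesssim_def by blast
  interpret M: left_module R M by fact
  interpret N: left_module R N by fact
  have sub: "submodule N1 R N" "submodule N2 R N" and int: "N1 \<inter> N2 = {\<zero>\<^bsub>N\<^esub>}"
    and sum: "carrier N = {x \<oplus>\<^bsub>N\<^esub> y | x y. x \<in> N1 \<and> y \<in> N2}"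
    using ds unfolding internal_direct_sum_def by auto
  note N1 = N.submoduleD[OF sub(1)] and N2 = N.submoduleD[OF sub(2)]
  have "\<forall>y. \<exists>a b. y \<in> carrier N \<longrightarrow> a \<in> N1 \<and> b \<in> N2 \<and> y = a \<oplus>\<^bsub>N\<^esub> b"
    using sum by blast
  then obtain \<alpha> \<beta> where
    "\<forall>y. y \<in> carrier N \<longrightarrow> \<alpha> y \<in> N1 \<and> \<beta> y \<in> N2 \<and> y = \<alpha> y \<oplus>\<^bsub>N\<^esub> \<beta> y"
    unfolding choice_iff by blast
  then have ab: "\<alpha> y \<in> N1" "\<beta> y \<in> N2" "\<alpha> y \<oplus>\<^bsub>N\<^esub> \<beta> y = y" if "y \<in> carrier N" for y
    using that by simp_all
  \<comment> \<open>\<open>a\<close> - \<open>a'\<close> = \<open>b'\<close> - \<open>b\<close> lies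
    in both summands and is therefore zero.\<close>
  have uniq: "a = a' \<and> b = b'"
    if "a \<in> N1" "a' \<in> N1" "b \<in> N2" "b' \<in> N2" "a \<oplus>\<^bsub>N\<^esub> b = a' \<oplus>\<^bsub>N\<^esub> b'" for a a' b b'
  proof -
    have c: "a \<in> carrier N" "a' \<in> carrier N" "b \<in> carrier N" "b' \<in> carrier N"
      using that N1(1) N2(1) by auto
    have "a \<ominus>\<^bsub>N\<^esub> a' = (a \<oplus>\<^bsub>N\<^esub> b) \<oplus>\<^bsub>N\<^esub> (\<ominus>\<^bsub>N\<^esub> b \<oplus>\<^bsub>N\<^esub> \<ominus>\<^bsub>N\<^esub> a')"
      using c by (simp add: a_minus_def N.M.a_assoc N.M.r_neg2)
    also have "\<dots> = (b' \<oplus>\<^bsub>N\<^esub> a') \<oplus>\<^bsub>N\<^esub> (\<ominus>\<^bsub>N\<^esub> a' \<oplus>\<^bsub>N\<^esub> \<ominus>\<^bsub>N\<^esub> b)"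
      using c by (simp add: that(5) N.M.a_comm)
    also have "\<dots> = b' \<ominus>\<^bsub>N\<^esub> b"
      using c by (simp add: a_minus_def N.M.a_assoc N.M.r_neg2)
    finally have eq: "a \<ominus>\<^bsub>N\<^esub> a' = b' \<ominus>\<^bsub>N\<^esub> b" .
    moreover have "a \<ominus>\<^bsub>N\<^esub> a' \<in> N1" "b' \<ominus>\<^bsub>N\<^esub> b \<in> N2"
      by (simp_all only: N1(6) N2(6) that)
    ultimately have "a \<ominus>\<^bsub>N\<^esub> a' = \<zero>\<^bsub>N\<^esub>" "b' \<ominus>\<^bsub>N\<^esub> b = \<zero>\<^bsub>N\<^esub>"
      using int by auto
    then show ?thesis using N.diff_zero_eq[of a a'] N.diff_zero_eq[of b' b] c by simp
  qed
  have split: "\<alpha> (a \<oplus>\<^bsub>N\<^esub> b) = a" "\<beta> (a \<oplus>\<^bsub>N\<^esub> b) = b" if "a \<in> N1" "b \<in> N2" for a b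
  proof -
    have "a \<oplus>\<^bsub>N\<^esub> b \<in> carrier N" using that sum by blast
    note ab = ab[OF this]
    show "\<alpha> (a \<oplus>\<^bsub>N\<^esub> b) = a" "\<beta> (a \<oplus>\<^bsub>N\<^esub> b) = b"
      using uniq[OF ab(1) that(1) ab(2) that(2) ab(3)] by simp_all
  qed
  have abc: "\<alpha> y \<in> carrier N" "\<beta> y \<in> carrier N" if "y \<in> carrier N" for y
    using that ab N1(1) N2(1) by auto
  have add: "\<alpha> (x \<oplus>\<^bsub>N\<^esub> y) = \<alpha> x \<oplus>\<^bsub>N\<^esub> \<alpha> y" "\<beta> (x \<oplus>\<^bsub>N\<^esub> y) = \<beta> x \<oplus>\<^bsub>N\<^esub> \<beta> y"
    if "x \<in> carrier N" "y \<in> carrier N" for x y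
  proof -
    have "x \<oplus>\<^bsub>N\<^esub> y = (\<alpha> x \<oplus>\<^bsub>N\<^esub> \<beta> x) \<oplus>\<^bsub>N\<^esub> (\<alpha> y \<oplus>\<^bsub>N\<^esub> \<beta> y)" using that by (simp add: ab(3))
    also have "\<dots> = (\<alpha> x \<oplus>\<^bsub>N\<^esub> \<alpha> y) \<oplus>\<^bsub>N\<^esub> (\<beta> x \<oplus>\<^bsub>N\<^esub> \<beta> y)"
      using that abc by (simp add: N.M.add.m_ac)
    finally show "\<alpha> (x \<oplus>\<^bsub>N\<^esub> y) = \<alpha> x \<oplus>\<^bsub>N\<^esub> \<alpha> y" "\<beta> (x \<oplus>\<^bsub>N\<^esub> y) = \<beta> x \<oplus>\<^bsub>N\<^esub> \<beta> y"
      using split[of "\<alpha> x \<oplus>\<^bsub>N\<^esub> \<alpha> y" "\<beta> x \<oplus>\<^bsub>N\<^esub> \<beta> y"] that ab N1(3) N2(3) by simp_all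
  qed
  have smult: "\<alpha> (a \<odot>\<^bsub>N\<^esub> y) = a \<odot>\<^bsub>N\<^esub> \<alpha> y" "\<beta> (a \<odot>\<^bsub>N\<^esub> y) = a \<odot>\<^bsub>N\<^esub> \<beta> y"
    if "a \<in> carrier R" "y \<in> carrier N" for a y
  proof -
    have "a \<odot>\<^bsub>N\<^esub> y = a \<odot>\<^bsub>N\<^esub> (\<alpha> y \<oplus>\<^bsub>N\<^esub> \<beta> y)" using that by (simp add: ab(3))
    also have "\<dots> = a \<odot>\<^bsub>N\<^esub> \<alpha> y \<oplus>\<^bsub>N\<^esub> a \<odot>\<^bsub>N\<^esub> \<beta> y" using that abc by (simp add: N.lsmult_r_distr)
    finally show "\<alpha> (a \<odot>\<^bsub>N\<^esub> y) = a \<odot>\<^bsub>N\<^esub> \<alpha> y" "\<beta> (a \<odot>\<^bsub>N\<^esub> y) = a \<odot>\<^bsub>N\<^esub> \<beta> y"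
      using split[of "a \<odot>\<^bsub>N\<^esub> \<alpha> y" "a \<odot>\<^bsub>N\<^esub> \<beta> y"] that ab N1(4) N2(4) by simp_all
  qed
  have \<alpha>1: "\<alpha> a = a" if "a \<in> N1" for a
    using split(1)[OF that N2(2)] that N1(1) by (auto simp: subset_iff)
  have \<beta>2: "\<alpha> b = \<zero>\<^bsub>N\<^esub>" "\<beta> b = b" if "b \<in> N2" for b
    using split[OF N1(2) that] that N2(1) by (auto simp: subset_iff)
  have N1m: "left_module R (N\<lparr>carrier := N1\<rparr>)" by (rule N.submodule_left_module[OF sub(1)])
  have "\<beta> \<in> mod_hom R N N"
    by (rule mod_homI) (simp_all add: abc add smult)
  moreover have "(\<lambda>y. f (\<alpha> y)) \<in> mod_hom R N M"
    using mod_homD[OF f] ab(1) by (intro mod_homI) (simp_all add: add smult)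
  moreover have "g \<in> mod_hom R M N"
    using mod_homD[OF g] N2(1) by (intro mod_homI) (auto simp: subset_iff)
  moreover have "\<forall>y\<in>carrier N. \<beta> (\<beta> y) = \<beta> y" by (simp add: ab(2) \<beta>2)
  moreover have "\<forall>y\<in>carrier N. f (\<alpha> (\<beta> y)) = \<zero>\<^bsub>M\<^esub>"
    using mod_hom_zero[OF N1m M f] by (simp add: ab(2) \<beta>2)
  moreover have "(\<lambda>y. f (\<alpha> y)) ` carrier N = mod_ker M N g"
  proof -
    have "\<alpha> ` carrier N = N1"
    proof (intro equalityI subsetI)
      show "x \<in> N1" if "x \<in> \<alpha> ` carrier N" for x using that ab(1) by auto
      show "x \<in> \<alpha> ` carrier N" if "x \<in> N1" for x
        using that \<alpha>1[OF that] N1(1) by (intro image_eqI[of _ _ x]) auto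
    qed
    then have "(\<lambda>y. f (\<alpha> y)) ` carrier N = f ` N1" by (metis image_image)
    then show ?thesis by (simp add: fg(1) mod_ker_def)
  qed
  moreover have "g ` carrier M = \<beta> ` carrier N"
    unfolding fg(2)
  proof (intro equalityI subsetI)
    show "x \<in> N2" if "x \<in> \<beta> ` carrier N" for x using that ab(2) by auto
    show "x \<in> \<beta> ` carrier N" if "x \<in> N2" for x
      using that \<beta>2(2)[OF that] N2(1) by (intro image_eqI[of _ _ x]) auto
  qed
  ultimately show ?thesis by (rule that[OF M N])
qed

text \<open>The extreme case in which the first summand of \<open>N\<close> is zero and the second
  is everything.\<close>

lemma mod_isomorphic_imp_lesssim:
  assumes "left_module R M" "left_module R N" "mod_isomorphic R M N"
  shows "mod_lesssim R M N"
proof -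
  interpret M: left_module R M by fact
  obtain g where g: "g \<in> mod_hom R M N" "bij_betw g (carrier M) (carrier N)"
    using assms(3) unfolding mod_isomorphic_def by blast
  have inj: "x = \<zero>\<^bsub>M\<^esub>" if "x \<in> carrier M" "g x = \<zero>\<^bsub>N\<^esub>" for x
    using g(2) that mod_hom_zero[OF assms(1,2) g(1)] unfolding bij_betw_def
    by (metis M.M.zero_closed inj_onD)
  have "(\<lambda>y. \<zero>\<^bsub>M\<^esub>) ` carrier N = mod_ker M N g"
  proof -
    have "\<zero>\<^bsub>N\<^esub> \<in> carrier N"
      using mod_homD(1)[OF g(1) M.M.zero_closed] mod_hom_zero[OF assms(1,2) g(1)] by simp
    then have "(\<lambda>y. \<zero>\<^bsub>M\<^esub>) ` carrier N = {\<zero>\<^bsub>M\<^esub>}" by auto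
    also have "\<dots> = mod_ker M N g"
      using inj mod_hom_zero[OF assms(1,2) g(1)] by (auto simp: mod_ker_def)
    finally show ?thesis .
  qed
  then show ?thesis
    using g(2) unfolding bij_betw_def
    by (intro mod_lesssimI[OF assms(1,2) mod_hom_id mod_hom_const_zero[OF assms(1)] g(1)]) auto
qed

text \<open>The opposite extreme: the first summand of \<open>N\<close> is everything and the second
  is zero, so exactness says that \<open>p\<close> is onto.\<close>

lemma surj_imp_lesssim:
  assumes "left_module R M" "left_module R N" "p \<in> mod_hom R N M" "p ` carrier N = carrier M"
  shows "mod_lesssim R M N"
proof -
  interpret M: left_module R M by fact
  interpret N: left_module R N by fact
  show ?thesis
    by (rule mod_lesssimI[OF assms(1,2) mod_hom_const_zero[OF assms(2)] assms(3)
          mod_hom_const_zero[OF assms(2)]])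
      (use mod_hom_zero[OF assms(2,1,3)] assms(4) in \<open>auto simp: mod_ker_def image_constant_conv\<close>)
qed

text \<open>All maps are conjugated by the isomorphisms. This is needed because forming direct sums
  leaves the carrier type, while a chain stays in one type.\<close>

lemma mod_lesssim_cong:
  assumes "mod_lesssim R M N" "mod_isomorphic R M M'" "mod_isomorphic R N N'"
    "left_module R M'" "left_module R N'"
  shows "mod_lesssim R M' N'"
proof -
  obtain e f g where M: "left_module R M" and N: "left_module R N" and
    e: "e \<in> mod_hom R N N" and f: "f \<in> mod_hom R N M" and g: "g \<in> mod_hom R M N" and
    ee: "\<forall>y\<in>carrier N. e (e y) = e y" and fe: "\<forall>y\<in>carrier N. f (e y) = \<zero>\<^bsub>M\<^esub>" and
    exact: "f ` carrier N = mod_ker M N g" and range: "g ` carrier M = e ` carrier N"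
    by (rule mod_lesssimE[OF assms(1)])
  obtain u u' where u: "u \<in> mod_hom R M M'" "u' \<in> mod_hom R M' M"
    "\<And>x. x \<in> carrier M \<Longrightarrow> u' (u x) = x" "\<And>x. x \<in> carrier M' \<Longrightarrow> u (u' x) = x"
    using mod_isomorphicE[OF assms(2) M] by metis
  obtain v v' where v: "v \<in> mod_hom R N N'" "v' \<in> mod_hom R N' N"
    "\<And>x. x \<in> carrier N \<Longrightarrow> v' (v x) = x" "\<And>x. x \<in> carrier N' \<Longrightarrow> v (v' x) = x"
    using mod_isomorphicE[OF assms(3) N] by metis
  note c = mod_homD(1)[OF u(1)] mod_homD(1)[OF u(2)] mod_homD(1)[OF v(1)] mod_homD(1)[OF v(2)]
    mod_homD(1)[OF e] mod_homD(1)[OF f] mod_homD(1)[OF g]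
  have u': "u' ` carrier M' = carrier M" and v': "v' ` carrier N' = carrier N"
    using c u v by (force simp: image_iff)+
  show ?thesis
  proof (rule mod_lesssimI[OF assms(4,5), of "\<lambda>y. v (e (v' y))" "\<lambda>y. u (f (v' y))" "\<lambda>x. v (g (u' x))"])
    show "(\<lambda>y. v (e (v' y))) \<in> mod_hom R N' N'"
      by (intro mod_hom_comp[OF v(2)] mod_hom_comp[OF e] v)
    show "(\<lambda>y. u (f (v' y))) \<in> mod_hom R N' M'"
      by (intro mod_hom_comp[OF v(2)] mod_hom_comp[OF f] u)
    show "(\<lambda>x. v (g (u' x))) \<in> mod_hom R M' N'"
      by (intro mod_hom_comp[OF u(2)] mod_hom_comp[OF g] v)
    show "v (e (v' (v (e (v' y))))) = v (e (v' y))" if "y \<in> carrier N'" for y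
      using that by (simp add: c v ee)
    show "u (f (v' (v (e (v' y))))) = \<zero>\<^bsub>M'\<^esub>" if "y \<in> carrier N'" for y
      using that by (simp add: c v fe mod_hom_zero[OF M assms(4) u(1)])
    have "(\<lambda>y. u (f (v' y))) ` carrier N' = u ` f ` v' ` carrier N'" by (simp add: image_image)
    also have "\<dots> = u ` mod_ker M N g" by (simp add: v' exact)
    also have "\<dots> = mod_ker M' N' (\<lambda>x. v (g (u' x)))"
    proof (rule Set.set_eqI)
      fix x
      have v0: "v y = \<zero>\<^bsub>N'\<^esub> \<longleftrightarrow> y = \<zero>\<^bsub>N\<^esub>" if "y \<in> carrier N" for y
        using that v(3) mod_hom_zero[OF N assms(5) v(1)] mod_hom_zero[OF assms(5) N v(2)] by metis
      show "x \<in> u ` mod_ker M N g \<longleftrightarrow> x \<in> mod_ker M' N' (\<lambda>x. v (g (u' x)))"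
      proof
        assume "x \<in> u ` mod_ker M N g"
        then show "x \<in> mod_ker M' N' (\<lambda>x. v (g (u' x)))" by (auto simp: mod_ker_def c u v0 mod_hom_zero[OF N assms(5) v(1)])
      next
        assume "x \<in> mod_ker M' N' (\<lambda>x. v (g (u' x)))"
        then have "u' x \<in> mod_ker M N g" "x = u (u' x)" by (auto simp: mod_ker_def c u v0)
        then show "x \<in> u ` mod_ker M N g" by blast
      qed
    qed
    finally show "(\<lambda>y. u (f (v' y))) ` carrier N' = mod_ker M' N' (\<lambda>x. v (g (u' x)))" .
    have "(\<lambda>x. v (g (u' x))) ` carrier M' = v ` g ` u' ` carrier M'" by (simp add: image_image)
    also have "\<dots> = v ` e ` v' ` carrier N'" by (simp add: u' v' range)
    finally show "(\<lambda>x. v (g (u' x))) ` carrier M' = (\<lambda>y. v (e (v' y))) ` carrier N'"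
      by (simp add: image_image)
  qed
qed

text \<open>\<open>P\<close> is demanded at both ends, so that the reflexive transitive closure
  keeps every member of a nontrivial chain in the class.\<close>

definition chain_step ::
  "('a, 'r) ring_scheme \<Rightarrow> (('a, 'x) module \<Rightarrow> bool) \<Rightarrow> ('a, 'x) module \<Rightarrow> ('a, 'x) module \<Rightarrow> bool" where
  "chain_step R P M N \<longleftrightarrow> P M \<and> P N \<and> mod_lesssim R M N"

text \<open>The closure relates every module to itself, whereas a chain of length one requires
  \<open>P\<close>; hence the extra conjunct.\<close>

lemma mod_preceq_iff: "mod_preceq R P M N \<longleftrightarrow> P M \<and> (chain_step R P)\<^sup>*\<^sup>* M N"
proof
  assume "mod_preceq R P M N"
  then obtain n F where n: "n \<ge> (1::nat)" and F: "F 1 = M" "F n = N" "\<forall>i\<in>{1..n}. P (F i)"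
    "\<forall>i\<in>{1..<n}. mod_lesssim R (F i) (F (Suc i))"
    unfolding mod_preceq_def by blast
  have "(chain_step R P)\<^sup>*\<^sup>* (F 1) (F i)" if "1 \<le> i" "i \<le> n" for i
    using that
  proof (induction i rule: dec_induct)
    case (step k)
    then show ?case using F(3,4) by (auto simp: chain_step_def intro: rtranclp.rtrancl_into_rtrancl)
  qed simp
  then show "P M \<and> (chain_step R P)\<^sup>*\<^sup>* M N" using n F by auto
next
  assume "P M \<and> (chain_step R P)\<^sup>*\<^sup>* M N"
  then have "P M" "(chain_step R P)\<^sup>*\<^sup>* M N" by auto
  from this(2) show "mod_preceq R P M N"
  proof (induction rule: rtranclp_induct)
    case base
    show ?case using \<open>P M\<close> unfolding mod_preceq_def by (intro exI[of _ 1] conjI exI[of _ "\<lambda>_. M"]) auto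
  next
    case (step N N')
    then obtain n F where n: "n \<ge> (1::nat)" and F: "F 1 = M" "F n = N" "\<forall>i\<in>{1..n}. P (F i)"
      "\<forall>i\<in>{1..<n}. mod_lesssim R (F i) (F (Suc i))"
      unfolding mod_preceq_def by blast
    have "P N'" "mod_lesssim R N N'" using step(2) by (auto simp: chain_step_def)
    then show ?case
      using n F unfolding mod_preceq_def
      by (intro exI[of _ "Suc n"] conjI exI[of _ "F(Suc n := N')"])
        (auto simp: less_Suc_eq le_Suc_eq)
  qed
qed

lemma mod_preceq_imp: "mod_preceq R P M N \<Longrightarrow> P M \<and> P N"
  unfolding mod_preceq_iff by (auto simp: chain_step_def elim: rtranclp.cases)

lemma mod_preceq_trans: "mod_preceq R P M N \<Longrightarrow> mod_preceq R P N K \<Longrightarrow> mod_preceq R P M K"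
  unfolding mod_preceq_iff by (meson rtranclp_trans)

lemma mod_preceq_step: "P M \<Longrightarrow> P N \<Longrightarrow> mod_lesssim R M N \<Longrightarrow> mod_preceq R P M N"
  unfolding mod_preceq_iff by (auto simp: chain_step_def)

lemma mod_preceq_refl: "P M \<Longrightarrow> mod_preceq R P M M"
  unfolding mod_preceq_iff by simp

text \<open>With \<open>fin_pres\<close> and \<open>fin_gen\<close> for the two classes this is the
  easy half of the comparison.\<close>

lemma mod_preceq_mono:
  assumes "mod_preceq R P M N" "\<And>M. P M \<Longrightarrow> Q M"
  shows "mod_preceq R Q M N"
proof -
  have "chain_step R Q A B" if "chain_step R P A B" for A B
    using that assms(2) by (simp add: chain_step_def)
  then have "(chain_step R P)\<^sup>*\<^sup>* M N \<Longrightarrow> (chain_step R Q)\<^sup>*\<^sup>* M N"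
    by (metis mono_rtranclp)
  then show ?thesis using assms unfolding mod_preceq_iff by blast
qed

section \<open>Direct sums\<close>

lemma direct_sum_simps [simp]:
  "carrier (direct_sum M N) = carrier M \<times> carrier N"
  "\<zero>\<^bsub>direct_sum M N\<^esub> = (\<zero>\<^bsub>M\<^esub>, \<zero>\<^bsub>N\<^esub>)"
  "(x, y) \<oplus>\<^bsub>direct_sum M N\<^esub> (x', y') = (x \<oplus>\<^bsub>M\<^esub> x', y \<oplus>\<^bsub>N\<^esub> y')"
  "a \<odot>\<^bsub>direct_sum M N\<^esub> (x, y) = (a \<odot>\<^bsub>M\<^esub> x, a \<odot>\<^bsub>N\<^esub> y)"
  by (simp_all add: direct_sum_def)

lemma left_module_direct_sum:
  assumes "left_module R M" "left_module R N"
  shows "left_module R (direct_sum M N)"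
proof -
  interpret M: left_module R M by fact
  interpret N: left_module R N by fact
  let ?S = "direct_sum M N"
  have "abelian_group ?S"
  proof (rule abelian_groupI)
    show "\<exists>y\<in>carrier ?S. y \<oplus>\<^bsub>?S\<^esub> x = \<zero>\<^bsub>?S\<^esub>" if "x \<in> carrier ?S" for x
      using that
      by (cases x) (auto simp: M.M.l_neg N.M.l_neg
          intro!: bexI[of _ "(\<ominus>\<^bsub>M\<^esub> fst x, \<ominus>\<^bsub>N\<^esub> snd x)"])
  qed (clarsimp simp: M.M.add.m_ac N.M.add.m_ac)+
  moreover have "left_module_axioms R ?S"
    by unfold_locales (clarsimp simp: M.lsmult_closed M.lsmult_l_distr M.lsmult_r_distr M.lsmult_assoc
        M.lsmult_one N.lsmult_closed N.lsmult_l_distr N.lsmult_r_distr N.lsmult_assoc N.lsmult_one)+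
  ultimately show ?thesis using M.R.ring_axioms by (simp add: left_module_def)
qed

lemma mod_hom_map_prod:
  assumes "f \<in> mod_hom R M M'" "g \<in> mod_hom R N N'"
  shows "(\<lambda>(x, y). (f x, g y)) \<in> mod_hom R (direct_sum M N) (direct_sum M' N')"
  by (rule mod_homI) (auto simp: mod_homD[OF assms(1)] mod_homD[OF assms(2)])

lemma mod_hom_fst: "fst \<in> mod_hom R (direct_sum M N) M"
  and mod_hom_snd: "snd \<in> mod_hom R (direct_sum M N) N"
  by (auto intro!: mod_homI)

lemma mod_hom_pair:
  assumes "f \<in> mod_hom R K M" "g \<in> mod_hom R K N"
  shows "(\<lambda>x. (f x, g x)) \<in> mod_hom R K (direct_sum M N)"
  by (rule mod_homI) (auto simp: mod_homD[OF assms(1)] mod_homD[OF assms(2)])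

lemma mod_isomorphic_direct_sum:
  assumes "mod_isomorphic R M M'" "mod_isomorphic R N N'" "left_module R M" "left_module R N"
  shows "mod_isomorphic R (direct_sum M N) (direct_sum M' N')"
proof -
  obtain f f' where f: "f \<in> mod_hom R M M'" "f' \<in> mod_hom R M' M"
    "\<And>x. x \<in> carrier M \<Longrightarrow> f' (f x) = x" "\<And>x. x \<in> carrier M' \<Longrightarrow> f (f' x) = x"
    using mod_isomorphicE[OF assms(1,3)] by metis
  obtain g g' where g: "g \<in> mod_hom R N N'" "g' \<in> mod_hom R N' N"
    "\<And>x. x \<in> carrier N \<Longrightarrow> g' (g x) = x" "\<And>x. x \<in> carrier N' \<Longrightarrow> g (g' x) = x"
    using mod_isomorphicE[OF assms(2,4)] by metis
  show ?thesis
    by (rule mod_isomorphicI[OF mod_hom_map_prod[OF f(1) g(1)] mod_hom_map_prod[OF f(2) g(2)]])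
      (auto simp: f(3,4) g(3,4))
qed

lemma mod_isomorphic_direct_sum_comm:
  "mod_isomorphic R (direct_sum M N) (direct_sum N M)"
  by (rule mod_isomorphicI[OF mod_hom_pair[OF mod_hom_snd mod_hom_fst]
        mod_hom_pair[OF mod_hom_snd mod_hom_fst]]) auto

lemma mod_isomorphic_direct_sum_assoc:
  "mod_isomorphic R (direct_sum (direct_sum M N) K) (direct_sum M (direct_sum N K))"
  by (rule mod_isomorphicI[of "\<lambda>((x, y), z). (x, (y, z))" _ _ _ "\<lambda>(x, (y, z)). ((x, y), z)"])
    (auto intro!: mod_homI)

lemma left_module_zero: "ring R \<Longrightarrow> left_module R zero_module"
  unfolding left_module_def left_module_axioms_def
  by (auto simp: zero_module_def intro!: abelian_groupI)

lemma left_module_regular: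
  assumes "ring R"
  shows "left_module R (regular_module R)"
proof -
  interpret R: ring R by fact
  have "abelian_group (regular_module R)"
    using R.add.l_inv_ex by (intro abelian_groupI) (auto simp: regular_module_def R.add.m_ac)
  then show ?thesis
    using assms unfolding left_module_def left_module_axioms_def
    by (auto simp: regular_module_def R.l_distr R.r_distr R.m_assoc)
qed

lemma mod_isomorphic_direct_sum_zero:
  assumes "left_module R M"
  shows "mod_isomorphic R (direct_sum zero_module M) M"
proof -
  interpret M: left_module R M by fact
  have "(\<lambda>x. ()) \<in> mod_hom R M zero_module"
    by (rule mod_homI) (auto simp: zero_module_def)
  from mod_hom_pair[OF this mod_hom_id] show ?thesis
    by (rule mod_isomorphicI[OF mod_hom_snd]) (auto simp: zero_module_def)
qed

text \<open>\<open>K\<close> joins the second summand of \<open>N\<close>: the projection and the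
  quotient map act on it as the identity, and the map from the first summand is zero on it.\<close>

lemma mod_lesssim_direct_sum:
  assumes "mod_lesssim R M N" and K: "left_module R K"
  shows "mod_lesssim R (direct_sum M K) (direct_sum N K)"
proof -
  obtain e f g where M: "left_module R M" and N: "left_module R N" and
    e: "e \<in> mod_hom R N N" and f: "f \<in> mod_hom R N M" and g: "g \<in> mod_hom R M N" and
    ee: "\<forall>y\<in>carrier N. e (e y) = e y" and fe: "\<forall>y\<in>carrier N. f (e y) = \<zero>\<^bsub>M\<^esub>" and
    exact: "f ` carrier N = mod_ker M N g" and range: "g ` carrier M = e ` carrier N"
    by (rule mod_lesssimE[OF assms(1)])
  interpret K: left_module R K by fact
  let ?e = "\<lambda>(y, z). (e y, z)" and ?f = "\<lambda>(y, z). (f y, \<zero>\<^bsub>K\<^esub>)" and ?g = "\<lambda>(x, z). (g x, z)"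
  show ?thesis
  proof (rule mod_lesssimI[OF left_module_direct_sum[OF M K] left_module_direct_sum[OF N K]
        mod_hom_map_prod[OF e mod_hom_id] mod_hom_map_prod[OF f mod_hom_const_zero[OF K]]
        mod_hom_map_prod[OF g mod_hom_id]])
    have "?f ` (carrier N \<times> carrier K) = (f ` carrier N) \<times> {\<zero>\<^bsub>K\<^esub>}" by auto
    also have "\<dots> = mod_ker (direct_sum M K) (direct_sum N K) ?g"
      unfolding exact by (auto simp: mod_ker_def)
    finally show "?f ` carrier (direct_sum N K) = mod_ker (direct_sum M K) (direct_sum N K) ?g"
      by simp
    have "?g ` (carrier M \<times> carrier K) = (g ` carrier M) \<times> carrier K" by auto
    also have "\<dots> = ?e ` (carrier N \<times> carrier K)" unfolding range by auto
    finally show "?g ` carrier (direct_sum M K) = ?e ` carrier (direct_sum N K)" by simp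
  qed (auto simp: ee fe)
qed

text \<open>Together with \<open>vec_split\<close> this identifies R^m \<oplus> R^n with R^(m+n), so
  that the sum of two covers becomes a cover by a single free module, as \<open>fin_pres\<close> and
  \<open>fp_approximable\<close> demand.\<close>

definition vec_append :: "nat \<Rightarrow> nat \<Rightarrow> (nat \<Rightarrow> 'a) \<times> (nat \<Rightarrow> 'a) \<Rightarrow> nat \<Rightarrow> 'a" where
  "vec_append m n = (\<lambda>(c, d). \<lambda>i\<in>{..<m + n}. if i < m then c i else d (i - m))"

definition vec_split :: "nat \<Rightarrow> nat \<Rightarrow> (nat \<Rightarrow> 'a) \<Rightarrow> (nat \<Rightarrow> 'a) \<times> (nat \<Rightarrow> 'a)" where
  "vec_split m n c = (\<lambda>i\<in>{..<m}. c i, \<lambda>i\<in>{..<n}. c (m + i))"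

lemma vec_append_hom:
  "vec_append m n \<in> mod_hom R (direct_sum (free_module R m) (free_module R n)) (free_module R (m + n))"
proof -
  have "i - m < n" if "i < m + n" "\<not> i < m" for i using that by arith
  then show ?thesis
    by (intro mod_homI) (auto simp: vec_append_def free_module_simps PiE_iff intro!: restrict_ext)
qed

lemma vec_split_hom:
  "vec_split m n \<in> mod_hom R (free_module R (m + n)) (direct_sum (free_module R m) (free_module R n))"
  by (rule mod_homI) (auto simp: vec_split_def free_module_simps PiE_iff intro!: restrict_ext)

lemma vec_split_append:
  "x \<in> carrier (direct_sum (free_module R m) (free_module R n)) \<Longrightarrow> vec_split m n (vec_append m n x) = x"
  by (auto simp: vec_split_def vec_append_def free_module_simps PiE_iff extensional_def fun_eq_iff)

lemma vec_append_split:
  "c \<in> carrier (free_module R (m + n)) \<Longrightarrow> vec_append m n (vec_split m n c) = c"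
  by (auto simp: vec_split_def vec_append_def free_module_simps PiE_iff extensional_def fun_eq_iff)

text \<open>Each pair is the sum of its two coordinates padded by zero; the padded copies stay in
  \<open>L \<times> K\<close> since both submodules contain zero.\<close>

lemma generates_direct_sum:
  assumes M: "left_module R M" and N: "left_module R N"
    and S: "generates R M S L" "generates R N T K" and L: "submodule L R M" "submodule K R N"
  shows "generates R (direct_sum M N) ((\<lambda>x. (x, \<zero>\<^bsub>N\<^esub>)) ` S \<union> (\<lambda>y. (\<zero>\<^bsub>M\<^esub>, y)) ` T) (L \<times> K)"
  unfolding generates_def
proof (intro conjI allI impI)
  interpret M: left_module R M by fact
  interpret N: left_module R N by fact
  have D: "left_module R (direct_sum M N)" by (rule left_module_direct_sum[OF M N])
  interpret D: left_module R "direct_sum M N" by (rule D)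
  have ST: "S \<subseteq> L" "T \<subseteq> K" using S by (auto simp: generates_def)
  then show "(\<lambda>x. (x, \<zero>\<^bsub>N\<^esub>)) ` S \<union> (\<lambda>y. (\<zero>\<^bsub>M\<^esub>, y)) ` T \<subseteq> L \<times> K"
    using M.submoduleD(2)[OF L(1)] N.submoduleD(2)[OF L(2)] by blast
  fix H assume H: "submodule H R (direct_sum M N)"
    and sub: "(\<lambda>x. (x, \<zero>\<^bsub>N\<^esub>)) ` S \<union> (\<lambda>y. (\<zero>\<^bsub>M\<^esub>, y)) ` T \<subseteq> H"
  show "L \<times> K \<subseteq> H"
  proof clarify
    fix x y assume xy: "x \<in> L" "y \<in> K"
    have "(x, \<zero>\<^bsub>N\<^esub>) \<in> H"
      by (rule generates_hom_mem[OF M D S(1) M.submoduleD(1)[OF L(1)]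
            mod_hom_pair[OF mod_hom_id mod_hom_const_zero[OF N]] H _ xy(1)]) (use sub in blast)
    moreover have "(\<zero>\<^bsub>M\<^esub>, y) \<in> H"
      by (rule generates_hom_mem[OF N D S(2) N.submoduleD(1)[OF L(2)]
            mod_hom_pair[OF mod_hom_const_zero[OF M] mod_hom_id] H _ xy(2)]) (use sub in blast)
    ultimately have "(x, \<zero>\<^bsub>N\<^esub>) \<oplus>\<^bsub>direct_sum M N\<^esub> (\<zero>\<^bsub>M\<^esub>, y) \<in> H" by (rule D.submoduleD(3)[OF H])
    then show "(x, y) \<in> H"
      using xy M.submoduleD(1)[OF L(1)] N.submoduleD(1)[OF L(2)] by (simp add: subset_iff)
  qed
qed

lemma fin_gen_direct_sum:
  assumes "fin_gen R M" "fin_gen R N"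
  shows "fin_gen R (direct_sum M N)"
proof -
  obtain S T where M: "left_module R M" "finite S" "generates R M S (carrier M)"
    and N: "left_module R N" "finite T" "generates R N T (carrier N)"
    using assms unfolding fin_gen_iff_generates by blast
  show ?thesis
    using generates_direct_sum[OF M(1) N(1) M(3) N(3) left_module.submodule_carrier[OF M(1)]
        left_module.submodule_carrier[OF N(1)]] M(2) N(2)
    unfolding fin_gen_iff_generates direct_sum_simps
    by (intro conjI left_module_direct_sum[OF M(1) N(1)] exI) (rule finite_UnI, simp_all)
qed

lemma fin_pres_direct_sum:
  assumes "fin_pres R M" "fin_pres R N"
  shows "fin_pres R (direct_sum M N)"
proof -
  obtain m p S where M: "left_module R M" and p: "p \<in> mod_hom R (free_module R m) M"
    "p ` carrier (free_module R m) = carrier M"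
    and S: "finite S" "generates R (free_module R m) S (mod_ker (free_module R m) M p)"
    using assms(1) unfolding fin_pres_iff by blast
  obtain n q T where N: "left_module R N" and q: "q \<in> mod_hom R (free_module R n) N"
    "q ` carrier (free_module R n) = carrier N"
    and T: "finite T" "generates R (free_module R n) T (mod_ker (free_module R n) N q)"
    using assms(2) unfolding fin_pres_iff by blast
  interpret M: left_module R M by fact
  have F: "left_module R (free_module R k)" for k using M.R.ring_axioms by (rule left_module_free)
  let ?D = "direct_sum (free_module R m) (free_module R n)"
  let ?F = "free_module R (m + n)"
  let ?pq = "\<lambda>(c, d). (p c, q d)"
  let ?r = "\<lambda>c. ?pq (vec_split m n c)"
  let ?K = "mod_ker (free_module R m) M p \<times> mod_ker (free_module R n) N q"
  obtain U where U: "finite U" "generates R ?D U ?K"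
    using generates_direct_sum[OF F F S(2) T(2) submodule_mod_ker[OF F M p(1)]
        submodule_mod_ker[OF F N q(1)]] S(1) T(1) by (metis finite_UnI finite_imageI)
  have D: "left_module R ?D" by (rule left_module_direct_sum[OF F F])
  have r: "?r \<in> mod_hom R ?F (direct_sum M N)"
    by (rule mod_hom_comp[OF vec_split_hom mod_hom_map_prod[OF p(1) q(1)]])
  have pq: "?pq ` carrier ?D = carrier (direct_sum M N)"
    unfolding direct_sum_simps p(2)[symmetric] q(2)[symmetric] by auto
  have sp: "vec_split m n ` carrier ?F = carrier ?D"
  proof (intro equalityI subsetI)
    show "x \<in> carrier ?D" if "x \<in> vec_split m n ` carrier ?F" for x
      using that mod_homD(1)[OF vec_split_hom] by (auto simp del: direct_sum_simps)
    show "x \<in> vec_split m n ` carrier ?F" if x: "x \<in> carrier ?D" for x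
      using vec_split_append[OF x] mod_homD(1)[OF vec_append_hom x] by (metis imageI)
  qed
  have "?r ` carrier ?F = ?pq ` vec_split m n ` carrier ?F" by (simp only: image_image)
  then have surj: "?r ` carrier ?F = carrier (direct_sum M N)" by (simp only: sp pq)
  have K: "?K \<subseteq> carrier ?D" by (auto simp: mod_ker_def)
  \<comment> \<open>The kernel of a product map is the product of the kernels; concatenation carries
    its finite generating set over to R^(m+n).\<close>
  have "vec_append m n ` ?K = mod_ker ?F (direct_sum M N) ?r"
  proof (intro equalityI subsetI)
    fix c assume "c \<in> vec_append m n ` ?K"
    then obtain x where x: "x \<in> ?K" "c = vec_append m n x" by blast
    moreover have "x \<in> carrier ?D" using x(1) K by blast
    ultimately show "c \<in> mod_ker ?F (direct_sum M N) ?r"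
      using mod_homD(1)[OF vec_append_hom, of x R m n] vec_split_append[of x R m n]
      by (auto simp: mod_ker_def)
  next
    fix c assume c: "c \<in> mod_ker ?F (direct_sum M N) ?r"
    then have cF: "c \<in> carrier ?F" by (simp add: mod_ker_def)
    have "vec_split m n c \<in> ?K"
      using c mod_homD(1)[OF vec_split_hom cF]
      by (cases "vec_split m n c") (auto simp: mod_ker_def)
    then show "c \<in> vec_append m n ` ?K" using vec_append_split[OF cF] by (metis imageI)
  qed
  then have "generates R ?F (vec_append m n ` U) (mod_ker ?F (direct_sum M N) ?r)"
    using generates_image[OF D F vec_append_hom U(2) K] by simp
  then show ?thesis
    unfolding fin_pres_iff
    using left_module_direct_sum[OF M N] r surj finite_imageI[OF U(1)] by blast
qed

lemma fin_pres_regular: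
  assumes "ring R"
  shows "fin_pres R (regular_module R)"
proof -
  interpret R: ring R by fact
  let ?p = "\<lambda>c. c (0::nat)"
  have L: "left_module R (regular_module R)" by (rule left_module_regular[OF assms])
  interpret F: left_module R "free_module R 1" by (rule left_module_free[OF assms])
  have p: "?p \<in> mod_hom R (free_module R 1) (regular_module R)"
    by (rule mod_homI) (auto simp: free_module_simps regular_module_def)
  have surj: "?p ` carrier (free_module R 1) = carrier (regular_module R)"
  proof (intro equalityI subsetI)
    show "a \<in> carrier (regular_module R)" if "a \<in> ?p ` carrier (free_module R 1)" for a
      using that mod_homD(1)[OF p] by auto
    show "a \<in> ?p ` carrier (free_module R 1)" if "a \<in> carrier (regular_module R)" for a
      using that by (intro image_eqI[of _ _ "\<lambda>i\<in>{..<1}. a"])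
        (auto simp: free_module_simps regular_module_def)
  qed
  have "c = \<zero>\<^bsub>free_module R 1\<^esub>" if "c \<in> mod_ker (free_module R 1) (regular_module R) ?p" for c
    using that by (intro free_module_ext[OF _ F.M.zero_closed])
      (auto simp: mod_ker_def free_module_simps regular_module_def)
  moreover have "\<zero>\<^bsub>free_module R 1\<^esub> \<in> mod_ker (free_module R 1) (regular_module R) ?p"
    using F.submoduleD(2)[OF submodule_mod_ker[OF F.left_module_axioms L p]] .
  ultimately have "generates R (free_module R 1) {\<zero>\<^bsub>free_module R 1\<^esub>}
      (mod_ker (free_module R 1) (regular_module R) ?p)"
    unfolding generates_def by blast
  then show ?thesis
    unfolding fin_pres_iff using L p surj by blast
qed

lemma fin_pres_zero:
  assumes "ring R"
  shows "fin_pres R (zero_module :: ('a, unit) module)"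
proof -
  let ?p = "\<lambda>c :: nat \<Rightarrow> 'a. ()"
  let ?F = "free_module R 0"
  have L: "left_module R (zero_module :: ('a, unit) module)" by (rule left_module_zero[OF assms])
  interpret F: left_module R ?F by (rule left_module_free[OF assms])
  have p: "?p \<in> mod_hom R ?F zero_module" by (rule mod_homI) (auto simp: zero_module_def)
  have surj: "?p ` carrier ?F = carrier zero_module"
    using F.M.zero_closed by (auto simp: zero_module_def)
  have "mod_ker ?F zero_module ?p = carrier ?F" by (auto simp: mod_ker_def zero_module_def)
  then have "generates R ?F (unit_vec R 0 ` {..<0}) (mod_ker ?F zero_module ?p)"
    using generates_unit_vec[OF assms, of 0] by simp
  then show ?thesis
    unfolding fin_pres_iff using L p surj by blast
qed

section \<open>Replacing finitely generated chains by finitely presented ones\<close>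

lemma generated_submodule_exists:
  assumes "left_module R M" "S \<subseteq> carrier M"
  obtains L where "submodule L R M" "generates R M S L"
proof -
  interpret M: left_module R M by fact
  let ?L = "\<Inter>{H. submodule H R M \<and> S \<subseteq> H}"
  have "?L \<subseteq> carrier M" using M.submodule_carrier assms(2) by blast
  then have "submodule ?L R M"
    by (rule M.submoduleI) (simp_all add: M.submoduleD)
  moreover have "generates R M S ?L" unfolding generates_def by blast
  ultimately show ?thesis by (rule that)
qed

text \<open>Prescribes a module by finitely many relations; this produces both summands A' and B' of
  the approximation.\<close>

lemma fin_pres_quotient_exists:
  fixes R :: "('a, 'r) ring_scheme"
  assumes "ring R" "finite S" "S \<subseteq> carrier (free_module R n)"
  obtains A :: "'a umodule" and p where "fin_pres R A" "p \<in> mod_hom R (free_module R n) A"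
    "p ` carrier (free_module R n) = carrier A"
    "generates R (free_module R n) S (mod_ker (free_module R n) A p)"
proof -
  obtain L where L: "submodule L R (free_module R n)" "generates R (free_module R n) S L"
    by (rule generated_submodule_exists[OF left_module_free[OF assms(1)] assms(3)])
  obtain A :: "'a umodule" and p where A: "left_module R A" and
    p: "p \<in> mod_hom R (free_module R n) A" "p ` carrier (free_module R n) = carrier A"
      "mod_ker (free_module R n) A p = L"
    by (rule free_quotient_exists[OF assms(1) L(1)])
  have gen: "generates R (free_module R n) S (mod_ker (free_module R n) A p)"
    using L(2) p(3) by simp
  have "fin_pres R A"
    unfolding fin_pres_iff by (intro conjI A exI[of _ n] exI[of _ p] exI[of _ S] p(1,2) gen assms(2))
  from this p(1,2) gen show ?thesis by (rule that)
qed

text \<open>On the external sum the idempotent is the projection onto \<open>B\<close>, and \<phi>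
  is extended by zero on \<open>B\<close>.\<close>

lemma exact_imp_lesssim:
  assumes A: "left_module R A" and B: "left_module R B" and M: "left_module R M"
    and \<phi>: "\<phi> \<in> mod_hom R A M" and \<gamma>: "\<gamma> \<in> mod_hom R M B"
    and exact: "\<phi> ` carrier A = mod_ker M B \<gamma>" and surj: "\<gamma> ` carrier M = carrier B"
  shows "mod_lesssim R M (direct_sum A B)"
proof (rule mod_lesssimI[OF M left_module_direct_sum[OF A B]
      mod_hom_pair[OF mod_hom_const_zero[OF A] mod_hom_snd] mod_hom_comp[OF mod_hom_fst \<phi>]
      mod_hom_pair[OF mod_hom_const_zero[OF A] \<gamma>]])
  interpret A: left_module R A by fact
  interpret B: left_module R B by fact
  have "(\<lambda>x. \<phi> (fst x)) ` (carrier A \<times> carrier B) = \<phi> ` fst ` (carrier A \<times> carrier B)"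
    by (simp only: image_image)
  also have "\<dots> = \<phi> ` carrier A" using B.M.zero_closed by (subst fst_image_times) auto
  also have "\<dots> = mod_ker M (direct_sum A B) (\<lambda>x. (\<zero>\<^bsub>A\<^esub>, \<gamma> x))"
    unfolding exact by (auto simp: mod_ker_def)
  finally show "(\<lambda>x. \<phi> (fst x)) ` carrier (direct_sum A B) =
      mod_ker M (direct_sum A B) (\<lambda>x. (\<zero>\<^bsub>A\<^esub>, \<gamma> x))" by simp
  have "(\<lambda>x. (\<zero>\<^bsub>A\<^esub>, \<gamma> x)) ` carrier M = Pair \<zero>\<^bsub>A\<^esub> ` \<gamma> ` carrier M" by (simp only: image_image)
  also have "\<dots> = (\<lambda>x. (\<zero>\<^bsub>A\<^esub>, snd x)) ` (carrier A \<times> carrier B)"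
    unfolding surj using A.M.zero_closed by force
  finally show "(\<lambda>x. (\<zero>\<^bsub>A\<^esub>, \<gamma> x)) ` carrier M =
      (\<lambda>x. (\<zero>\<^bsub>A\<^esub>, snd x)) ` carrier (direct_sum A B)" by simp
qed (auto simp: mod_hom_zero[OF A M \<phi>])

text \<open>The finite set \<open>S\<close> must work for all \<open>M'\<close> with kernel between \<open>S\<close> and \<open>ker p\<close>, not just for one:
  the induction along the chain needs to enlarge the kernel so that it splits.\<close>

definition fp_approximable ::
  "('a, 'r) ring_scheme \<Rightarrow> 'a umodule \<Rightarrow> 'a umodule \<Rightarrow> bool" where
  "fp_approximable R N M \<longleftrightarrow> (\<forall>n. \<forall>p\<in>mod_hom R (free_module R n) M.
     p ` carrier (free_module R n) = carrier M \<longrightarrow>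
     (\<exists>S. finite S \<and> S \<subseteq> mod_ker (free_module R n) M p \<and>
       (\<forall>M'. fin_pres R M' \<longrightarrow> (\<forall>p'\<in>mod_hom R (free_module R n) M'.
          p' ` carrier (free_module R n) = carrier M' \<longrightarrow>
          S \<subseteq> mod_ker (free_module R n) M' p' \<longrightarrow>
          mod_ker (free_module R n) M' p' \<subseteq> mod_ker (free_module R n) M p \<longrightarrow>
          mod_preceq R (fin_pres R) M' N))))"

text \<open>Take for \<open>S\<close> a finite generating set of the kernel of \<open>p\<close>.
  Containing \<open>S\<close> then forces the kernel of \<open>p'\<close> to be all of the kernel of
  \<open>p\<close>, so \<open>M'\<close> is isomorphic to \<open>N\<close>.\<close>

lemma fp_approximable_refl:
  assumes "fin_pres R N"
  shows "fp_approximable R N N"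
  unfolding fp_approximable_def
proof (intro allI ballI impI)
  fix n p assume p: "p \<in> mod_hom R (free_module R n) N" "p ` carrier (free_module R n) = carrier N"
  let ?F = "free_module R n"
  have N: "left_module R N" using assms by (simp add: fin_pres_def)
  have F: "left_module R ?F" by (rule left_module_free[OF left_module.axioms(1)[OF N]])
  obtain S where S: "finite S" "generates R ?F S (mod_ker ?F N p)"
    by (rule fin_pres_kernel_generates[OF assms p])
  have "mod_preceq R (fin_pres R) M' N"
    if M': "fin_pres R M'" and p': "p' \<in> mod_hom R ?F M'" "p' ` carrier ?F = carrier M'"
      "S \<subseteq> mod_ker ?F M' p'" "mod_ker ?F M' p' \<subseteq> mod_ker ?F N p" for M' :: "'a umodule" and p'
  proof -
    have lM': "left_module R M'" using M' by (simp add: fin_pres_def)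
    have "mod_ker ?F N p \<subseteq> mod_ker ?F M' p'"
      by (rule generatesD[OF S(2) submodule_mod_ker[OF F lM' p'(1)] p'(3)])
    with p'(4) have "mod_ker ?F M' p' = mod_ker ?F N p" by (rule subset_antisym)
    then have "mod_isomorphic R M' N"
      by (rule mod_isomorphic_quotient[OF F lM' N p'(1,2) p])
    then have "mod_lesssim R M' N" by (rule mod_isomorphic_imp_lesssim[OF lM' N])
    then show ?thesis by (rule mod_preceq_step[OF M' assms])
  qed
  moreover have "S \<subseteq> mod_ker ?F N p" using S(2) by (simp add: generates_def)
  ultimately show "\<exists>S. finite S \<and> S \<subseteq> mod_ker ?F N p \<and>
       (\<forall>M'. fin_pres R M' \<longrightarrow> (\<forall>p'\<in>mod_hom R ?F M'. p' ` carrier ?F = carrier M' \<longrightarrow>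
          S \<subseteq> mod_ker ?F M' p' \<longrightarrow> mod_ker ?F M' p' \<subseteq> mod_ker ?F N p \<longrightarrow>
          mod_preceq R (fin_pres R) M' N))"
    using S(1) by (intro exI[of _ S]) simp
qed

text \<open>The descent along one step of the chain, with \<open>A\<close> and \<open>B\<close> of
  the exact sequence realised as the kernel and the image of the idempotent \<open>e\<close> on
  \<open>N0\<close>. The finite set \<open>T\<close> that \<open>app\<close> supplies for the cover
  \<open>q\<close> of \<open>N0\<close> is translated into a finite set \<open>S\<close> for the
  cover \<open>p\<close> of \<open>M\<close>.\<close>

lemma fp_approximable_lesssim:
  fixes N N0 M :: "'a umodule"
  assumes le: "mod_lesssim R M N0" and gen: "fin_gen R N0" and app: "fp_approximable R N N0"
  shows "fp_approximable R N M"
  unfolding fp_approximable_def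
proof (intro allI ballI impI)
  fix n p assume p: "p \<in> mod_hom R (free_module R n) M" "p ` carrier (free_module R n) = carrier M"
  obtain e f g where M: "left_module R M" and N0: "left_module R N0" and
    e: "e \<in> mod_hom R N0 N0" and f: "f \<in> mod_hom R N0 M" and g: "g \<in> mod_hom R M N0" and
    ee: "\<forall>y\<in>carrier N0. e (e y) = e y" and fe: "\<forall>y\<in>carrier N0. f (e y) = \<zero>\<^bsub>M\<^esub>" and
    exact: "f ` carrier N0 = mod_ker M N0 g" and range: "g ` carrier M = e ` carrier N0"
    by (rule mod_lesssimE[OF le])
  interpret M: left_module R M by (rule M)
  interpret N0: left_module R N0 by (rule N0)
  note R = M.R.ring_axioms
  have F: "left_module R (free_module R k)" for k by (rule left_module_free[OF R])
  obtain a r where r: "r \<in> mod_hom R (free_module R a) N0" "r ` carrier (free_module R a) = carrier N0"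
    by (rule fin_gen_cover[OF gen])
  let ?Fn = "free_module R n" and ?Fa = "free_module R a"
  let ?D = "direct_sum ?Fa ?Fn"
  interpret Fn: left_module R ?Fn by (rule F)
  interpret Fa: left_module R ?Fa by (rule F)
  have D: "left_module R ?D" by (rule left_module_direct_sum[OF F F])
  note rc = mod_homD(1)[OF r(1)] and pc = mod_homD(1)[OF p(1)] and ec = mod_homD(1)[OF e]
    and gc = mod_homD(1)[OF g] and fc = mod_homD(1)[OF f]
  \<comment> \<open>\<open>k\<close> covers the summand \<open>ker e\<close>, \<open>g \<circ> p\<close> covers \<open>im e\<close>, and \<open>q\<close> below covers their sum.\<close>
  define k where "k c = r c \<ominus>\<^bsub>N0\<^esub> e (r c)" for c
  have k: "k \<in> mod_hom R ?Fa N0"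
    unfolding k_def by (rule mod_hom_diff[OF F N0 r(1) mod_hom_comp[OF r(1) e]])
  note kc = mod_homD(1)[OF k]
  have ek: "e (k c) = \<zero>\<^bsub>N0\<^esub>" if "c \<in> carrier ?Fa" for c
    using that rc ec by (simp add: k_def mod_hom_minus[OF N0 N0 e] ee N0.diff_self)
  have fk: "f (k c) = f (r c)" if "c \<in> carrier ?Fa" for c
    using that rc ec fc by (simp add: k_def mod_hom_minus[OF N0 M f] fe) (simp add: a_minus_def)
  have eg: "e (g x) = g x" if "x \<in> carrier M" for x
  proof -
    have "g x \<in> e ` carrier N0" using that range by blast
    then obtain y where "y \<in> carrier N0" "g x = e y" by blast
    then show ?thesis by (simp add: ee)
  qed
  have gf: "g (f y) = \<zero>\<^bsub>N0\<^esub>" if "y \<in> carrier N0" for y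
  proof -
    have "f y \<in> mod_ker M N0 g" using that exact by blast
    then show ?thesis by (simp add: mod_ker_def)
  qed
  define q where "q x = k (fst x) \<oplus>\<^bsub>N0\<^esub> g (p (snd x))" for x
  have q: "q \<in> mod_hom R ?D N0"
    unfolding q_def
    by (rule mod_hom_add[OF N0 mod_hom_comp[OF mod_hom_fst k]
          mod_hom_comp[OF mod_hom_snd mod_hom_comp[OF p(1) g]]])
  have q_surj: "q ` carrier ?D = carrier N0"
  proof (intro equalityI subsetI)
    show "y \<in> carrier N0" if "y \<in> q ` carrier ?D" for y
      using that mod_homD(1)[OF q] by blast
    fix y assume y: "y \<in> carrier N0"
    then have "y \<in> r ` carrier ?Fa" using r(2) by simp
    then obtain c where c: "c \<in> carrier ?Fa" "y = r c" by blast
    have "e y \<in> g ` carrier M" using range y by simp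
    then obtain x where x: "x \<in> carrier M" "e y = g x" by blast
    then have "x \<in> p ` carrier ?Fn" using p(2) by simp
    then obtain d where d: "d \<in> carrier ?Fn" "x = p d" by blast
    have "q (c, d) = (y \<ominus>\<^bsub>N0\<^esub> e y) \<oplus>\<^bsub>N0\<^esub> e y"
      unfolding q_def k_def fst_conv snd_conv c(2)[symmetric] d(2)[symmetric] x(2)[symmetric] ..
    also have "\<dots> = y" by (rule N0.add_diff_cancel(2)[OF ec[OF y] y])
    finally have "q (c, d) = y" .
    moreover have "(c, d) \<in> carrier ?D" using c(1) d(1) by simp
    ultimately show "y \<in> q ` carrier ?D" by (metis imageI)
  qed
  \<comment> \<open>Applying \<open>e\<close> kills the \<open>k\<close> part and fixes the
    \<open>g\<close> part, so a relation of the sum is a pair of relations.\<close>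
  have q_ker: "k (fst x) = \<zero>\<^bsub>N0\<^esub>" "g (p (snd x)) = \<zero>\<^bsub>N0\<^esub>"
    if x: "x \<in> carrier ?D" "q x = \<zero>\<^bsub>N0\<^esub>" for x
  proof -
    have c: "fst x \<in> carrier ?Fa" "snd x \<in> carrier ?Fn" using x(1) by auto
    have "e (q x) = g (p (snd x))"
      using c kc pc gc by (simp add: q_def mod_homD(2)[OF e] ek eg)
    then show g0: "g (p (snd x)) = \<zero>\<^bsub>N0\<^esub>" using x(2) mod_hom_zero[OF N0 N0 e] by simp
    show "k (fst x) = \<zero>\<^bsub>N0\<^esub>" using x(2) c kc by (simp add: q_def g0)
  qed
  let ?q = "\<lambda>z. q (vec_split a n z)" and ?F = "free_module R (a + n)"
  have sp: "vec_split a n ` carrier ?F = carrier ?D"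
  proof (intro equalityI subsetI)
    show "x \<in> carrier ?D" if "x \<in> vec_split a n ` carrier ?F" for x
      using that mod_homD(1)[OF vec_split_hom] by (auto simp del: direct_sum_simps)
    show "x \<in> vec_split a n ` carrier ?F" if x: "x \<in> carrier ?D" for x
      using vec_split_append[OF x] mod_homD(1)[OF vec_append_hom x] by (metis imageI)
  qed
  have q1: "?q \<in> mod_hom R ?F N0" by (rule mod_hom_comp[OF vec_split_hom q])
  have "?q ` carrier ?F = q ` vec_split a n ` carrier ?F" by (simp only: image_image)
  then have q1_surj: "?q ` carrier ?F = carrier N0" by (simp only: sp q_surj)
  obtain T where T: "finite T" "T \<subseteq> mod_ker ?F N0 ?q" and
    T_app: "\<forall>M'. fin_pres R M' \<longrightarrow> (\<forall>p'\<in>mod_hom R ?F M'. p' ` carrier ?F = carrier M' \<longrightarrow>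
          T \<subseteq> mod_ker ?F M' p' \<longrightarrow> mod_ker ?F M' p' \<subseteq> mod_ker ?F N0 ?q \<longrightarrow>
          mod_preceq R (fin_pres R) M' N)"
    using app[unfolded fp_approximable_def, rule_format, OF q1 q1_surj] by blast
  \<comment> \<open>The relations in \<open>T\<close>, read as pairs in R^a \<oplus> R^n.\<close>
  define T2 where "T2 = vec_split a n ` T"
  have T2: "x \<in> carrier ?D" "q x = \<zero>\<^bsub>N0\<^esub>" if x: "x \<in> T2" for x
  proof -
    obtain z where z: "z \<in> T" "x = vec_split a n z" using x by (auto simp: T2_def)
    then have "z \<in> mod_ker ?F N0 ?q" using T(2) by blast
    then have "z \<in> carrier ?F" "?q z = \<zero>\<^bsub>N0\<^esub>" unfolding mod_ker_def by blast+
    then show "x \<in> carrier ?D" "q x = \<zero>\<^bsub>N0\<^esub>"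
      using mod_homD(1)[OF vec_split_hom] unfolding z(2) by blast+
  qed
  have T2c: "fst x \<in> carrier ?Fa" "snd x \<in> carrier ?Fn" if "x \<in> T2" for x
    using T2(1)[OF that] by auto
  \<comment> \<open>\<open>h\<close> is a matrix for the map from the first summand to
    \<open>M\<close>; \<open>f\<close> agrees on \<open>k c\<close> and \<open>r c\<close> by
    \<open>fk\<close>.\<close>
  obtain h where h: "h \<in> mod_hom R ?Fa ?Fn" and ph: "\<And>c. c \<in> carrier ?Fa \<Longrightarrow> p (h c) = f (k c)"
    using free_module_projective[OF F M p mod_hom_comp[OF k f]] by blast
  note hc = mod_homD(1)[OF h]
  \<comment> \<open>The second coordinate of \<open>x\<close> vanishes under \<open>g\<close>
    \<circ> \<open>p\<close>, so by exactness its image in \<open>M\<close> comes from the first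
    summand and equals \<open>p (h u)\<close> for some \<open>u\<close>. Subtracting
    \<open>h u\<close> leaves a relation of \<open>M\<close>.\<close>
  have "\<exists>u\<in>carrier ?Fa. p (snd x \<ominus>\<^bsub>?Fn\<^esub> h u) = \<zero>\<^bsub>M\<^esub>" if x: "x \<in> T2" for x
  proof -
    have "p (snd x) \<in> mod_ker M N0 g"
      using T2c[OF x] pc q_ker(2)[OF T2[OF x]] by (simp add: mod_ker_def)
    then have "p (snd x) \<in> f ` carrier N0" using exact by simp
    then obtain y where y: "y \<in> carrier N0" "p (snd x) = f y" by blast
    then have "y \<in> r ` carrier ?Fa" using r(2) by simp
    then obtain u where u: "u \<in> carrier ?Fa" "y = r u" by blast
    have "p (snd x \<ominus>\<^bsub>?Fn\<^esub> h u) = \<zero>\<^bsub>M\<^esub>"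
      using T2c[OF x] u(1) hc pc fc y(1)
      by (simp add: mod_hom_minus[OF F M p(1)] ph fk y(2) flip: u(2)) (simp add: M.diff_self)
    then show ?thesis using u(1) by blast
  qed
  then obtain w where w: "\<And>x. x \<in> T2 \<Longrightarrow> w x \<in> carrier ?Fa"
    "\<And>x. x \<in> T2 \<Longrightarrow> p (snd x \<ominus>\<^bsub>?Fn\<^esub> h (w x)) = \<zero>\<^bsub>M\<^esub>"
    by metis
  \<comment> \<open>The first family makes \<open>h\<close> respect the relations of
    \<open>A\<close>; the second forces the second coordinates of \<open>T2\<close> to become
    relations of \<open>B\<close>, where values of \<open>h\<close> vanish.\<close>
  define S where "S = (\<lambda>x. h (fst x)) ` T2 \<union> (\<lambda>x. snd x \<ominus>\<^bsub>?Fn\<^esub> h (w x)) ` T2"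
  have S_fin: "finite S" using T(1) by (simp add: S_def T2_def)
  have S_ker: "S \<subseteq> mod_ker ?Fn M p"
  proof
    fix s assume "s \<in> S"
    then consider x where "x \<in> T2" "s = h (fst x)" | x where "x \<in> T2" "s = snd x \<ominus>\<^bsub>?Fn\<^esub> h (w x)"
      unfolding S_def by blast
    then show "s \<in> mod_ker ?Fn M p"
    proof cases
      case 1
      then show ?thesis
        using T2c(1)[OF 1(1)] q_ker(1)[OF T2[OF 1(1)]] hc mod_hom_zero[OF N0 M f]
        by (simp add: mod_ker_def ph)
    next
      case 2
      then show ?thesis
        using T2c(2)[OF 2(1)] w[OF 2(1)] hc Fn.M.minus_closed by (simp add: mod_ker_def)
    qed
  qed
  have "mod_preceq R (fin_pres R) M' N"
    if M'fp: "fin_pres R M'" and p': "p' \<in> mod_hom R ?Fn M'" "p' ` carrier ?Fn = carrier M'"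
      and S': "S \<subseteq> mod_ker ?Fn M' p'" and ker': "mod_ker ?Fn M' p' \<subseteq> mod_ker ?Fn M p"
    for M' :: "'a umodule" and p'
  proof -
    have M': "left_module R M'" using M'fp by (simp add: fin_pres_def)
    interpret M': left_module R M' by (rule M')
    obtain U where U: "finite U" "generates R ?Fn U (mod_ker ?Fn M' p')"
      by (rule fin_pres_kernel_generates[OF M'fp p'])
    have Uker: "U \<subseteq> mod_ker ?Fn M' p'" using U(2) by (simp add: generates_def)
    have units: "unit_vec R a i \<in> carrier ?Fa" for i by (rule unit_vec_closed[OF R])
    \<comment> \<open>The relations of \<open>A\<close> are the fewest that the demand
      \<open>T\<close> allows: this makes it easiest for \<open>h\<close> to descend, and keeps them
      inside the kernel of \<open>k\<close>.\<close>
    obtain A :: "'a umodule" and \<pi> where A: "fin_pres R A" "\<pi> \<in> mod_hom R ?Fa A"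
      "\<pi> ` carrier ?Fa = carrier A" "generates R ?Fa (fst ` T2) (mod_ker ?Fa A \<pi>)"
    proof (rule fin_pres_quotient_exists[OF R])
      show "finite (fst ` T2)" using T(1) by (simp add: T2_def)
      show "fst ` T2 \<subseteq> carrier ?Fa" using T2c by blast
    qed
    \<comment> \<open>\<open>B\<close> is R^n modulo the kernel of \<open>p'\<close> plus the image
      of \<open>h\<close>, that is, the cokernel of the map from \<open>A\<close> to
      \<open>M'\<close>. Finiteness of \<open>U\<close> is what makes it finitely presented.\<close>
    let ?V = "U \<union> (\<lambda>i. h (unit_vec R a i)) ` {..<a}"
    obtain B :: "'a umodule" and \<rho> where B: "fin_pres R B" "\<rho> \<in> mod_hom R ?Fn B"
      "\<rho> ` carrier ?Fn = carrier B" "generates R ?Fn ?V (mod_ker ?Fn B \<rho>)"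
    proof (rule fin_pres_quotient_exists[OF R])
      show "finite ?V" using U(1) by simp
      have "U \<subseteq> carrier ?Fn" using Uker unfolding mod_ker_def by blast
      then show "?V \<subseteq> carrier ?Fn" using hc units by blast
    qed
    have lA: "left_module R A" and lB: "left_module R B"
      using A(1) B(1) by (simp_all add: fin_pres_def)
    interpret A: left_module R A by (rule lA)
    interpret B: left_module R B by (rule lB)
    have kerA: "submodule (mod_ker ?Fa A \<pi>) R ?Fa" by (rule submodule_mod_ker[OF F lA A(2)])
    have kerB: "submodule (mod_ker ?Fn B \<rho>) R ?Fn" by (rule submodule_mod_ker[OF F lB B(2)])
    have kerAc: "mod_ker ?Fa A \<pi> \<subseteq> carrier ?Fa" and kerBc: "mod_ker ?Fn B \<rho> \<subseteq> carrier ?Fn"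
      unfolding mod_ker_def by blast+
    have \<rho>U: "mod_ker ?Fn M' p' \<subseteq> mod_ker ?Fn B \<rho>"
      using generatesD[OF U(2) kerB] B(4) by (simp add: generates_def)
    have \<rho>h: "\<rho> (h c) = \<zero>\<^bsub>B\<^esub>" if "c \<in> carrier ?Fa" for c
    proof -
      have "h c \<in> mod_ker ?Fn B \<rho>"
        by (rule generates_hom_mem[OF F F generates_unit_vec[OF R] subset_refl h kerB _ that])
          (use B(4) in \<open>auto simp: generates_def\<close>)
      then show ?thesis by (simp add: mod_ker_def)
    qed
    have p'h: "p' (h c) = \<zero>\<^bsub>M'\<^esub>" if c: "c \<in> carrier ?Fa" "\<pi> c = \<zero>\<^bsub>A\<^esub>" for c
    proof -
      have "c \<in> mod_ker ?Fa A \<pi>" using c by (simp add: mod_ker_def)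
      then have "p' (h c) \<in> {\<zero>\<^bsub>M'\<^esub>}"
      proof (rule generates_hom_mem[OF F M' A(4) kerAc mod_hom_comp[OF h p'(1)] M'.submodule_zero, rotated])
        fix c assume "c \<in> fst ` T2"
        then have "h c \<in> S" unfolding S_def by blast
        then have "h c \<in> mod_ker ?Fn M' p'" using S' by blast
        then show "p' (h c) \<in> {\<zero>\<^bsub>M'\<^esub>}" by (simp add: mod_ker_def)
      qed
      then show ?thesis by simp
    qed
    obtain \<phi> where \<phi>: "\<phi> \<in> mod_hom R A M'" and \<phi>\<pi>: "\<forall>c\<in>carrier ?Fa. \<phi> (\<pi> c) = p' (h c)"
      using mod_hom_factor[OF F lA M' A(2,3) mod_hom_comp[OF h p'(1)] p'h] by blast
    have \<rho>0: "\<rho> d = \<zero>\<^bsub>B\<^esub>" if "d \<in> carrier ?Fn" "p' d = \<zero>\<^bsub>M'\<^esub>" for d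
    proof -
      have "d \<in> mod_ker ?Fn M' p'" using that by (simp add: mod_ker_def)
      then have "d \<in> mod_ker ?Fn B \<rho>" using \<rho>U by blast
      then show ?thesis by (simp add: mod_ker_def)
    qed
    obtain \<gamma> where \<gamma>: "\<gamma> \<in> mod_hom R M' B" and \<gamma>p': "\<forall>d\<in>carrier ?Fn. \<gamma> (p' d) = \<rho> d"
      using mod_hom_factor[OF F M' lB p' B(2) \<rho>0] by blast
    have "\<gamma> ` p' ` carrier ?Fn = \<rho> ` carrier ?Fn"
      unfolding image_image using \<gamma>p' by (intro image_cong) simp_all
    then have \<gamma>_surj: "\<gamma> ` carrier M' = carrier B" by (simp only: p'(2) B(3))
    \<comment> \<open>For the kernel inside the image only the generators \<open>?V\<close> matter:
      those in \<open>U\<close> die in \<open>M'\<close>, and values of \<open>h\<close> come from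
      \<open>A\<close> by the definition of \<phi>.\<close>
    have \<phi>\<gamma>: "\<phi> ` carrier A = mod_ker M' B \<gamma>"
    proof (intro equalityI subsetI)
      fix x assume "x \<in> \<phi> ` carrier A"
      then have "x \<in> \<phi> ` \<pi> ` carrier ?Fa" using A(3) by simp
      then obtain c where c: "c \<in> carrier ?Fa" "x = p' (h c)" using \<phi>\<pi> by auto
      then show "x \<in> mod_ker M' B \<gamma>"
        using \<gamma>p' hc \<rho>h mod_homD(1)[OF p'(1)] by (simp add: mod_ker_def)
    next
      fix x assume x: "x \<in> mod_ker M' B \<gamma>"
      then have "x \<in> p' ` carrier ?Fn" using p'(2) by (simp add: mod_ker_def)
      then obtain d where d: "d \<in> carrier ?Fn" "x = p' d" by blast
      then have "d \<in> mod_ker ?Fn B \<rho>" using x \<gamma>p' by (simp add: mod_ker_def)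
      then have "p' d \<in> \<phi> ` carrier A"
      proof (rule generates_hom_mem[OF F M' B(4) kerBc p'(1)
            submodule_image[OF lA M' \<phi> A.submodule_carrier], rotated])
        fix v assume "v \<in> ?V"
        then consider "v \<in> U" | i where "v = h (unit_vec R a i)" by blast
        then show "p' v \<in> \<phi> ` carrier A"
        proof cases
          case 1
          then have "p' v = \<zero>\<^bsub>M'\<^esub>" using Uker by (auto simp: mod_ker_def)
          then show ?thesis using mod_hom_zero[OF lA M' \<phi>] A.M.zero_closed by (metis imageI)
        next
          case 2
          then have "p' v = \<phi> (\<pi> (unit_vec R a i))" using \<phi>\<pi> units by simp
          then show ?thesis using mod_homD(1)[OF A(2) units] by blast
        qed
      qed
      then show "x \<in> \<phi> ` carrier A" using d(2) by simp
    qed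
    have le': "mod_lesssim R M' (direct_sum A B)"
      by (rule exact_imp_lesssim[OF lA lB M' \<phi> \<gamma> \<phi>\<gamma> \<gamma>_surj])
    have fpAB: "fin_pres R (direct_sum A B)" by (rule fin_pres_direct_sum[OF A(1) B(1)])
    have lAB: "left_module R (direct_sum A B)" by (rule left_module_direct_sum[OF lA lB])
    \<comment> \<open>The sum lives on pairs, but \<open>T_app\<close> speaks of
      \<open>umodule\<close> only.\<close>
    obtain C :: "'a umodule" where C: "left_module R C" "mod_isomorphic R C (direct_sum A B)"
      by (rule fin_gen_copy[OF fin_pres_imp_fin_gen[OF fpAB]])
    have isoC: "mod_isomorphic R (direct_sum A B) C" by (rule mod_isomorphic_sym[OF C(2,1)])
    have Cfp: "fin_pres R C" by (rule fin_pres_isomorphic[OF fpAB isoC C(1)])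
    have leC: "mod_lesssim R M' C"
      by (rule mod_lesssim_cong[OF le' mod_isomorphic_refl isoC M' C(1)])
    obtain \<theta> where \<theta>: "\<theta> \<in> mod_hom R (direct_sum A B) C" "bij_betw \<theta> (carrier (direct_sum A B)) (carrier C)"
      using isoC unfolding mod_isomorphic_def by blast
    have \<theta>0: "\<theta> x = \<zero>\<^bsub>C\<^esub> \<longleftrightarrow> x = \<zero>\<^bsub>direct_sum A B\<^esub>" if "x \<in> carrier (direct_sum A B)" for x
    proof -
      have "\<zero>\<^bsub>direct_sum A B\<^esub> \<in> carrier (direct_sum A B)" by simp
      with that \<theta>(2) have "\<theta> x = \<theta> \<zero>\<^bsub>direct_sum A B\<^esub> \<longleftrightarrow> x = \<zero>\<^bsub>direct_sum A B\<^esub>"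
        unfolding bij_betw_def by (metis inj_onD)
      then show ?thesis using mod_hom_zero[OF lAB C(1) \<theta>(1)] by simp
    qed
    let ?\<pi>\<rho> = "\<lambda>(c, d). (\<pi> c, \<rho> d)"
    have \<pi>\<rho>: "?\<pi>\<rho> \<in> mod_hom R ?D (direct_sum A B)" by (rule mod_hom_map_prod[OF A(2) B(2)])
    \<comment> \<open>A cover of \<open>C\<close> by the same free module that covers
      \<open>N0\<close> through \<open>?q\<close>, so that the two kernels can be compared.\<close>
    let ?s = "\<lambda>z. \<theta> (?\<pi>\<rho> (vec_split a n z))"
    have s: "?s \<in> mod_hom R ?F C"
      by (rule mod_hom_comp[OF vec_split_hom mod_hom_comp[OF \<pi>\<rho> \<theta>(1)]])
    have \<pi>\<rho>_surj: "?\<pi>\<rho> ` carrier ?D = carrier (direct_sum A B)"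
      unfolding direct_sum_simps A(3)[symmetric] B(3)[symmetric] by auto
    have "?s ` carrier ?F = \<theta> ` ?\<pi>\<rho> ` vec_split a n ` carrier ?F" by (simp only: image_image)
    then have s_surj: "?s ` carrier ?F = carrier C"
      using \<theta>(2) unfolding bij_betw_def by (simp only: sp \<pi>\<rho>_surj)
    have s0: "?s z = \<zero>\<^bsub>C\<^esub> \<longleftrightarrow> \<pi> (fst (vec_split a n z)) = \<zero>\<^bsub>A\<^esub> \<and> \<rho> (snd (vec_split a n z)) = \<zero>\<^bsub>B\<^esub>"
      if z: "z \<in> carrier ?F" for z
    proof -
      have "?\<pi>\<rho> (vec_split a n z) \<in> carrier (direct_sum A B)"
        by (rule mod_homD(1)[OF \<pi>\<rho> mod_homD(1)[OF vec_split_hom z]])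
      from \<theta>0[OF this] show ?thesis by (simp add: case_prod_beta)
    qed
    have "T \<subseteq> mod_ker ?F C ?s"
    proof
      fix z assume z: "z \<in> T"
      then have zF: "z \<in> carrier ?F" using T(2) unfolding mod_ker_def by blast
      define x where "x = vec_split a n z"
      have x: "x \<in> T2" using z by (simp add: x_def T2_def)
      have "fst x \<in> mod_ker ?Fa A \<pi>" using A(4) x unfolding generates_def by blast
      then have "\<pi> (fst x) = \<zero>\<^bsub>A\<^esub>" by (simp add: mod_ker_def)
      moreover have "\<rho> (snd x) = \<zero>\<^bsub>B\<^esub>"
      proof -
        \<comment> \<open>The corrected relation lies in \<open>S\<close> and is killed by \<rho>;
          the correction \<open>h (w x)\<close> is killed by \<rho> as well.\<close>
        have "snd x \<ominus>\<^bsub>?Fn\<^esub> h (w x) \<in> S" unfolding S_def using x by blast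
        then have "snd x \<ominus>\<^bsub>?Fn\<^esub> h (w x) \<in> mod_ker ?Fn B \<rho>" using S' \<rho>U by blast
        then have "\<rho> (snd x) \<ominus>\<^bsub>B\<^esub> \<rho> (h (w x)) = \<zero>\<^bsub>B\<^esub>"
          using T2c[OF x] w(1)[OF x] hc by (simp add: mod_ker_def mod_hom_minus[OF F lB B(2)])
        then show ?thesis
          using T2c[OF x] w(1)[OF x] mod_homD(1)[OF B(2)] by (simp add: \<rho>h) (simp add: a_minus_def)
      qed
      ultimately show "z \<in> mod_ker ?F C ?s"
        using zF s0[OF zF] unfolding x_def mod_ker_def by blast
    qed
    \<comment> \<open>The upper bound \<open>ker'\<close> enters here: \<open>U\<close> lies in the
      kernel of \<open>p\<close>, while values of \<open>h\<close> are killed by \<open>g\<close>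
      \<circ> \<open>p\<close> because \<open>g\<close> \<circ> \<open>f\<close> is zero.\<close>
    moreover have "mod_ker ?F C ?s \<subseteq> mod_ker ?F N0 ?q"
    proof
      fix z assume "z \<in> mod_ker ?F C ?s"
      then have zF: "z \<in> carrier ?F" and "?s z = \<zero>\<^bsub>C\<^esub>" unfolding mod_ker_def by blast+
      define x where "x = vec_split a n z"
      have xD: "x \<in> carrier ?D" unfolding x_def by (rule mod_homD(1)[OF vec_split_hom zF])
      have xc: "fst x \<in> carrier ?Fa" "snd x \<in> carrier ?Fn" using xD by auto
      have x0: "\<pi> (fst x) = \<zero>\<^bsub>A\<^esub>" "\<rho> (snd x) = \<zero>\<^bsub>B\<^esub>"
        using s0[OF zF] \<open>?s z = \<zero>\<^bsub>C\<^esub>\<close> unfolding x_def by blast+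
      have "fst x \<in> mod_ker ?Fa A \<pi>" using xc x0 by (simp add: mod_ker_def)
      then have "k (fst x) \<in> {\<zero>\<^bsub>N0\<^esub>}"
      proof (rule generates_hom_mem[OF F N0 A(4) kerAc k N0.submodule_zero, rotated])
        fix c assume "c \<in> fst ` T2"
        then obtain t where "t \<in> T2" "c = fst t" by blast
        then show "k c \<in> {\<zero>\<^bsub>N0\<^esub>}" using q_ker(1)[OF T2] by simp
      qed
      moreover have "snd x \<in> mod_ker ?Fn B \<rho>" using xc x0 by (simp add: mod_ker_def)
      then have "g (p (snd x)) \<in> {\<zero>\<^bsub>N0\<^esub>}"
      proof (rule generates_hom_mem[OF F N0 B(4) kerBc mod_hom_comp[OF p(1) g] N0.submodule_zero, rotated])
        fix v assume "v \<in> ?V"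
        then consider "v \<in> U" | i where "v = h (unit_vec R a i)" by blast
        then show "g (p v) \<in> {\<zero>\<^bsub>N0\<^esub>}"
        proof cases
          case 1
          then have "v \<in> mod_ker ?Fn M p" using Uker ker' by blast
          then show ?thesis using mod_hom_zero[OF M N0 g] by (simp add: mod_ker_def)
        next
          case 2
          then show ?thesis using gf kc units by (simp add: ph)
        qed
      qed
      ultimately have "q x = \<zero>\<^bsub>N0\<^esub>" by (simp add: q_def)
      then show "z \<in> mod_ker ?F N0 ?q" using zF by (simp add: mod_ker_def x_def)
    qed
    ultimately have "mod_preceq R (fin_pres R) C N"
      using T_app[rule_format, OF Cfp s s_surj] by blast
    with mod_preceq_step[of "fin_pres R", OF M'fp Cfp leC] show ?thesis by (rule mod_preceq_trans)
  qed
  with S_fin S_ker show "\<exists>S. finite S \<and> S \<subseteq> mod_ker ?Fn M p \<and>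
       (\<forall>M'. fin_pres R M' \<longrightarrow> (\<forall>p'\<in>mod_hom R ?Fn M'. p' ` carrier ?Fn = carrier M' \<longrightarrow>
          S \<subseteq> mod_ker ?Fn M' p' \<longrightarrow> mod_ker ?Fn M' p' \<subseteq> mod_ker ?Fn M p \<longrightarrow>
          mod_preceq R (fin_pres R) M' N))"
    by (intro exI[of _ S]) simp
qed

lemma mod_preceq_fin_gen_imp_fin_pres:
  fixes M N :: "'a umodule"
  assumes "fin_pres R M" "fin_pres R N" "mod_preceq R (fin_gen R) M N"
  shows "mod_preceq R (fin_pres R) M N"
proof -
  have "(chain_step R (fin_gen R))\<^sup>*\<^sup>* M N" using assms(3) unfolding mod_preceq_iff by simp
  then have app: "fp_approximable R N M"
  proof (induction rule: converse_rtranclp_induct)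
    case base
    show ?case by (rule fp_approximable_refl[OF assms(2)])
  next
    case (step A B)
    then show ?case unfolding chain_step_def by (intro fp_approximable_lesssim[of R A B]) simp_all
  qed
  obtain n p where p: "p \<in> mod_hom R (free_module R n) M" "p ` carrier (free_module R n) = carrier M"
    by (rule fin_gen_cover[OF fin_pres_imp_fin_gen[OF assms(1)]])
  obtain S where "S \<subseteq> mod_ker (free_module R n) M p" and
    "\<forall>M'. fin_pres R M' \<longrightarrow> (\<forall>p'\<in>mod_hom R (free_module R n) M'.
          p' ` carrier (free_module R n) = carrier M' \<longrightarrow>
          S \<subseteq> mod_ker (free_module R n) M' p' \<longrightarrow>
          mod_ker (free_module R n) M' p' \<subseteq> mod_ker (free_module R n) M p \<longrightarrow>
          mod_preceq R (fin_pres R) M' N)"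
    using app[unfolded fp_approximable_def, rule_format, OF p] by blast
  \<comment> \<open>\<open>M\<close> with \<open>p' = p\<close> is an approximation of itself,
    whatever \<open>S\<close> is.\<close>
  then show ?thesis using assms(1) p by simp
qed

section \<open>The monoids of classes\<close>

lemma mod_isomorphic_free_add:
  "mod_isomorphic R (direct_sum (free_module R m) (free_module R n)) (free_module R (m + n))"
  by (rule mod_isomorphicI[OF vec_append_hom vec_split_hom vec_split_append vec_append_split])

lemma mod_isomorphic_free_one:
  "mod_isomorphic R (regular_module R) (free_module R 1)"
  by (rule mod_isomorphicI[of "\<lambda>a. \<lambda>i\<in>{..<1}. a" _ _ _ "\<lambda>c. c 0"])
    (auto simp: free_module_simps regular_module_def PiE_iff extensional_def fun_eq_iff
      intro!: mod_homI)

lemma mod_isomorphic_free_zero: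
  fixes R :: "('a, 'r) ring_scheme"
  assumes "ring R"
  shows "mod_isomorphic R (zero_module :: ('a, unit) module) (free_module R 0)"
  by (rule mod_isomorphicI[of "\<lambda>_. \<lambda>i\<in>{..<0}. undefined" _ _ _ "\<lambda>_. ()"])
    (auto simp: free_module_simps zero_module_def intro!: mod_homI)

text \<open>One development for both monoids. The predicate \<open>P\<close> lives on
  \<open>umodule\<close> only, so closure under sums and membership of the zero and regular modules
  are stated for isomorphic copies \<open>X\<close>.\<close>

locale module_class =
  fixes R :: "('a, 'r) ring_scheme" (structure) and P :: "'a umodule \<Rightarrow> bool"
  assumes R: "ring R"
    and P_fin_gen: "P M \<Longrightarrow> fin_gen R M"
    and P_iso: "P M \<Longrightarrow> mod_isomorphic R M N \<Longrightarrow> left_module R N \<Longrightarrow> P N"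
    and P_sum: "P M \<Longrightarrow> P N \<Longrightarrow> mod_isomorphic R X (direct_sum M N) \<Longrightarrow> left_module R X \<Longrightarrow> P X"
    and P_zero: "mod_isomorphic R X zero_module \<Longrightarrow> left_module R X \<Longrightarrow> P X"
    and P_regular: "mod_isomorphic R X (regular_module R) \<Longrightarrow> left_module R X \<Longrightarrow> P X"
begin

lemma P_left_module: "P M \<Longrightarrow> left_module R M"
  using P_fin_gen by (simp add: fin_gen_def)

lemma preceq_iso:
  assumes "P M" "mod_isomorphic R M N" "left_module R N"
  shows "mod_preceq R P M N"
  by (rule mod_preceq_step[of P, OF assms(1) P_iso[OF assms]
        mod_isomorphic_imp_lesssim[OF P_left_module[OF assms(1)] assms(3,2)]])

lemma sim_iso:
  assumes "P M" "mod_isomorphic R M N" "left_module R N"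
  shows "mod_sim R P M N"
  unfolding mod_sim_def
  by (intro conjI preceq_iso assms P_iso[OF assms] mod_isomorphic_sym P_left_module)

lemma sim_refl: "P M \<Longrightarrow> mod_sim R P M M"
  unfolding mod_sim_def by (simp add: mod_preceq_refl)

lemma sim_sym: "mod_sim R P M N \<Longrightarrow> mod_sim R P N M"
  unfolding mod_sim_def by simp

lemma sim_trans:
  assumes "mod_sim R P M N" "mod_sim R P N K"
  shows "mod_sim R P M K"
  using mod_preceq_trans[of R P M N K] mod_preceq_trans[of R P K N M] assms
  unfolding mod_sim_def by simp

lemma sim_imp: "mod_sim R P M N \<Longrightarrow> P M \<and> P N"
  unfolding mod_sim_def using mod_preceq_imp by blast

lemma iso_common:
  assumes "mod_isomorphic R M Y" "mod_isomorphic R N Y" "left_module R N"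
  shows "mod_isomorphic R M N"
  by (rule mod_isomorphic_trans[OF assms(1) mod_isomorphic_sym[OF assms(2,3)]])

text \<open>Two copies of \<open>Y\<close> in the class are isomorphic and hence equivalent, so the
  existential over copies in \<open>mod_class\<close> collapses to any one of them.\<close>

lemma class_eq_sim:
  assumes M: "P M" and iso: "mod_isomorphic R M Y"
  shows "mod_class R P Y = {Q. mod_sim R P Q M}"
proof (intro equalityI subsetI)
  fix Q assume "Q \<in> mod_class R P Y"
  then obtain M' where M': "mod_isomorphic R M' Y" "mod_sim R P Q M'"
    unfolding mod_class_def by blast
  have "P M'" using sim_imp[OF M'(2)] by simp
  then have "mod_sim R P M' M"
    by (rule sim_iso[OF _ iso_common[OF M'(1) iso P_left_module[OF M]] P_left_module[OF M]])
  with M'(2) have "mod_sim R P Q M" by (rule sim_trans)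
  then show "Q \<in> {Q. mod_sim R P Q M}" by simp
next
  fix Q assume "Q \<in> {Q. mod_sim R P Q M}"
  then show "Q \<in> mod_class R P Y" unfolding mod_class_def using iso by blast
qed

lemma class_copy:
  assumes "P M" "mod_isomorphic R M Y"
  shows "mod_class R P Y = mod_class R P M"
  by (simp only: class_eq_sim[OF assms] class_eq_sim[OF assms(1) mod_isomorphic_refl])

lemma class_eq_iff:
  assumes "P M" "P N"
  shows "mod_class R P M = mod_class R P N \<longleftrightarrow> mod_sim R P M N"
proof
  assume "mod_class R P M = mod_class R P N"
  then have "{Q. mod_sim R P Q M} = {Q. mod_sim R P Q N}"
    by (simp only: class_eq_sim[OF assms(1) mod_isomorphic_refl]
        class_eq_sim[OF assms(2) mod_isomorphic_refl])
  then show "mod_sim R P M N" using sim_refl[OF assms(1)] by blast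
next
  assume MN: "mod_sim R P M N"
  have "mod_sim R P Q M \<longleftrightarrow> mod_sim R P Q N" for Q
    using sim_trans[of Q M N] sim_trans[of Q N M] sim_sym[OF MN] MN by blast
  then show "mod_class R P M = mod_class R P N"
    by (simp only: class_eq_sim[OF assms(1) mod_isomorphic_refl]
        class_eq_sim[OF assms(2) mod_isomorphic_refl])
qed

lemma mem_class_iff: "P M \<Longrightarrow> Q \<in> mod_class R P M \<longleftrightarrow> mod_sim R P Q M"
  using class_eq_sim[OF _ mod_isomorphic_refl] by simp

lemma sum_copy:
  assumes "P M" "P N"
  obtains X where "P X" "mod_isomorphic R X (direct_sum M N)"
proof -
  obtain X :: "'a umodule" where X: "left_module R X" "mod_isomorphic R X (direct_sum M N)"
    by (rule fin_gen_copy[OF fin_gen_direct_sum[OF P_fin_gen[OF assms(1)] P_fin_gen[OF assms(2)]]])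
  from P_sum[OF assms X(2,1)] X(2) show ?thesis by (rule that)
qed

text \<open>Adding \<open>K\<close> to every member of a chain leaves the type, so each intermediate
  sum is replaced by a copy \<open>Z\<close>. The end \<open>Y\<close> varies in the induction
  because the copy changes with the member.\<close>

lemma preceq_translate:
  assumes "mod_preceq R P M N" and K: "P K"
    and X: "left_module R X" "mod_isomorphic R X (direct_sum M K)"
    and Y: "left_module R Y" "mod_isomorphic R Y (direct_sum N K)"
  shows "mod_preceq R P X Y"
proof -
  have M: "P M" and "(chain_step R P)\<^sup>*\<^sup>* M N" using assms(1) unfolding mod_preceq_iff by auto
  have PX: "P X" by (rule P_sum[OF M K X(2,1)])
  from \<open>(chain_step R P)\<^sup>*\<^sup>* M N\<close> Y show ?thesis
  proof (induction arbitrary: Y rule: rtranclp_induct)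
    case base
    show ?case by (rule preceq_iso[OF PX iso_common[OF X(2) base(2,1)] base(1)])
  next
    case (step N N')
    then have N: "P N" "P N'" "mod_lesssim R N N'" by (simp_all add: chain_step_def)
    obtain Z where Z: "P Z" "mod_isomorphic R Z (direct_sum N K)" by (rule sum_copy[OF N(1) K])
    note lZ = P_left_module[OF Z(1)]
    have PY: "P Y" by (rule P_sum[OF N(2) K step.prems(2,1)])
    have "mod_preceq R P X Z" by (rule step.IH[OF lZ Z(2)])
    moreover have "mod_lesssim R Z Y"
      by (rule mod_lesssim_cong[OF mod_lesssim_direct_sum[OF N(3) P_left_module[OF K]]
            mod_isomorphic_sym[OF Z(2) lZ] mod_isomorphic_sym[OF step.prems(2,1)] lZ step.prems(1)])
    then have "mod_preceq R P Z Y" by (rule mod_preceq_step[of P, OF Z(1) PY])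
    ultimately show ?case by (rule mod_preceq_trans)
  qed
qed

text \<open>One summand is changed at a time; commutativity brings the second into first
  position.\<close>

lemma preceq_direct_sum:
  assumes MM': "mod_preceq R P M M'" and NN': "mod_preceq R P N N'"
    and X: "left_module R X" "mod_isomorphic R X (direct_sum M N)"
    and X': "left_module R X'" "mod_isomorphic R X' (direct_sum M' N')"
  shows "mod_preceq R P X X'"
proof -
  have P: "P M'" "P N" using mod_preceq_imp[OF MM'] mod_preceq_imp[OF NN'] by simp_all
  obtain Z where Z: "P Z" "mod_isomorphic R Z (direct_sum M' N)" by (rule sum_copy[OF P])
  note lZ = P_left_module[OF Z(1)]
  have "mod_preceq R P X Z" by (rule preceq_translate[OF MM' P(2) X lZ Z(2)])
  moreover have "mod_preceq R P Z X'"
    by (rule preceq_translate[OF NN' P(1) lZ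
          mod_isomorphic_trans[OF Z(2) mod_isomorphic_direct_sum_comm] X'(1)
          mod_isomorphic_trans[OF X'(2) mod_isomorphic_direct_sum_comm]])
  ultimately show ?thesis by (rule mod_preceq_trans)
qed

lemma class_direct_sum_sim:
  assumes "mod_sim R P M M'" "mod_sim R P N N'"
  shows "mod_class R P (direct_sum M N) = mod_class R P (direct_sum M' N')"
proof -
  have P: "P M" "P N" "P M'" "P N'" using sim_imp[OF assms(1)] sim_imp[OF assms(2)] by simp_all
  obtain X where X: "P X" "mod_isomorphic R X (direct_sum M N)" by (rule sum_copy[OF P(1,2)])
  obtain X' where X': "P X'" "mod_isomorphic R X' (direct_sum M' N')" by (rule sum_copy[OF P(3,4)])
  note lX = P_left_module[OF X(1)] P_left_module[OF X'(1)]
  have "mod_sim R P X X'"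
    using assms preceq_direct_sum[OF _ _ lX(1) X(2) lX(2) X'(2)]
      preceq_direct_sum[OF _ _ lX(2) X'(2) lX(1) X(2)]
    unfolding mod_sim_def by simp
  then show ?thesis
    by (simp only: class_copy[OF X] class_copy[OF X'] class_eq_iff[OF X(1) X'(1)])
qed

section \<open>The ordered monoid of classes\<close>

abbreviation "W \<equiv> class_monoid R P"

lemma carrier_W: "carrier W = {mod_class R P M | M. P M}"
  by (simp add: class_monoid_def)

lemma class_in_W: "P M \<Longrightarrow> mod_class R P M \<in> carrier W"
  unfolding carrier_W by blast

text \<open>By \<open>class_direct_sum_sim\<close> the union in the definition runs over copies of
  one and the same set, and the family is nonempty because \<open>M\<close> and \<open>N\<close> lie
  in their own classes.\<close>

lemma mult_W:
  assumes "P M" "P N"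
  shows "mod_class R P M \<otimes>\<^bsub>W\<^esub> mod_class R P N = mod_class R P (direct_sum M N)"
proof -
  have sum: "mod_class R P (direct_sum A B) = mod_class R P (direct_sum M N)"
    if "A \<in> mod_class R P M" "B \<in> mod_class R P N" for A B
    using class_direct_sum_sim[of A M B N] that assms by (simp add: mem_class_iff)
  have mem: "M \<in> mod_class R P M" "N \<in> mod_class R P N"
    using assms sim_refl by (simp_all add: mem_class_iff)
  have "(\<Union>A\<in>mod_class R P M. \<Union>B\<in>mod_class R P N. mod_class R P (direct_sum A B)) =
      mod_class R P (direct_sum M N)"
  proof (intro equalityI UN_least)
    show "mod_class R P (direct_sum A B) \<subseteq> mod_class R P (direct_sum M N)"
      if "A \<in> mod_class R P M" "B \<in> mod_class R P N" for A B
      using sum[OF that] by simp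
    show "mod_class R P (direct_sum M N) \<subseteq>
        (\<Union>A\<in>mod_class R P M. \<Union>B\<in>mod_class R P N. mod_class R P (direct_sum A B))"
      using mem by blast
  qed
  then show ?thesis by (simp add: class_monoid_def)
qed

lemma mult_W_copy:
  assumes "P M" "P N" "P X" "mod_isomorphic R X (direct_sum M N)"
  shows "mod_class R P M \<otimes>\<^bsub>W\<^esub> mod_class R P N = mod_class R P X"
  by (simp only: mult_W[OF assms(1,2)] class_copy[OF assms(3,4)])

lemma le_W:
  assumes "P M" "P N"
  shows "mon_le W (mod_class R P M) (mod_class R P N) \<longleftrightarrow> mod_preceq R P M N"
proof -
  have le: "mon_le W (mod_class R P M) (mod_class R P N) \<longleftrightarrow>
      (\<exists>A\<in>mod_class R P M. \<exists>B\<in>mod_class R P N. mod_preceq R P A B)"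
    by (simp add: class_monoid_def)
  show ?thesis
    unfolding le
  proof
    assume "\<exists>A\<in>mod_class R P M. \<exists>B\<in>mod_class R P N. mod_preceq R P A B"
    then obtain A B where "A \<in> mod_class R P M" "B \<in> mod_class R P N" "mod_preceq R P A B"
      by blast
    then have "mod_preceq R P M A" "mod_preceq R P A B" "mod_preceq R P B N"
      using assms by (simp_all add: mem_class_iff mod_sim_def)
    then show "mod_preceq R P M N" by (blast intro: mod_preceq_trans)
  next
    assume "mod_preceq R P M N"
    moreover have "M \<in> mod_class R P M" "N \<in> mod_class R P N"
      using assms sim_refl by (simp_all add: mem_class_iff)
    ultimately show "\<exists>A\<in>mod_class R P M. \<exists>B\<in>mod_class R P N. mod_preceq R P A B"
      by blast
  qed
qed

lemma zero_copy: obtains Z where "P Z" "mod_isomorphic R Z zero_module" "\<one>\<^bsub>W\<^esub> = mod_class R P Z"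
proof -
  obtain Z :: "'a umodule" where Z: "left_module R Z" "mod_isomorphic R Z zero_module"
    by (rule fin_gen_copy[OF fin_pres_imp_fin_gen[OF fin_pres_zero[OF R]]])
  have P: "P Z" by (rule P_zero[OF Z(2,1)])
  have "\<one>\<^bsub>W\<^esub> = mod_class R P Z"
    using class_copy[OF P Z(2)] by (simp add: class_monoid_def)
  with P Z(2) show ?thesis by (rule that)
qed

lemma regular_copy:
  obtains U where "P U" "mod_isomorphic R U (regular_module R)" "ord_unit W = mod_class R P U"
proof -
  obtain U :: "'a umodule" where U: "left_module R U" "mod_isomorphic R U (regular_module R)"
    by (rule fin_gen_copy[OF fin_pres_imp_fin_gen[OF fin_pres_regular[OF R]]])
  have P: "P U" by (rule P_regular[OF U(2,1)])
  have "ord_unit W = mod_class R P U"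
    using class_copy[OF P U(2)] by (simp add: class_monoid_def)
  with P U(2) show ?thesis by (rule that)
qed

lemma W_cases:
  assumes "x \<in> carrier W"
  obtains M where "P M" "x = mod_class R P M"
  using assms unfolding carrier_W by blast

lemma comm_monoid_W: "comm_monoid W"
proof (rule comm_monoidI)
  fix x y assume "x \<in> carrier W" "y \<in> carrier W"
  then obtain M N where M: "P M" "x = mod_class R P M" and N: "P N" "y = mod_class R P N"
    by (elim W_cases)
  obtain X where X: "P X" "mod_isomorphic R X (direct_sum M N)" by (rule sum_copy[OF M(1) N(1)])
  have xy: "x \<otimes>\<^bsub>W\<^esub> y = mod_class R P X" unfolding M(2) N(2) by (rule mult_W_copy[OF M(1) N(1) X])
  then show "x \<otimes>\<^bsub>W\<^esub> y \<in> carrier W" using class_in_W[OF X(1)] by simp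
  have "y \<otimes>\<^bsub>W\<^esub> x = mod_class R P X" unfolding M(2) N(2)
    by (rule mult_W_copy[OF N(1) M(1) X(1)
          mod_isomorphic_trans[OF X(2) mod_isomorphic_direct_sum_comm]])
  with xy show "x \<otimes>\<^bsub>W\<^esub> y = y \<otimes>\<^bsub>W\<^esub> x" by simp
  fix z assume "z \<in> carrier W"
  then obtain K where K: "P K" "z = mod_class R P K" by (elim W_cases)
  obtain Y where Y: "P Y" "mod_isomorphic R Y (direct_sum N K)" by (rule sum_copy[OF N(1) K(1)])
  \<comment> \<open>\<open>V\<close> is a copy of both bracketings, so both products are its
    class.\<close>
  obtain V where V: "P V" "mod_isomorphic R V (direct_sum X K)" by (rule sum_copy[OF X(1) K(1)])
  note l = P_left_module
  have "mod_isomorphic R V (direct_sum (direct_sum M N) K)"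
    by (rule mod_isomorphic_trans[OF V(2)
          mod_isomorphic_direct_sum[OF X(2) mod_isomorphic_refl l[OF X(1)] l[OF K(1)]]])
  then have "mod_isomorphic R V (direct_sum M (direct_sum N K))"
    by (rule mod_isomorphic_trans[OF _ mod_isomorphic_direct_sum_assoc])
  then have "mod_isomorphic R V (direct_sum M Y)"
    by (rule iso_common[OF _ mod_isomorphic_direct_sum[OF mod_isomorphic_refl Y(2) l[OF M(1)] l[OF Y(1)]]
          left_module_direct_sum[OF l[OF M(1)] l[OF Y(1)]]])
  then have "x \<otimes>\<^bsub>W\<^esub> mod_class R P Y = mod_class R P V"
    unfolding M(2) by (rule mult_W_copy[OF M(1) Y(1) V(1)])
  moreover have "mod_class R P X \<otimes>\<^bsub>W\<^esub> z = mod_class R P V"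
    unfolding K(2) by (rule mult_W_copy[OF X(1) K(1) V])
  moreover have "y \<otimes>\<^bsub>W\<^esub> z = mod_class R P Y"
    unfolding N(2) K(2) by (rule mult_W_copy[OF N(1) K(1) Y])
  ultimately show "x \<otimes>\<^bsub>W\<^esub> y \<otimes>\<^bsub>W\<^esub> z = x \<otimes>\<^bsub>W\<^esub> (y \<otimes>\<^bsub>W\<^esub> z)" by (simp only: xy)
next
  obtain Z where Z: "P Z" "mod_isomorphic R Z zero_module" "\<one>\<^bsub>W\<^esub> = mod_class R P Z"
    by (rule zero_copy)
  then show "\<one>\<^bsub>W\<^esub> \<in> carrier W" using class_in_W by simp
  fix x assume "x \<in> carrier W"
  then obtain M where M: "P M" "x = mod_class R P M" by (elim W_cases)
  note l = P_left_module[OF Z(1)] P_left_module[OF M(1)]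
  have "mod_isomorphic R (direct_sum Z M) (direct_sum zero_module M)"
    by (rule mod_isomorphic_direct_sum[OF Z(2) mod_isomorphic_refl l])
  then have "mod_isomorphic R (direct_sum Z M) M"
    by (rule mod_isomorphic_trans[OF _ mod_isomorphic_direct_sum_zero[OF l(2)]])
  then have "mod_isomorphic R M (direct_sum Z M)"
    by (rule mod_isomorphic_sym[OF _ left_module_direct_sum[OF l]])
  then show "\<one>\<^bsub>W\<^esub> \<otimes>\<^bsub>W\<^esub> x = x"
    unfolding Z(3) M(2) by (rule mult_W_copy[OF Z(1) M(1) M(1)])
qed

text \<open>Powers in the multiplicative notation are multiples of the class of the regular module,
  that is, classes of free modules. This turns the order-unit property into the existence of finite
  covers.\<close>

lemma unit_pow:
  "\<exists>X. P X \<and> mod_isomorphic R X (free_module R n) \<and> ord_unit W [^]\<^bsub>W\<^esub> n = mod_class R P X"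
proof (induction n)
  interpret W: comm_monoid W by (rule comm_monoid_W)
  case 0
  obtain Z where Z: "P Z" "mod_isomorphic R Z zero_module" "\<one>\<^bsub>W\<^esub> = mod_class R P Z"
    by (rule zero_copy)
  have "mod_isomorphic R Z (free_module R 0)"
    by (rule mod_isomorphic_trans[OF Z(2) mod_isomorphic_free_zero[OF R]])
  then show ?case using Z by (intro exI[of _ Z]) simp
next
  interpret W: comm_monoid W by (rule comm_monoid_W)
  case (Suc n)
  then obtain X where X: "P X" "mod_isomorphic R X (free_module R n)"
    "ord_unit W [^]\<^bsub>W\<^esub> n = mod_class R P X" by blast
  obtain U where U: "P U" "mod_isomorphic R U (regular_module R)" "ord_unit W = mod_class R P U"
    by (rule regular_copy)
  obtain Y where Y: "P Y" "mod_isomorphic R Y (direct_sum X U)" by (rule sum_copy[OF X(1) U(1)])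
  have "mod_isomorphic R (direct_sum X U) (direct_sum (free_module R n) (free_module R 1))"
    by (rule mod_isomorphic_direct_sum[OF X(2) mod_isomorphic_trans[OF U(2) mod_isomorphic_free_one]
          P_left_module[OF X(1)] P_left_module[OF U(1)]])
  then have "mod_isomorphic R (direct_sum X U) (free_module R (n + 1))"
    by (rule mod_isomorphic_trans[OF _ mod_isomorphic_free_add])
  then have "mod_isomorphic R Y (free_module R (n + 1))" by (rule mod_isomorphic_trans[OF Y(2)])
  moreover have "ord_unit W [^]\<^bsub>W\<^esub> Suc n = mod_class R P Y"
    using mult_W_copy[OF X(1) U(1) Y] X(3) U(3) by (simp only: W.nat_pow_Suc)
  ultimately show ?case using Y(1) by (intro exI[of _ Y]) simp
qed

lemma po_comm_monoid_W: "po_comm_monoid_with_unit W"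
proof (intro po_comm_monoid_with_unit.intro comm_monoid_W po_comm_monoid_with_unit_axioms.intro)
  interpret W: comm_monoid W by (rule comm_monoid_W)
  fix x assume "x \<in> carrier W"
  then obtain M where M: "P M" "x = mod_class R P M" by (elim W_cases)
  show "mon_le W x x" unfolding M(2) le_W[OF M(1) M(1)] by (rule mod_preceq_refl[of P, OF M(1)])
  show "\<exists>n::nat. mon_le W x (ord_unit W [^]\<^bsub>W\<^esub> n)"
  proof -
    obtain n p where p: "p \<in> mod_hom R (free_module R n) M" "p ` carrier (free_module R n) = carrier M"
      by (rule fin_gen_cover[OF P_fin_gen[OF M(1)]])
    obtain X where X: "P X" "mod_isomorphic R X (free_module R n)"
      "ord_unit W [^]\<^bsub>W\<^esub> n = mod_class R P X" using unit_pow by blast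
    note l = P_left_module[OF M(1)] P_left_module[OF X(1)]
    have "mod_lesssim R M X"
      by (rule mod_lesssim_cong[OF surj_imp_lesssim[OF l(1) left_module_free[OF R] p]
            mod_isomorphic_refl mod_isomorphic_sym[OF X(2) l(2)] l])
    then have "mod_preceq R P M X" by (rule mod_preceq_step[of P, OF M(1) X(1)])
    then show ?thesis unfolding M(2) using X(3) le_W[OF M(1) X(1)] by metis
  qed
  fix y assume "y \<in> carrier W"
  then obtain N where N: "P N" "y = mod_class R P N" by (elim W_cases)
  show "x = y" if "mon_le W x y" "mon_le W y x"
    using that unfolding M(2) N(2) le_W[OF M(1) N(1)] le_W[OF N(1) M(1)] class_eq_iff[OF M(1) N(1)]
    by (simp add: mod_sim_def)
  fix z assume "z \<in> carrier W"
  then obtain K where K: "P K" "z = mod_class R P K" by (elim W_cases)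
  show "mon_le W x z" if "mon_le W x y" "mon_le W y z"
    using that unfolding M(2) N(2) K(2) le_W[OF M(1) N(1)] le_W[OF N(1) K(1)] le_W[OF M(1) K(1)]
    by (rule mod_preceq_trans)
  show "mon_le W (x \<otimes>\<^bsub>W\<^esub> z) (y \<otimes>\<^bsub>W\<^esub> z)" if le: "mon_le W x y"
  proof -
    obtain X where X: "P X" "mod_isomorphic R X (direct_sum M K)" by (rule sum_copy[OF M(1) K(1)])
    obtain Y where Y: "P Y" "mod_isomorphic R Y (direct_sum N K)" by (rule sum_copy[OF N(1) K(1)])
    have "mod_preceq R P M N" using le unfolding M(2) N(2) le_W[OF M(1) N(1)] .
    then have "mod_preceq R P X Y"
      by (rule preceq_translate[OF _ K(1) P_left_module[OF X(1)] X(2) P_left_module[OF Y(1)] Y(2)])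
    then show ?thesis
      unfolding M(2) N(2) K(2) mult_W_copy[OF M(1) K(1) X] mult_W_copy[OF N(1) K(1) Y]
        le_W[OF X(1) Y(1)] .
  qed
next
  obtain U where U: "P U" "mod_isomorphic R U (regular_module R)" "ord_unit W = mod_class R P U"
    by (rule regular_copy)
  obtain Z where Z: "P Z" "mod_isomorphic R Z zero_module" "\<one>\<^bsub>W\<^esub> = mod_class R P Z"
    by (rule zero_copy)
  show "ord_unit W \<in> carrier W" unfolding U(3) by (rule class_in_W[OF U(1)])
  note lU = P_left_module[OF U(1)] and lZ = P_left_module[OF Z(1)]
  have "(\<lambda>_. ()) \<in> mod_hom R U zero_module" by (rule mod_homI) (auto simp: zero_module_def)
  \<comment> \<open>Surjectivity onto the one-point module needs a nonempty carrier of
    \<open>U\<close>; the instance of \<open>mod_homD\<close> supplies its zero.\<close>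
  moreover have "(\<lambda>_. ()) ` carrier U = carrier (zero_module :: ('a, unit) module)"
    using mod_homD(1)[OF mod_hom_const_zero[OF lU], of undefined zero_module]
    by (auto simp: zero_module_def)
  ultimately have "mod_lesssim R zero_module U"
    by (rule surj_imp_lesssim[OF left_module_zero[OF R] lU])
  then have "mod_lesssim R Z U"
    by (rule mod_lesssim_cong[OF _ mod_isomorphic_sym[OF Z(2) lZ] mod_isomorphic_refl lZ lU])
  then have "mod_preceq R P Z U" by (rule mod_preceq_step[of P, OF Z(1) U(1)])
  then show "mon_le W \<one>\<^bsub>W\<^esub> (ord_unit W)" unfolding U(3) Z(3) le_W[OF Z(1) U(1)] .
qed

end

section \<open>The two instances and the map between them\<close>

lemma module_class_fin_gen:
  assumes "ring R"
  shows "module_class R (fin_gen R)"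
proof (rule module_class.intro)
  fix X M N :: "'a umodule"
  show "fin_gen R M \<Longrightarrow> mod_isomorphic R M N \<Longrightarrow> left_module R N \<Longrightarrow> fin_gen R N"
    by (rule fin_gen_isomorphic)
  assume X: "left_module R X"
  show "fin_gen R X" if "fin_gen R M" "fin_gen R N" "mod_isomorphic R X (direct_sum M N)"
    by (rule fin_gen_isomorphic[OF fin_gen_direct_sum[OF that(1,2)] mod_isomorphic_sym[OF that(3) X] X])
  show "fin_gen R X" if "mod_isomorphic R X zero_module"
    by (rule fin_gen_isomorphic[OF fin_pres_imp_fin_gen[OF fin_pres_zero[OF assms]]
          mod_isomorphic_sym[OF that X] X])
  show "fin_gen R X" if "mod_isomorphic R X (regular_module R)"
    by (rule fin_gen_isomorphic[OF fin_pres_imp_fin_gen[OF fin_pres_regular[OF assms]]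
          mod_isomorphic_sym[OF that X] X])
qed (fact assms)

lemma module_class_fin_pres:
  assumes "ring R"
  shows "module_class R (fin_pres R)"
proof (rule module_class.intro)
  fix X M N :: "'a umodule"
  show "fin_pres R M \<Longrightarrow> fin_gen R M" by (rule fin_pres_imp_fin_gen)
  show "fin_pres R M \<Longrightarrow> mod_isomorphic R M N \<Longrightarrow> left_module R N \<Longrightarrow> fin_pres R N"
    by (rule fin_pres_isomorphic)
  assume X: "left_module R X"
  show "fin_pres R X" if "fin_pres R M" "fin_pres R N" "mod_isomorphic R X (direct_sum M N)"
    by (rule fin_pres_isomorphic[OF fin_pres_direct_sum[OF that(1,2)] mod_isomorphic_sym[OF that(3) X] X])
  show "fin_pres R X" if "mod_isomorphic R X zero_module"
    by (rule fin_pres_isomorphic[OF fin_pres_zero[OF assms] mod_isomorphic_sym[OF that X] X])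
  show "fin_pres R X" if "mod_isomorphic R X (regular_module R)"
    by (rule fin_pres_isomorphic[OF fin_pres_regular[OF assms] mod_isomorphic_sym[OF that X] X])
qed (fact assms)

text \<open>A single copy represents both classes of \<open>Y\<close>, so statements about modules
  on arbitrary types reduce to \<open>umodule\<close>.\<close>

lemma fin_pres_copy:
  fixes R :: "('a, 'r) ring_scheme"
  assumes "fin_pres R Y"
  obtains X :: "'a umodule" where "fin_pres R X" "mod_isomorphic R X Y"
    "fp_class R Y = fp_class R X" "fg_class R Y = fg_class R X"
proof -
  have "left_module R Y" using assms by (simp add: fin_pres_def)
  then have R: "ring R" by (rule left_module.axioms(1))
  obtain X :: "'a umodule" where X: "left_module R X" "mod_isomorphic R X Y"
    by (rule fin_gen_copy[OF fin_pres_imp_fin_gen[OF assms]])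
  have fp: "fin_pres R X" by (rule fin_pres_isomorphic[OF assms mod_isomorphic_sym[OF X(2,1)] X(1)])
  show ?thesis
    by (rule that[OF fp X(2)])
      (simp_all only: fp_class_def fg_class_def fp fin_pres_imp_fin_gen
        module_class.class_copy[OF module_class_fin_pres[OF R] fp X(2)]
        module_class.class_copy[OF module_class_fin_gen[OF R] fin_pres_imp_fin_gen[OF fp] X(2)])
qed

lemma mod_preceq_fin_pres_iff_fin_gen:
  fixes M N :: "'a umodule"
  assumes "fin_pres R M" "fin_pres R N"
  shows "mod_preceq R (fin_pres R) M N \<longleftrightarrow> mod_preceq R (fin_gen R) M N"
proof
  assume "mod_preceq R (fin_pres R) M N"
  then show "mod_preceq R (fin_gen R) M N"
    by (rule mod_preceq_mono) (rule fin_pres_imp_fin_gen)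
qed (rule mod_preceq_fin_gen_imp_fin_pres[OF assms])

text \<open>The order comparison in both directions; one implication makes the map well defined, the
  other makes it injective.\<close>

lemma fp_class_eq_iff_fg_class_eq:
  fixes M N :: "'a umodule"
  assumes "fin_pres R M" "fin_pres R N"
  shows "fp_class R M = fp_class R N \<longleftrightarrow> fg_class R M = fg_class R N"
proof -
  have "left_module R M" using assms by (simp add: fin_pres_def)
  then have R: "ring R" by (rule left_module.axioms(1))
  have "mod_sim R (fin_pres R) M N \<longleftrightarrow> mod_sim R (fin_gen R) M N"
    unfolding mod_sim_def
    by (simp only: mod_preceq_fin_pres_iff_fin_gen[OF assms]
        mod_preceq_fin_pres_iff_fin_gen[OF assms(2,1)])
  then show ?thesis
    unfolding fp_class_def fg_class_def
      module_class.class_eq_iff[OF module_class_fin_pres[OF R] assms]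
      module_class.class_eq_iff[OF module_class_fin_gen[OF R] assms[THEN fin_pres_imp_fin_gen]] .
qed

text \<open>\<open>the_elem\<close> is meaningful here: all members of the class are equivalent
  through finitely presented chains, hence share one finitely generated class, and the class is
  nonempty.\<close>

lemma VM_to_UM_fp_class:
  assumes "fin_pres R M"
  shows "VM_to_UM R (fp_class R M) = fg_class R M"
proof -
  have "left_module R M" using assms by (simp add: fin_pres_def)
  then have R: "ring R" by (rule left_module.axioms(1))
  interpret FP: module_class R "fin_pres R" by (rule module_class_fin_pres[OF R])
  obtain X :: "'a umodule" where X: "fin_pres R X" "fp_class R M = fp_class R X"
    "fg_class R M = fg_class R X" by (rule fin_pres_copy[OF assms])
  have "fg_class R Q = fg_class R X" if "Q \<in> fp_class R X" for Q
  proof -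
    have sim: "mod_sim R (fin_pres R) Q X"
      using that FP.mem_class_iff[OF X(1)] by (simp add: fp_class_def)
    have Q: "fin_pres R Q" using FP.sim_imp[OF sim] by simp
    have "fp_class R Q = fp_class R X"
      using sim FP.class_eq_iff[OF Q X(1)] by (simp add: fp_class_def)
    then show ?thesis using fp_class_eq_iff_fg_class_eq[OF Q X(1)] by simp
  qed
  moreover have "X \<in> fp_class R X"
    unfolding fp_class_def FP.mem_class_iff[OF X(1)] by (rule FP.sim_refl[OF X(1)])
  ultimately have "fg_class R ` fp_class R X = {fg_class R X}" by blast
  then show ?thesis unfolding VM_to_UM_def X(2,3) by simp
qed

theorem theorem7p3:
  fixes R :: "('a, 'r) ring_scheme" (structure)
  assumes "ring R" and "\<one> \<noteq> \<zero>"
  shows "po_comm_monoid_with_unit (VM R) \<and> po_comm_monoid_with_unit (UM R) \<and>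
    (\<forall>(M :: ('a, 'x) module) (N :: ('a, 'y) module). fin_pres R M \<longrightarrow> fin_pres R N \<longrightarrow>
       fp_class R M = fp_class R N \<longrightarrow> fg_class R M = fg_class R N) \<and>
    (\<forall>M :: ('a, 'x) module. fin_pres R M \<longrightarrow> VM_to_UM R (fp_class R M) = fg_class R M) \<and>
    VM_to_UM R \<in> hom (VM R) (UM R) \<and>
    VM_to_UM R \<one>\<^bsub>VM R\<^esub> = \<one>\<^bsub>UM R\<^esub> \<and>
    VM_to_UM R (ord_unit (VM R)) = ord_unit (UM R) \<and>
    inj_on (VM_to_UM R) (carrier (VM R)) \<and>
    (\<forall>(M :: ('a, 'x) module) (N :: ('a, 'y) module). fin_pres R M \<longrightarrow> fin_pres R N \<longrightarrow>
       mon_le (VM R) (fp_class R M) (fp_class R N) = mon_le (UM R) (fg_class R M) (fg_class R N))"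
proof -
  interpret FP: module_class R "fin_pres R" by (rule module_class_fin_pres[OF assms(1)])
  interpret FG: module_class R "fin_gen R" by (rule module_class_fin_gen[OF assms(1)])
  note defs = VM_def UM_def fp_class_def fg_class_def
  have V_cases: "\<exists>M :: 'a umodule. fin_pres R M \<and> x = fp_class R M" if "x \<in> carrier (VM R)" for x
    using that unfolding defs FP.carrier_W by blast
  have 1: "fg_class R M = fg_class R N"
    if "fin_pres R M" "fin_pres R N" "fp_class R M = fp_class R N"
    for M :: "('a, 'x) module" and N :: "('a, 'y) module"
    using VM_to_UM_fp_class[OF that(1)] VM_to_UM_fp_class[OF that(2)] that(3) by simp
  have 2: "VM_to_UM R \<in> hom (VM R) (UM R)"
  proof (rule homI)
    fix x assume "x \<in> carrier (VM R)"
    then obtain M :: "'a umodule" where M: "fin_pres R M" "x = fp_class R M" using V_cases by blast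
    show "VM_to_UM R x \<in> carrier (UM R)"
      unfolding M(2) VM_to_UM_fp_class[OF M(1)] unfolding defs
      by (rule FG.class_in_W[OF fin_pres_imp_fin_gen[OF M(1)]])
    fix y assume "y \<in> carrier (VM R)"
    then obtain N :: "'a umodule" where N: "fin_pres R N" "y = fp_class R N" using V_cases by blast
    have "x \<otimes>\<^bsub>VM R\<^esub> y = fp_class R (direct_sum M N)"
      unfolding M(2) N(2) defs by (rule FP.mult_W[OF M(1) N(1)])
    moreover have "fg_class R M \<otimes>\<^bsub>UM R\<^esub> fg_class R N = fg_class R (direct_sum M N)"
      unfolding defs by (rule FG.mult_W[OF M(1)[THEN fin_pres_imp_fin_gen] N(1)[THEN fin_pres_imp_fin_gen]])
    ultimately show "VM_to_UM R (x \<otimes>\<^bsub>VM R\<^esub> y) = VM_to_UM R x \<otimes>\<^bsub>UM R\<^esub> VM_to_UM R y"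
      unfolding M(2) N(2)
      by (simp only: VM_to_UM_fp_class[OF M(1)] VM_to_UM_fp_class[OF N(1)]
          VM_to_UM_fp_class[OF fin_pres_direct_sum[OF M(1) N(1)]])
  qed
  \<comment> \<open>The zero and regular modules have carrier types of their own; the formula for
    the map holds on every type and applies to them directly.\<close>
  have 3: "VM_to_UM R \<one>\<^bsub>VM R\<^esub> = \<one>\<^bsub>UM R\<^esub>"
    using VM_to_UM_fp_class[OF fin_pres_zero[OF assms(1)]] by (simp add: defs class_monoid_def)
  have 4: "VM_to_UM R (ord_unit (VM R)) = ord_unit (UM R)"
    using VM_to_UM_fp_class[OF fin_pres_regular[OF assms(1)]] by (simp add: defs class_monoid_def)
  have 5: "inj_on (VM_to_UM R) (carrier (VM R))"
  proof (rule inj_onI)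
    fix x y assume "x \<in> carrier (VM R)" "y \<in> carrier (VM R)" and eq: "VM_to_UM R x = VM_to_UM R y"
    then obtain M N :: "'a umodule" where M: "fin_pres R M" "x = fp_class R M"
      and N: "fin_pres R N" "y = fp_class R N"
      using V_cases by blast
    have "fg_class R M = fg_class R N"
      using eq unfolding M(2) N(2) VM_to_UM_fp_class[OF M(1)] VM_to_UM_fp_class[OF N(1)] .
    then show "x = y" unfolding M(2) N(2) fp_class_eq_iff_fg_class_eq[OF M(1) N(1)] .
  qed
  \<comment> \<open>Both \<open>le_W\<close> and the comparison of chains concern
    \<open>umodule\<close>, so \<open>M\<close> and \<open>N\<close> are first replaced by
    copies.\<close>
  have 6: "mon_le (VM R) (fp_class R M) (fp_class R N) = mon_le (UM R) (fg_class R M) (fg_class R N)"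
    if MN: "fin_pres R M" "fin_pres R N" for M :: "('a, 'x) module" and N :: "('a, 'y) module"
  proof -
    obtain X :: "'a umodule" where X: "fin_pres R X" "fp_class R M = fp_class R X"
      "fg_class R M = fg_class R X" by (rule fin_pres_copy[OF MN(1)])
    obtain Y :: "'a umodule" where Y: "fin_pres R Y" "fp_class R N = fp_class R Y"
      "fg_class R N = fg_class R Y" by (rule fin_pres_copy[OF MN(2)])
    have "mon_le (VM R) (fp_class R X) (fp_class R Y) \<longleftrightarrow> mod_preceq R (fin_pres R) X Y"
      unfolding defs by (rule FP.le_W[OF X(1) Y(1)])
    also have "\<dots> \<longleftrightarrow> mod_preceq R (fin_gen R) X Y"
      by (rule mod_preceq_fin_pres_iff_fin_gen[OF X(1) Y(1)])
    also have "\<dots> \<longleftrightarrow> mon_le (UM R) (fg_class R X) (fg_class R Y)"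
      unfolding defs
      by (rule FG.le_W[OF X(1)[THEN fin_pres_imp_fin_gen] Y(1)[THEN fin_pres_imp_fin_gen], symmetric])
    finally show ?thesis unfolding X(2,3) Y(2,3) .
  qed
  have 7: "po_comm_monoid_with_unit (VM R)" unfolding VM_def by (rule FP.po_comm_monoid_W)
  have 8: "po_comm_monoid_with_unit (UM R)" unfolding UM_def by (rule FG.po_comm_monoid_W)
  show ?thesis
    by (intro conjI allI impI 7 8 1 VM_to_UM_fp_class 2 3 4 5 6)
qed

end
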